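(* Let $g:X\to\mathbb R$ be a continuous function such that every sublevel set $X_{\le a}=g^{-1}((-\infty,a])$ is locally path-connected with finitely many connected components and the component structure changes at only finitely many parameter values. Let $\mathfrak F=(K,f,\prec,\Bbbk,\mathcal R)$ be reduction data such that the component evolution of the cellular filtration $\{K_t\}$ agrees with that of $\{X_{\le t}\}$, and such that the reduction is zero-column preserving in dimension zero, i.e. $V_i=e_i$ (equivalently $z_i=\sigma_i$) for every positive $0$-cell $\sigma_i$. Suppose the elder rule for $g$ uses the same tie-breaking order $\prec$. Then the $0$-th persistence pairing graph $\mathcal G^{(0)}(\mathfrak F)$ is isomorphic to the elder-rule branch graph $\mathcal B_g$, and every edge has coefficient $1\in\Bbbk$. Consequently, if the component structure eventually stabilizes to one component, $\mathcal G^{(0)}(\mathfrak F)$ is a rooted directed tree whose edges are oriented toward its unique root; if several terminal components remain, it is a rooted directed forest with one root for each terminal component.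
   Context: Reduction data. $K$ is a finite CW complex with fixed cell orientations and set of open cells $\mathcal K$; $\Bbbk$ is a field; homology is cellular homology over $\Bbbk$. $f:\mathcal K\to\mathbb R$ is a filtration function: $\tau\subseteq\overline\sigma$ implies $f(\tau)\le f(\sigma)$; its values are called filtration values. $K_t$ (resp. $K_{t^-}$) is the union of the cells $\sigma$ with $f(\sigma)\le t$ (resp. $f(\sigma)<t$), and $i_t:K_{t^-}\hookrightarrow K_t$ is the inclusion. The cells are totally ordered $\sigma_1\prec\dots\prec\sigma_N$ so that $f(\sigma_i)<f(\sigma_j)$ implies $i<j$, and $\sigma_i\subseteq\overline{\sigma_j}$, $\sigma_i\ne\sigma_j$ implies $i<j$. The sets $K_t$, $K_{t^-}$ and $\bigcup_{\ell\le p}\sigma_\ell$ are CW subcomplexes. The boundary matrix $D$ has entries $D_{ij}=[\sigma_j:\sigma_i]$ (cellular incidence coefficients). For a nonzero column $c$, $\operatorname{low}(c)=\max\{i\mid c_i\neq 0\}$; a matrix is reduced if no two nonzero columns have the same low. $\mathcal R=(R,V)$ is a factorization $R=DV$ with $R$ reduced and $V$ upper unitriangular and dimension preserving (column $V_i$ is supported on cells of the same dimension as $\sigma_i$). Columns are identified with chains; $e_i$ is the $i$-th coordinate vector. $\sigma_i$ is positive if $R_i=0$, with selected birth cycle $z_i:=V_i$; $\operatorname{pair}(i)=j$ if $\operatorname{low}(R_j)=i$ for some (unique) $j$ with $R_j\neq0$, and $\operatorname{pair}(i)=\infty$ otherwise. Persistence pairing graph (dimension $0$). $\mathcal V^{(0)}$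 is the set of labels $u$ of positive $0$-cells $\sigma_{i(u)}$ with $b_u<d_u$, where $b_u=f(\sigma_{i(u)})$ and $d_u=f(\sigma_{\operatorname{pair}(i(u))})$ (or $d_u=\infty$ if $\operatorname{pair}(i(u))=\infty$); $z_u:=z_{i(u)}$. For a filtration value $t$ let $\mathcal S_t^{(0)}=\{v\mid b_v<t<d_v\}$. The classes $[z_v]_t\in H_0(K_t;\Bbbk)$, $v\in\mathcal S_t^{(0)}$, form a basis of $\operatorname{im}\bigl((i_t)_*:H_0(K_{t^-};\Bbbk)\to H_0(K_t;\Bbbk)\bigr)$, and for $u$ with $d_u=t$ the transition coefficients $w_{uv}$ are defined by $(i_t)_*[z_u]_{t^-}=\sum_{v\in\mathcal S_t^{(0)}}w_{uv}[z_v]_t$. $\mathcal G^{(0)}(\mathfrak F)$ is the directed graph with vertex set $\mathcal V^{(0)}$ and an edge $u\to v$, with coefficient $w_{uv}$, whenever $d_u<\infty$, $b_v<d_u<d_v$ and $w_{uv}\ne0$. Agreement of component evolution. At the filtration values under consideration, the connected components of $K_t$ and of $X_{\le t}$ are in bijection, compatibly with the maps on components induced by inclusions, and the component structure of $\{X_{\le t}\}$ changes only at filtration values. Branch graph $\mathcal B_g$. As the parameter increases, a branch is born at value $t$ for each component of $X_{\le t}$ containing no component of $X_{\le s}$ for any $s<t$. When two or more components merge, the elder rule retains the branch with the earliest birth value and the remaining branches terminate; if several branches have the same birth value, their relative order is determined by $\prec$ (comparing the $\prec$-least vertices of the corresponding components of the cellular filtration at birth). The vertices of $\mathcal B_g$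 are the branches of nonzero length. When such a branch terminates at a value $t$, there is a directed edge from it to the unique nonzero branch labeling the connected component containing it immediately after the transition at $t$ (a simultaneous multiway merge gives one edge from each terminating nonzero branch to the branch retained after the entire merge event).
   Formalization: Agreement of component evolution is taken to include that X_{≤t} is empty for t below every filtration value (as K_t is); otherwise a component present at all levels is never born, e.g. X=ℝ, g=id, K a single vertex, and the claimed isomorphism fails. *)

theory Defs
  imports
    "HOL-Homology.Homology"
    "HOL-Algebra.Module"
    "HOL-Library.Extended_Real"
    "Jordan_Normal_Form.Matrix"
    "Graph_Theory.Graph_Theory"
begin

section \<open>Finite CW complexes\<close>

text \<open>As in \<^const>\<open>Euclidean_space\<close> and \<^const>\<open>nsphere\<close>, points of Euclidean \<open>n\<close>-space are
  functions \<open>nat \<Rightarrow> real\<close> that vanish from index \<open>n\<close> on.  For \<open>n = 0\<close> the closed and the open disk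
  are both the single point \<open>0\<close>, and the boundary sphere is empty.\<close>

definition sq_norm :: "nat \<Rightarrow> (nat \<Rightarrow> real) \<Rightarrow> real" where
  "sq_norm n x = (\<Sum>i<n. (x i)\<^sup>2)"

definition closed_disk :: "nat \<Rightarrow> (nat \<Rightarrow> real) topology" where
  "closed_disk n = subtopology (Euclidean_space n) {x. sq_norm n x \<le> 1}"

definition open_disk :: "nat \<Rightarrow> (nat \<Rightarrow> real) topology" where
  "open_disk n = subtopology (Euclidean_space n) {x. sq_norm n x < 1}"

definition boundary_sphere :: "nat \<Rightarrow> (nat \<Rightarrow> real) set" where
  "boundary_sphere n = {x \<in> topspace (Euclidean_space n). sq_norm n x = 1}"

text \<open>Cells are named by the elements of an index type; the open cell named \<open>c\<close> is the image of the
  open disk under the characteristic map.  The characteristic maps carry the cell orientations.\<close>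

record ('a, 'c) cell_structure =
  cw_space :: "'a topology"
  cw_cells :: "'c set"
  cw_dim :: "'c \<Rightarrow> nat"
  cw_char :: "'c \<Rightarrow> (nat \<Rightarrow> real) \<Rightarrow> 'a"

definition open_cell :: "('a, 'c) cell_structure \<Rightarrow> 'c \<Rightarrow> 'a set" where
  "open_cell K c = cw_char K c ` topspace (open_disk (cw_dim K c))"

text \<open>The weak topology condition is automatic because there are finitely many cells.\<close>

definition finite_cw_complex :: "('a, 'c) cell_structure \<Rightarrow> bool" where
  "finite_cw_complex K \<longleftrightarrow>
     Hausdorff_space (cw_space K) \<and> finite (cw_cells K) \<and>
     disjoint_family_on (open_cell K) (cw_cells K) \<and>
     (\<Union>c\<in>cw_cells K. open_cell K c) = topspace (cw_space K) \<and>
     (\<forall>c\<in>cw_cells K.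
        continuous_map (closed_disk (cw_dim K c)) (cw_space K) (cw_char K c) \<and>
        embedding_map (open_disk (cw_dim K c)) (cw_space K) (cw_char K c) \<and>
        cw_char K c ` boundary_sphere (cw_dim K c)
          \<subseteq> (\<Union>d\<in>{d \<in> cw_cells K. cw_dim K d < cw_dim K c}. open_cell K d))"

definition is_subcomplex :: "('a, 'c) cell_structure \<Rightarrow> 'c set \<Rightarrow> bool" where
  "is_subcomplex K S \<longleftrightarrow> S \<subseteq> cw_cells K \<and>
     (\<forall>c\<in>S. cw_space K closure_of open_cell K c \<subseteq> (\<Union>d\<in>S. open_cell K d))"

definition cell_subspace :: "('a, 'c) cell_structure \<Rightarrow> 'c set \<Rightarrow> 'a topology" where
  "cell_subspace K S = subtopology (cw_space K) (\<Union>c\<in>S. open_cell K c)"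

text \<open>\<open>disk_collapse n\<close> maps the closed \<open>n\<close>-disk onto the \<open>n\<close>-sphere, injectively on the open disk
  and sending the whole boundary to \<open>sphere_base n\<close>; it identifies the quotient of the disk by its
  boundary with the sphere.\<close>

definition sphere_base :: "nat \<Rightarrow> nat \<Rightarrow> real" where
  "sphere_base n = (\<lambda>i. if i = n then - 1 else 0)"

definition disk_collapse :: "nat \<Rightarrow> (nat \<Rightarrow> real) \<Rightarrow> nat \<Rightarrow> real" where
  "disk_collapse n x = (\<lambda>i. if i < n then 2 * sqrt (1 - sq_norm n x) * x i
                            else if i = n then 1 - 2 * sq_norm n x else 0)"

text \<open>The map whose degree is \<open>[c : d]\<close>, for an \<open>(n + 1)\<close>-cell \<open>c\<close> and an \<open>n\<close>-cell \<open>d\<close>: the attaching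
  map of \<open>c\<close> followed by the collapse of the \<open>n\<close>-skeleton onto the sphere that sends everything
  outside \<open>d\<close> to the base point.  For \<open>n = 0\<close> its degree, taken in reduced homology, is
  \<open>1\<close> if only the end \<open>+1\<close> of the edge \<open>c\<close> is the vertex \<open>d\<close>, \<open>-1\<close> if only the end \<open>-1\<close> is, and
  \<open>0\<close> otherwise.\<close>

definition incidence_map ::
    "('a, 'c) cell_structure \<Rightarrow> 'c \<Rightarrow> 'c \<Rightarrow> (nat \<Rightarrow> real) \<Rightarrow> nat \<Rightarrow> real" where
  "incidence_map K c d x =
     (let n = cw_dim K d; y = cw_char K c x in
      if y \<in> open_cell K d
      then disk_collapse n (the_inv_into (topspace (open_disk n)) (cw_char K d) y)
      else sphere_base n)"

definition incidence :: "('a, 'c) cell_structure \<Rightarrow> 'c \<Rightarrow> 'c \<Rightarrow> int" where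
  "incidence K c d =
     (if cw_dim K c = Suc (cw_dim K d) then Brouwer_degree2 (cw_dim K d) (incidence_map K c d)
      else 0)"


section \<open>Reduction data\<close>

text \<open>The order on cells is given by the enumeration \<open>rd_cell\<close> of the cells by \<open>0, \<dots>, N - 1\<close>.\<close>

record ('a, 'c, 'k) reduction_data =
  rd_complex :: "('a, 'c) cell_structure"
  rd_filt :: "'c \<Rightarrow> real"
  rd_cell :: "nat \<Rightarrow> 'c"
  rd_R :: "'k mat"
  rd_V :: "'k mat"

definition num_cells :: "('a, 'c, 'k) reduction_data \<Rightarrow> nat" where
  "num_cells F = card (cw_cells (rd_complex F))"

definition idx_dim :: "('a, 'c, 'k) reduction_data \<Rightarrow> nat \<Rightarrow> nat" where
  "idx_dim F i = cw_dim (rd_complex F) (rd_cell F i)"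

definition idx_filt :: "('a, 'c, 'k) reduction_data \<Rightarrow> nat \<Rightarrow> real" where
  "idx_filt F i = rd_filt F (rd_cell F i)"

definition idx_cell :: "('a, 'c, 'k) reduction_data \<Rightarrow> nat \<Rightarrow> 'a set" where
  "idx_cell F i = open_cell (rd_complex F) (rd_cell F i)"

definition filtration_values :: "('a, 'c, 'k) reduction_data \<Rightarrow> real set" where
  "filtration_values F = rd_filt F ` cw_cells (rd_complex F)"

definition boundary_matrix :: "('a, 'c, 'k :: field) reduction_data \<Rightarrow> 'k mat" where
  "boundary_matrix F = mat (num_cells F) (num_cells F)
     (\<lambda>(i, j). of_int (incidence (rd_complex F) (rd_cell F j) (rd_cell F i)))"

definition low :: "'k :: zero vec \<Rightarrow> nat" where
  "low c = Max {i. i < dim_vec c \<and> vec_index c i \<noteq> 0}"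

definition reduced_matrix :: "'k :: zero mat \<Rightarrow> bool" where
  "reduced_matrix M \<longleftrightarrow>
     (\<forall>j<dim_col M. \<forall>k<dim_col M.
        col M j \<noteq> 0\<^sub>v (dim_row M) \<and> col M k \<noteq> 0\<^sub>v (dim_row M) \<and> j \<noteq> k
          \<longrightarrow> low (col M j) \<noteq> low (col M k))"

text \<open>All sublevel complexes, strict or not, are initial segments of the enumeration, so the
  subcomplex condition below covers them.\<close>

definition valid_reduction_data :: "('a, 'c, 'k :: field) reduction_data \<Rightarrow> bool" where
  "valid_reduction_data F \<longleftrightarrow>
     (let K = rd_complex F; N = num_cells F; V = rd_V F; R = rd_R F in
      finite_cw_complex K \<and>
      (\<forall>c\<in>cw_cells K. \<forall>d\<in>cw_cells K.
         open_cell K d \<subseteq> cw_space K closure_of open_cell K c \<longrightarrow> rd_filt F d \<le> rd_filt F c) \<and>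
      bij_betw (rd_cell F) {..<N} (cw_cells K) \<and>
      (\<forall>i<N. \<forall>j<N. idx_filt F i < idx_filt F j \<longrightarrow> i < j) \<and>
      (\<forall>i<N. \<forall>j<N. idx_cell F i \<subseteq> cw_space K closure_of idx_cell F j \<and> i \<noteq> j \<longrightarrow> i < j) \<and>
      (\<forall>p\<le>N. is_subcomplex K (rd_cell F ` {..<p})) \<and>
      V \<in> carrier_mat N N \<and> upper_triangular V \<and> (\<forall>i<N. V $$ (i, i) = 1) \<and>
      (\<forall>i<N. \<forall>j<N. V $$ (i, j) \<noteq> 0 \<longrightarrow> idx_dim F i = idx_dim F j) \<and>
      R = boundary_matrix F * V \<and> reduced_matrix R)"

definition positive_cell :: "('a, 'c, 'k :: field) reduction_data \<Rightarrow> nat \<Rightarrow> bool" where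
  "positive_cell F i \<longleftrightarrow> col (rd_R F) i = 0\<^sub>v (num_cells F)"

definition birth_cycle :: "('a, 'c, 'k :: field) reduction_data \<Rightarrow> nat \<Rightarrow> 'k vec" where
  "birth_cycle F i = col (rd_V F) i"

definition zero_column_preserving_0 :: "('a, 'c, 'k :: field) reduction_data \<Rightarrow> bool" where
  "zero_column_preserving_0 F \<longleftrightarrow>
     (\<forall>i<num_cells F. idx_dim F i = 0 \<and> positive_cell F i
        \<longrightarrow> col (rd_V F) i = unit_vec (num_cells F) i)"

text \<open>\<open>None\<close> stands for an infinite pairing partner.\<close>

definition pair :: "('a, 'c, 'k :: field) reduction_data \<Rightarrow> nat \<Rightarrow> nat option" where
  "pair F i =
     (let P = (\<lambda>j. j < num_cells F \<and> col (rd_R F) j \<noteq> 0\<^sub>v (num_cells F) \<and> low (col (rd_R F) j) = i)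
      in if \<exists>j. P j then Some (THE j. P j) else None)"

definition birth :: "('a, 'c, 'k :: field) reduction_data \<Rightarrow> nat \<Rightarrow> real" where
  "birth F i = idx_filt F i"

definition death :: "('a, 'c, 'k :: field) reduction_data \<Rightarrow> nat \<Rightarrow> ereal" where
  "death F i = (case pair F i of None \<Rightarrow> \<infinity> | Some j \<Rightarrow> ereal (idx_filt F j))"

definition cells_le :: "('a, 'c, 'k) reduction_data \<Rightarrow> real \<Rightarrow> 'c set" where
  "cells_le F t = {c \<in> cw_cells (rd_complex F). rd_filt F c \<le> t}"

definition cells_lt :: "('a, 'c, 'k) reduction_data \<Rightarrow> real \<Rightarrow> 'c set" where
  "cells_lt F t = {c \<in> cw_cells (rd_complex F). rd_filt F c < t}"

definition subcomplex_le :: "('a, 'c, 'k) reduction_data \<Rightarrow> real \<Rightarrow> 'a topology" where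
  "subcomplex_le F t = cell_subspace (rd_complex F) (cells_le F t)"


section \<open>Cellular homology\<close>

definition chains :: "('a, 'c, 'k :: field) reduction_data \<Rightarrow> nat \<Rightarrow> 'c set \<Rightarrow> 'k vec set" where
  "chains F p S = {x \<in> carrier_vec (num_cells F).
     \<forall>i<num_cells F. vec_index x i \<noteq> 0 \<longrightarrow> idx_dim F i = p \<and> rd_cell F i \<in> S}"

definition cycles :: "('a, 'c, 'k :: field) reduction_data \<Rightarrow> nat \<Rightarrow> 'c set \<Rightarrow> 'k vec set" where
  "cycles F p S = {x \<in> chains F p S. boundary_matrix F *\<^sub>v x = 0\<^sub>v (num_cells F)}"

definition boundaries :: "('a, 'c, 'k :: field) reduction_data \<Rightarrow> nat \<Rightarrow> 'c set \<Rightarrow> 'k vec set" where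
  "boundaries F p S = (\<lambda>x. boundary_matrix F *\<^sub>v x) ` chains F (Suc p) S"

definition hclass :: "('a, 'c, 'k :: field) reduction_data \<Rightarrow> nat \<Rightarrow> 'c set \<Rightarrow> 'k vec \<Rightarrow> 'k vec set" where
  "hclass F p S z = {z + b | b. b \<in> boundaries F p S}"

text \<open>Homology classes are cosets of boundaries, with the usual operations on cosets.  The
  multiplicative fields of the module record play no role.\<close>

definition homology ::
    "('a, 'c, 'k :: field) reduction_data \<Rightarrow> nat \<Rightarrow> 'c set \<Rightarrow> ('k, 'k vec set) module" where
  "homology F p S =
     \<lparr> carrier = hclass F p S ` cycles F p S,
       monoid.mult = undefined, one = undefined,
       zero = boundaries F p S,
       add = (\<lambda>A B. {a + b | a b. a \<in> A \<and> b \<in> B}),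
       module.smult = (\<lambda>k A. {k \<cdot>\<^sub>v a + b | a b. a \<in> A \<and> b \<in> boundaries F p S}) \<rparr>"

text \<open>The map induced by including a subcomplex into the subcomplex with cell set \<open>S\<close>; it sends
  the class of a cycle to the class of the same cycle.\<close>

definition induced_map ::
    "('a, 'c, 'k :: field) reduction_data \<Rightarrow> nat \<Rightarrow> 'c set \<Rightarrow> 'k vec set \<Rightarrow> 'k vec set" where
  "induced_map F p S A = {a + b | a b. a \<in> A \<and> b \<in> boundaries F p S}"


section \<open>The persistence pairing graph in dimension zero\<close>

definition pairing_vertices :: "('a, 'c, 'k :: field) reduction_data \<Rightarrow> nat set" where
  "pairing_vertices F = {i. i < num_cells F \<and> idx_dim F i = 0 \<and> positive_cell F i \<and>
     ereal (birth F i) < death F i}"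

definition surviving :: "('a, 'c, 'k :: field) reduction_data \<Rightarrow> real \<Rightarrow> nat set" where
  "surviving F t = {v \<in> pairing_vertices F. birth F v < t \<and> ereal t < death F v}"

text \<open>Only meaningful for \<open>u\<close> with finite death.\<close>

definition transition_coeff :: "('a, 'c, 'k :: field) reduction_data \<Rightarrow> nat \<Rightarrow> nat \<Rightarrow> 'k" where
  "transition_coeff F u =
     (let t = real_of_ereal (death F u); H = homology F 0 (cells_le F t) in
      THE w. (\<forall>v. v \<notin> surviving F t \<longrightarrow> w v = 0) \<and>
        induced_map F 0 (cells_le F t) (hclass F 0 (cells_lt F t) (birth_cycle F u)) =
        (\<Oplus>\<^bsub>H\<^esub>v\<in>surviving F t. w v \<odot>\<^bsub>H\<^esub> hclass F 0 (cells_le F t) (birth_cycle F v)))"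

definition pairing_graph :: "('a, 'c, 'k :: field) reduction_data \<Rightarrow> (nat, nat \<times> nat) pre_digraph" where
  "pairing_graph F =
     \<lparr> verts = pairing_vertices F,
       arcs = {(u, v). u \<in> pairing_vertices F \<and> v \<in> pairing_vertices F \<and>
         death F u < \<infinity> \<and> ereal (birth F v) < death F u \<and> death F u < death F v \<and>
         transition_coeff F u v \<noteq> 0},
       tail = fst, head = snd \<rparr>"


section \<open>Components of sublevel sets\<close>

definition sublevel :: "'x topology \<Rightarrow> ('x \<Rightarrow> real) \<Rightarrow> real \<Rightarrow> 'x topology" where
  "sublevel X g a = subtopology X {x \<in> topspace X. g x \<le> a}"

text \<open>The map on components induced by an inclusion into \<open>Y\<close>.\<close>

definition component_containing :: "'x topology \<Rightarrow> 'x set \<Rightarrow> 'x set" where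
  "component_containing Y C = (THE D. D \<in> connected_components_of Y \<and> C \<subseteq> D)"

text \<open>A change at the value \<open>r\<close> is visible at \<open>r\<close> itself: the components at \<open>s < t\<close> are the same
  unless there is a change in the half-open interval from \<open>s\<close> (excluded) to \<open>t\<close> (included).\<close>

definition changes_only_at :: "'x topology \<Rightarrow> ('x \<Rightarrow> real) \<Rightarrow> real set \<Rightarrow> bool" where
  "changes_only_at X g T \<longleftrightarrow>
     (\<forall>s t. s < t \<and> {s<..t} \<inter> T = {} \<longrightarrow>
        bij_betw (component_containing (sublevel X g t))
          (connected_components_of (sublevel X g s)) (connected_components_of (sublevel X g t)))"

text \<open>\<open>\<theta> t\<close> is the bijection at the filtration value \<open>t\<close>.  The last clause says that, like the
  cellular filtration, the sublevel sets are empty before the first filtration value; otherwise a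
  component present at all levels would never have been born.\<close>

definition component_evolution_agrees ::
    "('a, 'c, 'k) reduction_data \<Rightarrow> 'x topology \<Rightarrow> ('x \<Rightarrow> real) \<Rightarrow> (real \<Rightarrow> 'a set \<Rightarrow> 'x set) \<Rightarrow> bool" where
  "component_evolution_agrees F X g \<theta> \<longleftrightarrow>
     (\<forall>t\<in>filtration_values F.
        bij_betw (\<theta> t) (connected_components_of (subcomplex_le F t))
          (connected_components_of (sublevel X g t))) \<and>
     (\<forall>s\<in>filtration_values F. \<forall>t\<in>filtration_values F. s \<le> t \<longrightarrow>
        (\<forall>C\<in>connected_components_of (subcomplex_le F s).
           \<theta> t (component_containing (subcomplex_le F t) C) =
           component_containing (sublevel X g t) (\<theta> s C))) \<and>
     changes_only_at X g (filtration_values F) \<and>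
     (\<forall>t. (\<forall>r\<in>filtration_values F. t < r) \<longrightarrow> topspace (sublevel X g t) = {})"


section \<open>The elder rule branch graph\<close>

text \<open>A branch is its birth value together with the component that is born.\<close>

type_synonym 'x branch = "real \<times> 'x set"

definition branches :: "'x topology \<Rightarrow> ('x \<Rightarrow> real) \<Rightarrow> 'x branch set" where
  "branches X g = {(t, C). C \<in> connected_components_of (sublevel X g t) \<and>
     (\<forall>s<t. \<forall>B\<in>connected_components_of (sublevel X g s). \<not> B \<subseteq> C)}"

definition least_vertex ::
    "('a, 'c, 'k) reduction_data \<Rightarrow> (real \<Rightarrow> 'a set \<Rightarrow> 'x set) \<Rightarrow> 'x branch \<Rightarrow> nat" where
  "least_vertex F \<theta> \<beta> = (LEAST i. i < num_cells F \<and> idx_dim F i = 0 \<and>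
     idx_cell F i \<subseteq>
       the_inv_into (connected_components_of (subcomplex_le F (fst \<beta>))) (\<theta> (fst \<beta>)) (snd \<beta>))"

definition older ::
    "('a, 'c, 'k) reduction_data \<Rightarrow> (real \<Rightarrow> 'a set \<Rightarrow> 'x set) \<Rightarrow> 'x branch \<Rightarrow> 'x branch \<Rightarrow> bool" where
  "older F \<theta> \<beta> \<gamma> \<longleftrightarrow> fst \<beta> < fst \<gamma> \<or>
     (fst \<beta> = fst \<gamma> \<and> least_vertex F \<theta> \<beta> < least_vertex F \<theta> \<gamma>)"

text \<open>The components do not change from \<open>s\<close> on until immediately before \<open>t\<close>.\<close>

definition unchanged_before :: "'x topology \<Rightarrow> ('x \<Rightarrow> real) \<Rightarrow> real \<Rightarrow> real \<Rightarrow> bool" where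
  "unchanged_before X g s t \<longleftrightarrow> s < t \<and>
     (\<forall>r\<in>{s..<t}. bij_betw (component_containing (sublevel X g r))
        (connected_components_of (sublevel X g s)) (connected_components_of (sublevel X g r)))"

text \<open>The elder rule: \<open>L t C\<close> is the branch labeling the component \<open>C\<close> at level \<open>t\<close>.  A component
  that is born is labeled by the new branch; any other component is labeled by the oldest of the
  branches labeling the components, immediately before \<open>t\<close>, that have merged into it.  (If only one
  has, its label is kept.)\<close>

definition elder_labeling ::
    "'x topology \<Rightarrow> ('x \<Rightarrow> real) \<Rightarrow> ('x branch \<Rightarrow> 'x branch \<Rightarrow> bool) \<Rightarrow>
     (real \<Rightarrow> 'x set \<Rightarrow> 'x branch) \<Rightarrow> bool" where
  "elder_labeling X g old L \<longleftrightarrow>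
     (\<forall>t. \<forall>C\<in>connected_components_of (sublevel X g t).
        if (t, C) \<in> branches X g then L t C = (t, C)
        else \<forall>s. unchanged_before X g s t \<longrightarrow>
          (let M = {L s B | B. B \<in> connected_components_of (sublevel X g s) \<and> B \<subseteq> C} in
           L t C \<in> M \<and> (\<forall>\<beta>\<in>M. \<beta> \<noteq> L t C \<longrightarrow> old (L t C) \<beta>)))"

definition elder_label ::
    "('a, 'c, 'k) reduction_data \<Rightarrow> (real \<Rightarrow> 'a set \<Rightarrow> 'x set) \<Rightarrow> 'x topology \<Rightarrow> ('x \<Rightarrow> real) \<Rightarrow>
     real \<Rightarrow> 'x set \<Rightarrow> 'x branch" where
  "elder_label F \<theta> X g = (SOME L. elder_labeling X g (older F \<theta>) L)"

text \<open>The label, at level \<open>t\<close>, of the component containing the branch \<open>\<beta>\<close>.\<close>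

definition current_label ::
    "('a, 'c, 'k) reduction_data \<Rightarrow> (real \<Rightarrow> 'a set \<Rightarrow> 'x set) \<Rightarrow> 'x topology \<Rightarrow> ('x \<Rightarrow> real) \<Rightarrow>
     real \<Rightarrow> 'x branch \<Rightarrow> 'x branch" where
  "current_label F \<theta> X g t \<beta> =
     elder_label F \<theta> X g t (component_containing (sublevel X g t) (snd \<beta>))"

definition terminates_at ::
    "('a, 'c, 'k) reduction_data \<Rightarrow> (real \<Rightarrow> 'a set \<Rightarrow> 'x set) \<Rightarrow> 'x topology \<Rightarrow> ('x \<Rightarrow> real) \<Rightarrow>
     'x branch \<Rightarrow> real \<Rightarrow> bool" where
  "terminates_at F \<theta> X g \<beta> t \<longleftrightarrow> fst \<beta> \<le> t \<and> current_label F \<theta> X g t \<beta> \<noteq> \<beta> \<and>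
     (\<forall>s. fst \<beta> \<le> s \<and> s < t \<longrightarrow> current_label F \<theta> X g s \<beta> = \<beta>)"

definition nonzero_branches ::
    "('a, 'c, 'k) reduction_data \<Rightarrow> (real \<Rightarrow> 'a set \<Rightarrow> 'x set) \<Rightarrow> 'x topology \<Rightarrow> ('x \<Rightarrow> real) \<Rightarrow>
     'x branch set" where
  "nonzero_branches F \<theta> X g =
     {\<beta> \<in> branches X g. \<forall>t. terminates_at F \<theta> X g \<beta> t \<longrightarrow> fst \<beta> < t}"

definition branch_graph ::
    "('a, 'c, 'k) reduction_data \<Rightarrow> (real \<Rightarrow> 'a set \<Rightarrow> 'x set) \<Rightarrow> 'x topology \<Rightarrow> ('x \<Rightarrow> real) \<Rightarrow>
     ('x branch, 'x branch \<times> 'x branch) pre_digraph" where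
  "branch_graph F \<theta> X g =
     \<lparr> verts = nonzero_branches F \<theta> X g,
       arcs = {(\<beta>, \<gamma>). \<beta> \<in> nonzero_branches F \<theta> X g \<and> \<gamma> \<in> nonzero_branches F \<theta> X g \<and>
         (\<exists>t. terminates_at F \<theta> X g \<beta> t \<and> \<gamma> = current_label F \<theta> X g t \<beta>)},
       tail = fst, head = snd \<rparr>"


section \<open>Rooted directed trees and forests\<close>

definition rooted_in_tree :: "('v, 'e) pre_digraph \<Rightarrow> 'v \<Rightarrow> bool" where
  "rooted_in_tree T r \<longleftrightarrow> wf_digraph T \<and> r \<in> verts T \<and>
     (\<forall>v\<in>verts T. \<exists>!p. pre_digraph.awalk T v p r)"

text \<open>\<^const>\<open>Digraph_Component.connected\<close> is connectedness of the underlying undirected graph.\<close>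

definition weak_component :: "('v, 'e) pre_digraph \<Rightarrow> ('v, 'e) pre_digraph \<Rightarrow> bool" where
  "weak_component G T \<longleftrightarrow> pre_digraph.max_subgraph G Digraph_Component.connected T"

definition rooted_in_forest :: "('v, 'e) pre_digraph \<Rightarrow> bool" where
  "rooted_in_forest G \<longleftrightarrow> wf_digraph G \<and>
     (\<forall>T. weak_component G T \<longrightarrow> (\<exists>!r. rooted_in_tree T r))"

definition forest_roots :: "('v, 'e) pre_digraph \<Rightarrow> 'v set" where
  "forest_roots G = {r. \<exists>T. weak_component G T \<and> rooted_in_tree T r}"

end

theory Submission
  imports Defs
begin

text \<open>
  In dimension zero everything is governed by the graph formed by the vertices and edges of \<open>K\<close>.
  Spheres of positive dimension are connected, so the components of an initial subcomplex are the
  classes of vertices linked by its edges, and a reflection of the \<open>0\<close>-sphere having degree \<open>-1\<close>,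
  its \<open>0\<close>-boundaries are the chains whose coefficients sum to zero over every class.  Hence the lows
  of the reduced columns are exactly the vertices that are not least in their class: a vertex is
  alive at \<open>t\<close> iff it is the least vertex of its component of \<open>K\<^sub>t\<close>.  When it dies, its homology class
  becomes that of the least vertex of the component it has joined, which is the only nonzero
  transition coefficient.  Since \<open>\<prec>\<close> refines the order of births, the elder rule for \<open>g\<close> also labels each
  component by the branch of its least vertex, so the two graphs coincide.  Parents precede their
  children in \<open>\<prec>\<close>; this makes the graph a forest rooted at the vertices that never die.
\<close>

unbundle no vec_syntax

section \<open>Disks and spheres\<close>

text \<open>The two sides live on different parameters: \<open>g\<close> on all reals, the matrices
  on positions in the enumeration, and \<open>\<theta>\<close> only at filtration values. Cellular
  statements are therefore made about prefixes of the enumeration, \<open>level t\<close> being the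
  length of the prefix that makes up \<open>K\<close> at level \<open>t\<close>. On the side of
  \<open>X\<close>, each vertex is carried over by \<open>\<theta>\<close> once, at its birth value,
  and from then on followed along the inclusions of sublevel sets; this is \<open>\<kappa>\<close>.
  Equality of \<open>\<kappa> t i\<close> and \<open>\<kappa> t j\<close> then means linkage by
  edges of the prefix, so both sides speak of the same classes of vertices. Two choices have to be
  pinned down. Elder labels are a Hilbert choice, so a labeling must be exhibited and all labelings
  shown to agree on components, by induction over the finitely many values where anything changes.
  The factorization is arbitrary as well: \<open>V\<close> is unitriangular and dimension
  preserving, so it respects prefixes, and \<open>R\<close> has distinct lows; together this makes
  the lows of a prefix depend on its boundaries alone.\<close>

lemma topspace_closed_disk:
  "topspace (closed_disk n) = {x. (\<forall>i\<ge>n. x i = 0) \<and> sq_norm n x \<le> 1}"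
  by (auto simp: closed_disk_def topspace_Euclidean_space)

lemma topspace_open_disk:
  "topspace (open_disk n) = {x. (\<forall>i\<ge>n. x i = 0) \<and> sq_norm n x < 1}"
  by (auto simp: open_disk_def topspace_Euclidean_space)

lemma boundary_sphere_eq:
  "boundary_sphere n = {x. (\<forall>i\<ge>n. x i = 0) \<and> sq_norm n x = 1}"
  by (auto simp: boundary_sphere_def topspace_Euclidean_space)

lemma topspace_closed_disk_Un:
  "topspace (closed_disk n) = topspace (open_disk n) \<union> boundary_sphere n"
  by (auto simp: topspace_closed_disk topspace_open_disk boundary_sphere_eq)

lemma sq_norm_scale: "sq_norm n (\<lambda>i. r * x i) = r\<^sup>2 * sq_norm n x"
  by (simp add: sq_norm_def sum_distrib_left power_mult_distrib)

lemma sq_norm_nonneg: "0 \<le> sq_norm n x"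
  by (simp add: sq_norm_def sum_nonneg)

lemma boundary_sphere_0: "boundary_sphere 0 = {}"
  by (simp add: boundary_sphere_eq sq_norm_def)

lemma topspace_open_disk_0: "topspace (open_disk 0) = {\<lambda>_. 0}"
  by (auto simp: topspace_open_disk sq_norm_def)

lemma boundary_sphere_Suc_nonempty: "boundary_sphere (Suc n) \<noteq> {}"
proof -
  have "(\<lambda>i. if i = 0 then 1 else 0) \<in> boundary_sphere (Suc n)"
    by (simp add: boundary_sphere_eq sq_norm_def if_distrib [of "\<lambda>x. x ^ 2"] cong: if_cong)
  then show ?thesis by blast
qed

lemma boundary_sphere_1:
  "boundary_sphere 1 = {\<lambda>i. if i = 0 then 1 else 0, \<lambda>i. if i = 0 then - 1 else 0}"
proof -
  have "x = (\<lambda>i. if i = 0 then 1 else 0) \<or> x = (\<lambda>i. if i = 0 then - 1 else 0)"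
    if "\<forall>i\<ge>Suc 0. x i = 0" "(x 0)\<^sup>2 = 1" for x :: "nat \<Rightarrow> real"
    using that by (auto simp: fun_eq_iff power2_eq_1_iff)
  then show ?thesis
    by (auto simp: boundary_sphere_eq sq_norm_def)
qed

text \<open>Bridges to the type-class topology on \<open>nat \<Rightarrow> real\<close>, whose rules
  for \<open>closed\<close>, \<open>compact\<close> and \<open>continuous_on\<close> then apply to
  disks.\<close>

lemma closed_disk_eq: "closed_disk n = top_of_set (topspace (closed_disk n))"
proof -
  have "closed_disk n = top_of_set ({x. \<forall>i\<ge>n. x i = 0} \<inter> {x. sq_norm n x \<le> 1})"
    by (simp add: closed_disk_def Euclidean_space_def subtopology_subtopology euclidean_product_topology)
  then show ?thesis by simp
qed

lemma nsphere_eq: "nsphere n = top_of_set (boundary_sphere (Suc n))"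
proof -
  have "boundary_sphere (Suc n) = {x. (\<Sum>i\<le>n. x i ^ 2) = 1 \<and> (\<forall>i>n. x i = 0)}"
    by (auto simp: boundary_sphere_eq sq_norm_def lessThan_Suc_atMost)
  then show ?thesis
    by (simp add: nsphere euclidean_product_topology)
qed

text \<open>The disk is a closed subset of a Tychonoff product: \<open>{-1..1}\<close> in the first
  \<open>n\<close> coordinates and \<open>{0}\<close> in all others.\<close>

lemma compact_space_closed_disk: "compact_space (closed_disk n)"
proof -
  define P where "P = PiE UNIV (\<lambda>i. if i < n then {-1..1} else {0::real})"
  have "compactin (powertop_real UNIV) P"
    unfolding P_def by (subst compactin_PiE) auto
  then have P: "compact P" by (simp add: euclidean_product_topology)
  have cont: "continuous_on UNIV (\<lambda>x::nat \<Rightarrow> real. x i)" for i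
    by (rule continuous_on_product_coordinates)
  have "closed {x. (\<forall>i\<ge>n. x i = 0) \<and> sq_norm n x \<le> 1}"
    unfolding sq_norm_def
    by (intro closed_Collect_conj closed_Collect_all closed_Collect_imp closed_Collect_eq
        closed_Collect_le continuous_intros continuous_on_sum continuous_on_power cont open_Collect_const)
  then have cl: "closed (topspace (closed_disk n))"
    by (simp add: topspace_closed_disk)
  have "topspace (closed_disk n) \<subseteq> P"
  proof
    fix x assume x: "x \<in> topspace (closed_disk n)"
    have "\<bar>x i\<bar> \<le> 1" if "i < n" for i
    proof -
      have "(x i)\<^sup>2 \<le> sq_norm n x"
        unfolding sq_norm_def using that by (intro member_le_sum) auto
      also have "\<dots> \<le> 1" using x by (simp add: topspace_closed_disk)
      finally show ?thesis by (simp add: abs_square_le_1)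
    qed
    then show "x \<in> P"
      using x by (fastforce simp: P_def topspace_closed_disk PiE_def abs_le_iff)
  qed
  with P cl have "compact (topspace (closed_disk n))"
    by (metis compact_Int_closed inf.absorb_iff2)
  then show ?thesis
    by (subst closed_disk_eq) (simp add: compact_space_subtopology)
qed

text \<open>The radius serves twice: it joins every point of the disk to the centre, and it
  approaches a boundary point from inside the open disk.\<close>

lemma continuous_map_radial:
  assumes "x \<in> topspace (closed_disk n)"
  shows "continuous_map (top_of_set {0..1}) (closed_disk n) (\<lambda>t i. t * x i)"
proof -
  have "continuous_on {0..1} (\<lambda>t i. t * x i)"
    by (intro continuous_on_coordinatewise_then_product continuous_intros)
  moreover have "(\<lambda>i. t * x i) \<in> topspace (closed_disk n)" if "t \<in> {0..1}" for t
  proof -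
    have "t\<^sup>2 * sq_norm n x \<le> 1"
      using that assms sq_norm_nonneg[of n x]
      by (intro mult_le_one) (auto simp: topspace_closed_disk power_le_one)
    then show ?thesis
      using assms by (simp add: topspace_closed_disk sq_norm_scale)
  qed
  ultimately show ?thesis
    by (subst closed_disk_eq) (auto simp: continuous_map_in_subtopology)
qed

lemma connected_space_closed_disk: "connected_space (closed_disk n)"
proof -
  have "connected_component_of (closed_disk n) (\<lambda>_. 0) x" if x: "x \<in> topspace (closed_disk n)" for x
  proof -
    have "connectedin (closed_disk n) ((\<lambda>t i. t * x i) ` {0..1})"
      using connectedin_continuous_map_image[OF continuous_map_radial[OF x], of "{0..1}"]
      by (simp add: connectedin_subtopology)
    moreover have "(\<lambda>_. 0) \<in> (\<lambda>t i. t * x i) ` {0..1}" "x \<in> (\<lambda>t i. t * x i) ` {0..1}"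
      by (force intro: image_eqI[where x = 0], force intro: image_eqI[where x = 1])
    ultimately show ?thesis
      unfolding connected_component_of_def by blast
  qed
  then show ?thesis
    unfolding connected_space_iff_connected_component
    by (meson connected_component_of_sym connected_component_of_trans)
qed

text \<open>The two closed hemispheres are contractible, hence connected, and they meet on the
  equator. For \<open>n = 1\<close> the boundary is a pair of points, which is why edges are treated
  apart from all other cells.\<close>

lemma connectedin_boundary_sphere:
  assumes "2 \<le> n" shows "connectedin (closed_disk n) (boundary_sphere n)"
proof -
  obtain m where m: "n = Suc m" "1 \<le> m"
    using assms by (cases n) auto
  let ?U = "topspace (nsphere m) \<inter> {x. x m \<ge> 0}" and ?L = "topspace (nsphere m) \<inter> {x. x m \<le> 0}"
  have "connectedin (nsphere m) ?U" "connectedin (nsphere m) ?L"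
    using contractible_imp_connected_space[OF contractible_space_upper_hemisphere[of m m]]
      contractible_imp_connected_space[OF contractible_space_lower_hemisphere[of m m]]
    by (auto simp: connectedin_def subtopology_restrict)
  \<comment> \<open>A point of the equator: the hemispheres are cut out by coordinate
    \<open>m\<close>, which is not coordinate 0 because \<open>1 \<le> m\<close>.\<close>
  moreover have "(\<lambda>i. if i = 0 then 1 else 0) \<in> ?U \<inter> ?L"
    using in_topspace_nsphere[of m] m by auto
  ultimately have "connectedin (nsphere m) (?U \<union> ?L)"
    by (intro connectedin_Un) auto
  moreover have "?U \<union> ?L = boundary_sphere n"
    by (auto simp: nsphere_eq m)
  ultimately have "Topological_Spaces.connected (boundary_sphere n)"
    by (simp add: nsphere_eq m connectedin_subtopology)
  then show ?thesis
    by (subst closed_disk_eq) (auto simp: connectedin_subtopology topspace_closed_disk_Un)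
qed

section \<open>Components of finite CW complexes\<close>

text \<open>Taken as an image rather than as a closure: compactness and connectedness of the disk
  then pass along the characteristic map.\<close>

definition closed_cell :: "('a, 'c) cell_structure \<Rightarrow> 'c \<Rightarrow> 'a set" where
  "closed_cell K c = cw_char K c ` topspace (closed_disk (cw_dim K c))"

definition cell_boundary :: "('a, 'c) cell_structure \<Rightarrow> 'c \<Rightarrow> 'a set" where
  "cell_boundary K c = cw_char K c ` boundary_sphere (cw_dim K c)"

lemma connectedin_subset_closed_cases:
  assumes "connectedin X T" "closedin X U" "closedin X W" "T \<subseteq> U \<union> W" "U \<inter> W = {}"
  shows "T \<subseteq> U \<or> T \<subseteq> W"
  using assms unfolding connectedin_closedin by blast

lemma closed_cell_Un: "closed_cell K c = open_cell K c \<union> cell_boundary K c"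
  by (simp add: closed_cell_def open_cell_def cell_boundary_def topspace_closed_disk_Un image_Un)

text \<open>Rewrites a union of open cells as a union of closed ones; since closed cells are compact
  and finite in number, such a union is closed.\<close>

lemma Union_closed_cells:
  assumes "\<And>c. c \<in> A \<Longrightarrow> closed_cell K c \<subseteq> (\<Union>d\<in>A. open_cell K d)"
  shows "(\<Union>c\<in>A. open_cell K c) = (\<Union>c\<in>A. closed_cell K c)"
proof
  show "(\<Union>c\<in>A. open_cell K c) \<subseteq> (\<Union>c\<in>A. closed_cell K c)"
    by (auto simp: closed_cell_Un)
  show "(\<Union>c\<in>A. closed_cell K c) \<subseteq> (\<Union>c\<in>A. open_cell K c)"
    using assms by (rule UN_least)
qed

lemma open_cell_vertex: "cw_dim K v = 0 \<Longrightarrow> open_cell K v = {cw_char K v (\<lambda>_. 0)}"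
  by (simp add: open_cell_def topspace_open_disk_0)

lemma closed_cell_vertex: "cw_dim K v = 0 \<Longrightarrow> closed_cell K v = open_cell K v"
  by (simp add: closed_cell_Un cell_boundary_def boundary_sphere_0)

section \<open>Closed cells and subcomplexes of a finite complex\<close>

locale finite_cw =
  fixes K :: "('a, 'c) cell_structure"
  assumes cw: "finite_cw_complex K"
begin

lemma finite_cells: "finite (cw_cells K)"
  and Hausdorff: "Hausdorff_space (cw_space K)"
  and Union_open_cells: "(\<Union>c\<in>cw_cells K. open_cell K c) = topspace (cw_space K)"
  using cw by (auto simp: finite_cw_complex_def)

lemma continuous_char: "c \<in> cw_cells K \<Longrightarrow> continuous_map (closed_disk (cw_dim K c)) (cw_space K) (cw_char K c)"
  using cw by (auto simp: finite_cw_complex_def)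

lemma open_cell_unique:
  "c \<in> cw_cells K \<Longrightarrow> d \<in> cw_cells K \<Longrightarrow> x \<in> open_cell K c \<Longrightarrow> x \<in> open_cell K d \<Longrightarrow> c = d"
  using cw by (auto simp: finite_cw_complex_def disjoint_family_on_def)

lemma cell_boundary_subset:
  "c \<in> cw_cells K \<Longrightarrow>
    cell_boundary K c \<subseteq> (\<Union>d\<in>{d \<in> cw_cells K. cw_dim K d < cw_dim K c}. open_cell K d)"
  using cw by (auto simp: finite_cw_complex_def cell_boundary_def)

lemma closedin_closed_cell: "c \<in> cw_cells K \<Longrightarrow> closedin (cw_space K) (closed_cell K c)"
  unfolding closed_cell_def
  by (meson Hausdorff compactin_imp_closedin compact_space_closed_disk compact_space_def
      continuous_char image_compactin)

lemma connectedin_closed_cell: "c \<in> cw_cells K \<Longrightarrow> connectedin (cw_space K) (closed_cell K c)"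
  unfolding closed_cell_def
  by (meson connectedin_continuous_map_image connectedin_topspace connected_space_closed_disk continuous_char)

text \<open>Each point of the closed disk is a limit, along its radius, of points of the open disk.
  The lemma links \<open>is_subcomplex\<close>, which speaks of closures, to closed cells.\<close>

lemma closed_cell_subset_closure:
  assumes "c \<in> cw_cells K"
  shows "closed_cell K c \<subseteq> cw_space K closure_of open_cell K c"
proof
  fix y assume "y \<in> closed_cell K c"
  then obtain x where x: "x \<in> topspace (closed_disk (cw_dim K c))" "y = cw_char K c x"
    by (auto simp: closed_cell_def)
  let ?h = "\<lambda>t i. t * x i"
  let ?I = "top_of_set {0..1::real}"
  have cont: "continuous_map ?I (cw_space K) (cw_char K c \<circ> ?h)"
    using continuous_map_radial[OF x(1)] continuous_char[OF assms] by (rule continuous_map_compose)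
  have "(1::real) \<in> ?I closure_of {0..<1}"
    by (simp add: closure_of_subtopology Int_absorb1 subset_iff)
  then have "(cw_char K c \<circ> ?h) 1 \<in> cw_space K closure_of ((cw_char K c \<circ> ?h) ` {0..<1})"
    using continuous_map_image_closure_subset[OF cont, of "{0..<1}"] by blast
  moreover have "(cw_char K c \<circ> ?h) ` {0..<1} \<subseteq> open_cell K c"
  proof -
    have "t\<^sup>2 * sq_norm (cw_dim K c) x < 1" if "0 \<le> t" "t < 1" for t
    proof -
      have "t\<^sup>2 < 1" using that by (simp add: power_less_one_iff abs_square_less_1)
      moreover have "t\<^sup>2 * sq_norm (cw_dim K c) x \<le> t\<^sup>2 * 1"
        using x by (intro mult_left_mono) (auto simp: topspace_closed_disk)
      ultimately show ?thesis by linarith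
    qed
    then have "?h t \<in> topspace (open_disk (cw_dim K c))" if "t \<in> {0..<1}" for t
      using x that by (simp add: topspace_open_disk sq_norm_scale topspace_closed_disk)
    then show ?thesis
      unfolding open_cell_def comp_def by blast
  qed
  ultimately show "y \<in> cw_space K closure_of open_cell K c"
    using closure_of_mono x by fastforce
qed

context
  fixes S assumes sub: "is_subcomplex K S"
begin

lemma subcomplex_cells: "c \<in> S \<Longrightarrow> c \<in> cw_cells K"
  using sub by (auto simp: is_subcomplex_def)

lemma finite_subcomplex: "finite S"
  using finite_cells subcomplex_cells by (meson finite_subset subsetI)

lemma closed_cell_subset: "c \<in> S \<Longrightarrow> closed_cell K c \<subseteq> (\<Union>d\<in>S. open_cell K d)"
  using sub closed_cell_subset_closure subcomplex_cells unfolding is_subcomplex_def by blast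

text \<open>The complex puts a boundary point into a cell of lower dimension, the subcomplex puts it
  into a cell of \<open>S\<close>; disjointness of open cells makes these the same cell.\<close>

lemma cell_boundary_subset_lower:
  assumes "c \<in> S"
  shows "cell_boundary K c \<subseteq> (\<Union>d\<in>{d \<in> S. cw_dim K d < cw_dim K c}. open_cell K d)"
proof
  fix x assume x: "x \<in> cell_boundary K c"
  then obtain d where d: "d \<in> cw_cells K" "cw_dim K d < cw_dim K c" "x \<in> open_cell K d"
    using cell_boundary_subset[OF subcomplex_cells[OF assms]] by auto
  obtain e where "e \<in> S" "x \<in> open_cell K e"
    using closed_cell_subset[OF assms] x by (auto simp: closed_cell_Un)
  with d have "d \<in> S"
    using open_cell_unique subcomplex_cells by blast
  with d show "x \<in> (\<Union>d\<in>{d \<in> S. cw_dim K d < cw_dim K c}. open_cell K d)" by auto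
qed

lemma closedin_Union_closed_cells:
  assumes "A \<subseteq> S" shows "closedin (cw_space K) (\<Union>c\<in>A. closed_cell K c)"
proof -
  have "closedin (cw_space K) (closed_cell K c)" if "c \<in> A" for c
    using that assms subcomplex_cells closedin_closed_cell by blast
  moreover have "finite A"
    using assms finite_subcomplex by (rule finite_subset)
  ultimately show ?thesis
    by (intro closedin_Union) auto
qed

lemma topspace_cell_subspace: "topspace (cell_subspace K S) = (\<Union>c\<in>S. open_cell K c)"
  using Union_open_cells subcomplex_cells by (auto simp: cell_subspace_def)

lemma connected_component_closed_cell:
  assumes "c \<in> S" "x \<in> closed_cell K c" "y \<in> closed_cell K c"
  shows "connected_component_of (cell_subspace K S) x y"
  using assms closed_cell_subset[OF assms(1)] connectedin_closed_cell[OF subcomplex_cells[OF assms(1)]]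
  unfolding connected_component_of_def cell_subspace_def connectedin_subtopology by blast

text \<open>Descent on dimension: within its closed cell a point is joined to a boundary point,
  which lies in a cell of lower dimension.\<close>

lemma connected_component_vertex:
  assumes "c \<in> S" "x \<in> open_cell K c"
  shows "\<exists>v\<in>S. cw_dim K v = 0 \<and> (\<exists>y\<in>open_cell K v. connected_component_of (cell_subspace K S) x y)"
  using assms
proof (induction "cw_dim K c" arbitrary: c x rule: less_induct)
  case less
  show ?case
  proof (cases "cw_dim K c")
    case 0
    then show ?thesis
      using less.prems connected_component_of_refl topspace_cell_subspace by fastforce
  next
    case (Suc n)
    then obtain y where y: "y \<in> cell_boundary K c"
      using boundary_sphere_Suc_nonempty[of n] by (auto simp: cell_boundary_def)
    then obtain d where d: "d \<in> S" "cw_dim K d < cw_dim K c" "y \<in> open_cell K d"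
      using cell_boundary_subset_lower[OF less.prems(1)] by auto
    have "connected_component_of (cell_subspace K S) x y"
      using y less.prems by (intro connected_component_closed_cell) (auto simp: closed_cell_Un)
    moreover obtain v z where "v \<in> S" "cw_dim K v = 0" "z \<in> open_cell K v"
      "connected_component_of (cell_subspace K S) y z"
      using less.hyps[OF d(2,1,3)] by blast
    ultimately show ?thesis
      by (meson connected_component_of_trans)
  qed
qed

text \<open>Spheres of positive dimension are connected, so a partition of the vertices that no edge
  crosses extends over the skeleta to a partition of the subcomplex into two closed parts.\<close>

lemma vertex_partition_extends:
  assumes P: "P \<subseteq> {v \<in> S. cw_dim K v = 0}"
    and edges: "\<forall>c\<in>S. cw_dim K c = 1 \<longrightarrow>
      cell_boundary K c \<subseteq> (\<Union>v\<in>P. open_cell K v) \<or> cell_boundary K c \<inter> (\<Union>v\<in>P. open_cell K v) = {}"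
  shows "\<exists>A \<subseteq> S. {v \<in> A. cw_dim K v = 0} = P \<and>
    (\<forall>c\<in>A. closed_cell K c \<subseteq> (\<Union>d\<in>A. open_cell K d)) \<and>
    (\<forall>c\<in>S - A. closed_cell K c \<subseteq> (\<Union>d\<in>S - A. open_cell K d))"
proof -
  let ?U = "\<lambda>A. \<Union>d\<in>A. open_cell K d"
  define Sk where "Sk n = {c \<in> S. cw_dim K c \<le> n}" for n
  have disj: "?U A \<inter> ?U B = {}" if "A \<subseteq> S" "B \<subseteq> S" "A \<inter> B = {}" for A B
  proof -
    have False if "x \<in> open_cell K a" "a \<in> A" "x \<in> open_cell K b" "b \<in> B" for x a b
      using open_cell_unique[of a b x] that subcomplex_cells \<open>A \<subseteq> S\<close> \<open>B \<subseteq> S\<close> \<open>A \<inter> B = {}\<close> by blast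
    then show ?thesis by blast
  qed
  have closed: "closedin (cw_space K) (?U A)"
    if "A \<subseteq> S" "\<And>c. c \<in> A \<Longrightarrow> closed_cell K c \<subseteq> ?U A" for A
  proof -
    have "?U A = (\<Union>c\<in>A. closed_cell K c)"
      using that(2) by (rule Union_closed_cells)
    then show ?thesis
      using closedin_Union_closed_cells[OF that(1)] by simp
  qed
  have "\<exists>A \<subseteq> Sk n. {v \<in> A. cw_dim K v = 0} = P \<and> (\<forall>c\<in>A. closed_cell K c \<subseteq> ?U A) \<and>
    (\<forall>c\<in>Sk n - A. closed_cell K c \<subseteq> ?U (Sk n - A))" for n
  proof (induction n)
    case 0
    have "closed_cell K c = open_cell K c" if "c \<in> Sk 0" for c
      using that by (intro closed_cell_vertex) (simp add: Sk_def)
    moreover have "P \<subseteq> Sk 0" using P by (auto simp: Sk_def)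
    ultimately show ?case
      using P by (intro exI[of _ P] conjI ballI) (force simp: Sk_def)+
  next
    case (Suc n)
    then obtain A where A: "A \<subseteq> Sk n" "{v \<in> A. cw_dim K v = 0} = P"
      "\<forall>c\<in>A. closed_cell K c \<subseteq> ?U A" "\<forall>c\<in>Sk n - A. closed_cell K c \<subseteq> ?U (Sk n - A)" by blast
    have dj: "?U A \<inter> ?U (Sk n - A) = {}"
      using A(1) by (intro disj) (auto simp: Sk_def)
    have dichotomy: "cell_boundary K c \<subseteq> ?U A \<or> cell_boundary K c \<subseteq> ?U (Sk n - A)"
      if c: "c \<in> S" "cw_dim K c = Suc n" for c
    proof -
      have sub: "cell_boundary K c \<subseteq> ?U A \<union> ?U (Sk n - A)"
        using cell_boundary_subset_lower[OF c(1)] c(2) by (fastforce simp: Sk_def)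
      show ?thesis
      proof (cases "n = 0")
        case True
        then have "A = P" using A by (auto simp: Sk_def)
        \<comment> \<open>The boundary sphere of an edge is disconnected, so here the hypothesis on
          edges decides the side.\<close>
        moreover have "cell_boundary K c \<subseteq> ?U P \<or> cell_boundary K c \<inter> ?U P = {}"
          using edges c True by simp
        ultimately show ?thesis using sub by blast
      next
        case False
        then have "connectedin (cw_space K) (cell_boundary K c)"
          unfolding cell_boundary_def using c subcomplex_cells[OF c(1)]
          by (intro connectedin_continuous_map_image[OF continuous_char] connectedin_boundary_sphere) auto
        moreover have "A \<subseteq> S" "Sk n - A \<subseteq> S" using A(1) by (auto simp: Sk_def)
        then have "closedin (cw_space K) (?U A)" "closedin (cw_space K) (?U (Sk n - A))"
          using closed[of A] closed[of "Sk n - A"] A(3,4) by simp_all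
        ultimately show ?thesis
          using sub dj by (rule connectedin_subset_closed_cases)
      qed
    qed
    \<comment> \<open>A new cell joins \<open>A\<close> when its boundary lies there. By the
      dichotomy the boundary of any other new cell lies on the opposite side, so both parts still
      contain the closed cells of their members.\<close>
    define B where "B = A \<union> {c \<in> S. cw_dim K c = Suc n \<and> cell_boundary K c \<subseteq> ?U A}"
    have B1: "B \<subseteq> Sk (Suc n)"
      using A(1) by (auto simp: B_def Sk_def)
    have B2: "{v \<in> B. cw_dim K v = 0} = P"
      using A(2) by (auto simp: B_def)
    have B3: "closed_cell K c \<subseteq> ?U B" if "c \<in> B" for c
      using that A(3) unfolding B_def closed_cell_Un by blast
    have B4: "closed_cell K c \<subseteq> ?U (Sk (Suc n) - B)" if c: "c \<in> Sk (Suc n) - B" for c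
    proof -
      have "Sk n - A \<subseteq> Sk (Suc n) - B" by (auto simp: B_def Sk_def)
      then have mono: "?U (Sk n - A) \<subseteq> ?U (Sk (Suc n) - B)" by (rule UN_mono) simp
      show ?thesis
      proof (cases "c \<in> Sk n")
        case True
        then have "closed_cell K c \<subseteq> ?U (Sk n - A)" using c A(4) by (simp add: B_def)
        with mono show ?thesis by (rule order_trans[rotated])
      next
        case False
        then have "c \<in> S" "cw_dim K c = Suc n" using c by (auto simp: Sk_def)
        with dichotomy c have "cell_boundary K c \<subseteq> ?U (Sk n - A)" by (auto simp: B_def)
        with mono have "cell_boundary K c \<subseteq> ?U (Sk (Suc n) - B)" by (rule order_trans[rotated])
        with c show ?thesis unfolding closed_cell_Un by (intro Un_least UN_upper)
      qed
    qed
    show ?case by (intro exI[of _ B] conjI ballI B1 B2 B3 B4)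
  qed
  \<comment> \<open>The skeleton of top dimension is all of \<open>S\<close>; if \<open>S\<close> is
    empty, this holds whatever \<open>Max {}\<close> is.\<close>
  moreover have "Sk (Max (cw_dim K ` S)) = S"
    using finite_subcomplex by (auto simp: Sk_def)
  ultimately show ?thesis by metis
qed

text \<open>The two parts of the extended partition are disjoint and closed, so a connected set that
  meets the part of \<open>u\<close> stays inside it. Separation by edges thus becomes topological
  separation.\<close>

lemma connected_component_separated:
  assumes P: "P \<subseteq> {v \<in> S. cw_dim K v = 0}"
    and edges: "\<forall>c\<in>S. cw_dim K c = 1 \<longrightarrow>
      cell_boundary K c \<subseteq> (\<Union>v\<in>P. open_cell K v) \<or> cell_boundary K c \<inter> (\<Union>v\<in>P. open_cell K v) = {}"
    and xy: "connected_component_of (cell_subspace K S) x y"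
    and u: "u \<in> P" "x \<in> open_cell K u"
    and v: "v \<in> S" "cw_dim K v = 0" "y \<in> open_cell K v"
  shows "v \<in> P"
proof -
  let ?U = "\<lambda>A. \<Union>d\<in>A. open_cell K d"
  from vertex_partition_extends[OF P edges]
  obtain A where A: "A \<subseteq> S" "{v \<in> A. cw_dim K v = 0} = P"
    "\<forall>c\<in>A. closed_cell K c \<subseteq> ?U A" "\<forall>c\<in>S - A. closed_cell K c \<subseteq> ?U (S - A)"
    by (elim exE conjE)
  have closed: "closedin (cw_space K) (?U A)" "closedin (cw_space K) (?U (S - A))"
    using closedin_Union_closed_cells[OF A(1)] closedin_Union_closed_cells[of "S - A"]
      Union_closed_cells[of A K] Union_closed_cells[of "S - A" K] A(3,4)
    by simp_all
  have disj: "?U A \<inter> ?U (S - A) = {}"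
  proof -
    have False if "x \<in> open_cell K a" "a \<in> A" "x \<in> open_cell K b" "b \<in> S - A" for x a b
      using open_cell_unique[of a b x] that subcomplex_cells \<open>A \<subseteq> S\<close> by blast
    then show ?thesis by blast
  qed
  obtain T where T: "connectedin (cell_subspace K S) T" "x \<in> T" "y \<in> T"
    using xy by (auto simp: connected_component_of_def)
  then have "connectedin (cw_space K) T" "T \<subseteq> ?U S"
    by (auto simp: cell_subspace_def connectedin_subtopology)
  moreover from this have "T \<subseteq> ?U A \<union> ?U (S - A)" by blast
  moreover have "x \<in> ?U A" using u A(2) by blast
  ultimately have "y \<in> ?U A"
    using connectedin_subset_closed_cases[OF _ closed _ disj, of T] T disj by blast
  then obtain d where "d \<in> A" "y \<in> open_cell K d" by blast
  then have "d = v"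
    using open_cell_unique[of d v y] v A(1) subcomplex_cells by blast
  with \<open>d \<in> A\<close> v A(2) show "v \<in> P" by blast
qed

end

end


section \<open>The graph of vertices and edges\<close>

abbreviation pos_end :: "nat \<Rightarrow> real" where "pos_end \<equiv> \<lambda>i. if i = 0 then 1 else 0"
abbreviation neg_end :: "nat \<Rightarrow> real" where "neg_end \<equiv> \<lambda>i. if i = 0 then - 1 else 0"

text \<open>In dimension 0 the target sphere has two points: \<open>disk_collapse 0\<close> is
  constantly \<open>pos_end\<close>, and \<open>sphere_base 0\<close> is
  \<open>neg_end\<close>.\<close>

lemma incidence_map_0:
  assumes "cw_dim K d = 0"
  shows "incidence_map K c d x = (if cw_char K c x \<in> open_cell K d then pos_end else neg_end)"
  using assms by (auto simp: incidence_map_def disk_collapse_def sphere_base_def sq_norm_def fun_eq_iff)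

text \<open>A self-map of the two-point sphere is constant, the identity or the swap, of degree 0, 1
  and -1. A loop at \<open>d\<close> falls under the constant case, with both indicators equal to
  1.\<close>

lemma incidence_edge:
  assumes "cw_dim K c = 1" "cw_dim K d = 0"
  shows "incidence K c d =
    (if cw_char K c pos_end \<in> open_cell K d then 1 else 0) -
    (if cw_char K c neg_end \<in> open_cell K d then 1 else 0)"
proof -
  let ?f = "incidence_map K c d"
  have ends: "topspace (nsphere 0) = {pos_end, neg_end}"
    by (simp add: nsphere_eq boundary_sphere_1[unfolded One_nat_def])
  have deg: "incidence K c d = Brouwer_degree2 0 ?f"
    using assms by (simp add: incidence_def)
  let ?p = "cw_char K c pos_end \<in> open_cell K d" and ?q = "cw_char K c neg_end \<in> open_cell K d"
  have f: "?f pos_end = (if ?p then pos_end else neg_end)" "?f neg_end = (if ?q then pos_end else neg_end)"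
    by (rule incidence_map_0[OF assms(2)])+
  consider (const) "?p \<longleftrightarrow> ?q" | (id) ?p "\<not> ?q" | (swap) "\<not> ?p" ?q by blast
  then show ?thesis
  proof cases
    case const
    then have "?f neg_end = ?f pos_end" using f by simp
    then have "Brouwer_degree2 0 ?f = Brouwer_degree2 0 (\<lambda>_. ?f pos_end)"
      by (intro Brouwer_degree2_eq) (auto simp only: ends)
    then show ?thesis
      using const by (simp add: deg Brouwer_degree2_const)
  next
    case id
    then have "?f pos_end = pos_end" "?f neg_end = neg_end" using f by simp_all
    then have "Brouwer_degree2 0 ?f = Brouwer_degree2 0 id"
      by (intro Brouwer_degree2_eq) (auto simp only: ends id_apply)
    then show ?thesis
      using id by (simp add: deg)
  next
    case swap
    \<comment> \<open>The swap agrees on both points of the sphere with the reflection in coordinate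
      0, and the degree depends on these values only.\<close>
    have "?f pos_end = (\<lambda>i. if i = 0 then - pos_end i else pos_end i)"
      "?f neg_end = (\<lambda>i. if i = 0 then - neg_end i else neg_end i)"
      using f swap by (simp_all add: fun_eq_iff)
    then have "?f x = (\<lambda>i. if i = 0 then - x i else x i)" if "x \<in> {pos_end, neg_end}" for x
      using that by blast
    then have "Brouwer_degree2 0 ?f = Brouwer_degree2 0 (\<lambda>x i. if i = 0 then - x i else x i)"
      by (intro Brouwer_degree2_eq) (simp only: ends)
    then show ?thesis
      using swap by (simp add: deg Brouwer_degree2_reflection)
  qed
qed

section \<open>Vertices, edges and endpoints in the enumeration of cells\<close>

locale filtered_complex =
  fixes F :: "('a, 'c, 'k :: field) reduction_data"
  assumes valid: "valid_reduction_data F"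
begin

abbreviation "N \<equiv> num_cells F"
abbreviation "K \<equiv> rd_complex F"

sublocale finite_cw K
proof
  show "finite_cw_complex K"
    using valid unfolding valid_reduction_data_def Let_def by (elim conjE)
qed

lemma bij_rd_cell: "bij_betw (rd_cell F) {..<N} (cw_cells K)"
  and filt_less: "i < N \<Longrightarrow> j < N \<Longrightarrow> idx_filt F i < idx_filt F j \<Longrightarrow> i < j"
  and subcomplex: "p \<le> N \<Longrightarrow> is_subcomplex K (rd_cell F ` {..<p})"
  and V_carrier: "rd_V F \<in> carrier_mat N N"
  and V_upper: "upper_triangular (rd_V F)"
  and V_diag: "i < N \<Longrightarrow> rd_V F $$ (i, i) = 1"
  and V_dim: "i < N \<Longrightarrow> j < N \<Longrightarrow> rd_V F $$ (i, j) \<noteq> 0 \<Longrightarrow> idx_dim F i = idx_dim F j"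
  and R_eq: "rd_R F = boundary_matrix F * rd_V F"
  and R_reduced: "reduced_matrix (rd_R F)"
  using valid unfolding valid_reduction_data_def Let_def by blast+

lemma rd_cell_in: "i < N \<Longrightarrow> rd_cell F i \<in> cw_cells K"
  using bij_rd_cell by (auto simp: bij_betw_def)

lemma rd_cell_inj: "i < N \<Longrightarrow> j < N \<Longrightarrow> rd_cell F i = rd_cell F j \<Longrightarrow> i = j"
  using bij_rd_cell by (auto simp: bij_betw_def inj_on_def)

lemma filt_mono: "i < N \<Longrightarrow> j < N \<Longrightarrow> i \<le> j \<Longrightarrow> idx_filt F i \<le> idx_filt F j"
  using filt_less[of j i] by fastforce

definition vertices :: "nat set" where
  "vertices = {i. i < N \<and> idx_dim F i = 0}"

definition edges :: "nat set" where
  "edges = {j. j < N \<and> idx_dim F j = 1}"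

lemma finite_vertices: "finite vertices"
  by (simp add: vertices_def)

definition vertex_point :: "nat \<Rightarrow> 'a" where
  "vertex_point i = cw_char K (rd_cell F i) (\<lambda>_. 0)"

lemma idx_cell_vertex: "i \<in> vertices \<Longrightarrow> idx_cell F i = {vertex_point i}"
  by (simp add: vertices_def idx_dim_def idx_cell_def vertex_point_def open_cell_vertex)

lemma idx_cell_unique: "i < N \<Longrightarrow> j < N \<Longrightarrow> x \<in> idx_cell F i \<Longrightarrow> x \<in> idx_cell F j \<Longrightarrow> i = j"
  unfolding idx_cell_def by (meson open_cell_unique rd_cell_in rd_cell_inj)

text \<open>The bound \<open>i < j\<close> comes from the prefix up to and including
  \<open>j\<close> being a subcomplex: the endpoint lies in a cell of this prefix, and by dimension
  that cell is not \<open>j\<close>.\<close>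

lemma ex1_edge_end:
  assumes "j \<in> edges" "x \<in> cell_boundary K (rd_cell F j)"
  shows "\<exists>!i. i \<in> vertices \<and> x \<in> idx_cell F i"
    and "i \<in> vertices \<Longrightarrow> x \<in> idx_cell F i \<Longrightarrow> i < j"
proof -
  have j: "j < N" "cw_dim K (rd_cell F j) = 1"
    using assms(1) by (auto simp: edges_def idx_dim_def)
  have "rd_cell F j \<in> rd_cell F ` {..<Suc j}" by simp
  then obtain k where k: "k < Suc j" "cw_dim K (rd_cell F k) < 1" "x \<in> open_cell K (rd_cell F k)"
    using cell_boundary_subset_lower[OF subcomplex[of "Suc j"], of "rd_cell F j"] assms(2) j by auto
  then have "k \<in> vertices" "x \<in> idx_cell F k" "k < j"
    using j by (auto simp: vertices_def idx_dim_def idx_cell_def less_Suc_eq)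
  moreover have "i = k" if "i \<in> vertices" "x \<in> idx_cell F i" for i
    using idx_cell_unique[of i k x] that \<open>k \<in> vertices\<close> \<open>x \<in> idx_cell F k\<close>
    by (simp add: vertices_def)
  ultimately show "\<exists>!i. i \<in> vertices \<and> x \<in> idx_cell F i"
    and "i \<in> vertices \<Longrightarrow> x \<in> idx_cell F i \<Longrightarrow> i < j"
    by blast+
qed

text \<open>The positive end is called the source, so that the boundary of an edge is its source
  minus its target.\<close>

definition src :: "nat \<Rightarrow> nat" where
  "src j = (THE i. i \<in> vertices \<and> cw_char K (rd_cell F j) pos_end \<in> idx_cell F i)"

definition tgt :: "nat \<Rightarrow> nat" where
  "tgt j = (THE i. i \<in> vertices \<and> cw_char K (rd_cell F j) neg_end \<in> idx_cell F i)"

lemma cell_boundary_edge: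
  assumes "j \<in> edges"
  shows "cell_boundary K (rd_cell F j) =
    {cw_char K (rd_cell F j) pos_end, cw_char K (rd_cell F j) neg_end}"
proof -
  have "cw_dim K (rd_cell F j) = 1" using assms by (simp add: edges_def idx_dim_def)
  then show ?thesis by (simp only: cell_boundary_def boundary_sphere_1) simp
qed

lemma src:
  assumes "j \<in> edges"
  shows "src j \<in> vertices" "src j < j"
    "i \<in> vertices \<Longrightarrow> cw_char K (rd_cell F j) pos_end \<in> idx_cell F i \<longleftrightarrow> src j = i"
proof -
  have "cw_char K (rd_cell F j) pos_end \<in> cell_boundary K (rd_cell F j)"
    by (simp add: cell_boundary_edge[OF assms])
  note ends = ex1_edge_end[OF assms this]
  have *: "src j \<in> vertices \<and> cw_char K (rd_cell F j) pos_end \<in> idx_cell F (src j)"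
    unfolding src_def by (rule theI'[OF ends(1)])
  then show "src j \<in> vertices" "src j < j" using ends(2) by auto
  show "i \<in> vertices \<Longrightarrow> cw_char K (rd_cell F j) pos_end \<in> idx_cell F i \<longleftrightarrow> src j = i"
    using * ends(1) by blast
qed

lemma tgt:
  assumes "j \<in> edges"
  shows "tgt j \<in> vertices" "tgt j < j"
    "i \<in> vertices \<Longrightarrow> cw_char K (rd_cell F j) neg_end \<in> idx_cell F i \<longleftrightarrow> tgt j = i"
proof -
  have "cw_char K (rd_cell F j) neg_end \<in> cell_boundary K (rd_cell F j)"
    by (simp add: cell_boundary_edge[OF assms])
  note ends = ex1_edge_end[OF assms this]
  have *: "tgt j \<in> vertices \<and> cw_char K (rd_cell F j) neg_end \<in> idx_cell F (tgt j)"
    unfolding tgt_def by (rule theI'[OF ends(1)])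
  then show "tgt j \<in> vertices" "tgt j < j" using ends(2) by auto
  show "i \<in> vertices \<Longrightarrow> cw_char K (rd_cell F j) neg_end \<in> idx_cell F i \<longleftrightarrow> tgt j = i"
    using * ends(1) by blast
qed

lemma boundary_matrix_vertex_edge:
  assumes "i \<in> vertices" "j \<in> edges"
  shows "boundary_matrix F $$ (i, j) = (if src j = i then 1 else 0) - (if tgt j = i then 1 else 0)"
proof -
  have "i < N" "j < N" "cw_dim K (rd_cell F j) = 1" "cw_dim K (rd_cell F i) = 0"
    using assms by (auto simp: vertices_def edges_def idx_dim_def)
  then show ?thesis
    using incidence_edge[of K "rd_cell F j" "rd_cell F i"]
      src(3)[OF assms(2,1)] tgt(3)[OF assms(2,1)]
    by (simp add: boundary_matrix_def idx_cell_def)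
qed

lemma boundary_matrix_dim:
  "i < N \<Longrightarrow> j < N \<Longrightarrow> boundary_matrix F $$ (i, j) \<noteq> 0 \<Longrightarrow> idx_dim F j = Suc (idx_dim F i)"
  by (auto simp: boundary_matrix_def incidence_def idx_dim_def split: if_splits)

text \<open>The equivalence relation generated by the edges among the first \<open>p\<close> cells.
  Since the ends of an edge precede it, an index from \<open>p\<close> on is linked only to
  itself.\<close>

definition linked :: "nat \<Rightarrow> (nat \<times> nat) set" where
  "linked p = (\<Union>j\<in>{j \<in> edges. j < p}. {(src j, tgt j), (tgt j, src j)})\<^sup>*"

lemma linked_refl: "(u, u) \<in> linked p"
  by (simp add: linked_def)

lemma linked_trans: "(u, v) \<in> linked p \<Longrightarrow> (v, w) \<in> linked p \<Longrightarrow> (u, w) \<in> linked p"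
  by (simp add: linked_def)

lemma linked_sym:
  assumes "(u, v) \<in> linked p" shows "(v, u) \<in> linked p"
proof -
  have "sym (\<Union>j\<in>{j \<in> edges. j < p}. {(src j, tgt j), (tgt j, src j)})"
    by (auto simp: sym_def)
  then show ?thesis
    using assms unfolding linked_def by (meson sym_rtrancl symD)
qed

lemma linked_edge: "j \<in> edges \<Longrightarrow> j < p \<Longrightarrow> (src j, tgt j) \<in> linked p"
  unfolding linked_def by (rule r_into_rtrancl) blast

lemma linked_induct [consumes 1, case_names refl src_tgt tgt_src]:
  assumes "(u, v) \<in> linked p" "P u"
    "\<And>j. j \<in> edges \<Longrightarrow> j < p \<Longrightarrow> P (src j) \<Longrightarrow> P (tgt j)"
    "\<And>j. j \<in> edges \<Longrightarrow> j < p \<Longrightarrow> P (tgt j) \<Longrightarrow> P (src j)"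
  shows "P v"
  using assms(1) unfolding linked_def
  by (induction rule: rtrancl_induct) (use assms(2-) in auto)

lemma linked_vertex:
  assumes "(u, v) \<in> linked p" "u \<in> vertices" shows "v \<in> vertices"
  using assms by (induction rule: linked_induct) (simp_all add: src(1) tgt(1))

lemma linked_less:
  assumes "(u, v) \<in> linked p" "u < p" shows "v < p"
  using assms
proof (induction rule: linked_induct)
  case (src_tgt j)
  then show ?case using tgt(2)[of j] by simp
next
  case (tgt_src j)
  then show ?case using src(2)[of j] by simp
qed

text \<open>From left to right, the class of \<open>u\<close> is a set of vertices that no edge
  crosses, so it contains every vertex of the component. From right to left, each closed edge is a
  connected set containing both its ends.\<close>

lemma connected_component_iff_linked:
  assumes p: "p \<le> N" and u: "u \<in> vertices" "u < p" and v: "v \<in> vertices" "v < p"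
  shows "connected_component_of (cell_subspace K (rd_cell F ` {..<p})) (vertex_point u) (vertex_point v)
    \<longleftrightarrow> (u, v) \<in> linked p" (is "?C u v \<longleftrightarrow> _")
proof
  let ?S = "rd_cell F ` {..<p}"
  note sub = subcomplex[OF p]
  have point_in: "vertex_point w \<in> open_cell K (rd_cell F w)" if "w \<in> vertices" for w
    using idx_cell_vertex[OF that] by (simp add: idx_cell_def)
  {
    assume C: "?C u v"
    define P where "P = rd_cell F ` {w. (u, w) \<in> linked p}"
    have cls: "w \<in> vertices" "w < p" if "(u, w) \<in> linked p" for w
      using that u linked_vertex linked_less by blast+
    have P: "P \<subseteq> {c \<in> ?S. cw_dim K c = 0}"
      using cls by (auto simp: P_def vertices_def idx_dim_def)
    have in_P: "x \<in> (\<Union>c\<in>P. open_cell K c) \<longleftrightarrow> (u, w) \<in> linked p"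
      if "w \<in> vertices" "x \<in> idx_cell F w" for x w
    proof
      assume "x \<in> (\<Union>c\<in>P. open_cell K c)"
      then obtain w' where w': "(u, w') \<in> linked p" "x \<in> idx_cell F w'"
        by (auto simp: P_def idx_cell_def)
      then have "w' = w"
        using that cls(1)[OF w'(1)] idx_cell_unique[of w' w x] by (simp add: vertices_def)
      with w' show "(u, w) \<in> linked p" by simp
    qed (use that in \<open>auto simp: P_def idx_cell_def\<close>)
    have edges: "\<forall>c\<in>?S. cw_dim K c = 1 \<longrightarrow>
      cell_boundary K c \<subseteq> (\<Union>v\<in>P. open_cell K v) \<or> cell_boundary K c \<inter> (\<Union>v\<in>P. open_cell K v) = {}"
    proof (intro ballI impI)
      fix c assume c: "c \<in> ?S" "cw_dim K c = 1"
      then obtain j where j: "j < p" "c = rd_cell F j" by auto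
      then have e: "j \<in> edges" using c p by (auto simp: edges_def idx_dim_def)
      have "(u, src j) \<in> linked p \<longleftrightarrow> (u, tgt j) \<in> linked p"
        using linked_edge[OF e j(1)] linked_sym linked_trans by blast
      then show "cell_boundary K c \<subseteq> (\<Union>v\<in>P. open_cell K v) \<or> cell_boundary K c \<inter> (\<Union>v\<in>P. open_cell K v) = {}"
        using in_P[OF src(1)[OF e], of "cw_char K c pos_end"] in_P[OF tgt(1)[OF e], of "cw_char K c neg_end"]
          src[OF e] tgt[OF e] j(2) unfolding cell_boundary_edge[OF e, folded j(2)] by blast
    qed
    have "rd_cell F v \<in> P"
    proof (rule connected_component_separated[OF sub P edges C])
      show "rd_cell F u \<in> P" by (auto simp: P_def linked_refl)
    qed (use u v point_in in \<open>auto simp: vertices_def idx_dim_def\<close>)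
    then obtain w where w: "(u, w) \<in> linked p" "rd_cell F v = rd_cell F w"
      by (auto simp: P_def)
    have "v < N" "w < N" using v cls(1)[OF w(1)] by (simp_all add: vertices_def)
    with w(2) have "v = w" by (rule rd_cell_inj[rotated 2])
    with w(1) show "(u, v) \<in> linked p" by simp
  }
  {
    assume "(u, v) \<in> linked p"
    have ends: "vertex_point (src j) \<in> closed_cell K (rd_cell F j)"
      "vertex_point (tgt j) \<in> closed_cell K (rd_cell F j)" if j: "j \<in> edges" for j
    proof -
      have "cw_char K (rd_cell F j) pos_end = vertex_point (src j)"
        "cw_char K (rd_cell F j) neg_end = vertex_point (tgt j)"
        using src(1)[OF j] src(3)[OF j, of "src j"] tgt(1)[OF j] tgt(3)[OF j, of "tgt j"]
        by (simp_all add: idx_cell_vertex)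
      then show "vertex_point (src j) \<in> closed_cell K (rd_cell F j)"
        "vertex_point (tgt j) \<in> closed_cell K (rd_cell F j)"
        unfolding closed_cell_Un cell_boundary_edge[OF j] by simp_all
    qed
    have step: "?C (src j) (tgt j)" "?C (tgt j) (src j)" if "j \<in> edges" "j < p" for j
      using that ends[OF that(1)] connected_component_closed_cell[OF sub, of "rd_cell F j"]
      by simp_all
    show "?C u v"
      using \<open>(u, v) \<in> linked p\<close>
    proof (induction rule: linked_induct)
      case refl
      have "vertex_point u \<in> topspace (cell_subspace K ?S)"
        using point_in[OF u(1)] u(2) unfolding topspace_cell_subspace[OF sub] by blast
      then show ?case by (simp only: connected_component_of_refl)
    next
      case (src_tgt j)
      then show ?case using step(1) by (meson connected_component_of_trans)
    next
      case (tgt_src j)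
      then show ?case using step(2) by (meson connected_component_of_trans)
    qed
  }
qed

end

section \<open>Boundaries and lows\<close>

lemma low_props:
  assumes "c \<in> carrier_vec n" "c \<noteq> 0\<^sub>v n"
  shows "low c < n" "c $ low c \<noteq> 0" "\<And>i. low c < i \<Longrightarrow> i < n \<Longrightarrow> c $ i = 0"
proof -
  let ?S = "{i. i < dim_vec c \<and> c $ i \<noteq> 0}"
  have "?S \<noteq> {}"
  proof
    assume "?S = {}"
    then have "c = 0\<^sub>v n" using assms(1) by (intro eq_vecI) auto
    with assms(2) show False by simp
  qed
  then have "Max ?S \<in> ?S" by (intro Max_in) auto
  then show "low c < n" "c $ low c \<noteq> 0" using assms(1) by (auto simp: low_def)
  show "c $ i = 0" if "low c < i" "i < n" for i
  proof (rule ccontr)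
    assume "c $ i \<noteq> 0"
    then have "i \<le> Max ?S" using that assms(1) by (intro Max_ge) auto
    with that show False by (simp add: low_def)
  qed
qed

lemma low_eqI:
  assumes "c \<in> carrier_vec n" "i < n" "c $ i \<noteq> 0" "\<And>j. i < j \<Longrightarrow> j < n \<Longrightarrow> c $ j = 0"
  shows "low c = i"
  unfolding low_def using assms by (intro Max_eqI) (auto simp: not_less[symmetric])

lemma mult_mat_vec_entry:
  assumes "A \<in> carrier_mat n n" "x \<in> carrier_vec n" "i < n"
  shows "(A *\<^sub>v x) $ i = (\<Sum>j<n. A $$ (i, j) * x $ j)"
  using assms by (simp add: scalar_prod_def row_def atLeast0LessThan)

lemma mult_unit_vec:
  assumes "A \<in> carrier_mat n n" "j < n"
  shows "A *\<^sub>v unit_vec n j = col (A :: 'a :: semiring_1 mat) j"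
proof (rule eq_vecI)
  fix i assume "i < dim_vec (col A j)"
  then have i: "i < n" using assms by simp
  have "(A *\<^sub>v unit_vec n j) $ i = (\<Sum>k<n. if k = j then A $$ (i, j) else 0)"
    unfolding mult_mat_vec_entry[OF assms(1) unit_vec_carrier i]
    using assms(2) by (intro sum.cong refl) auto
  then show "(A *\<^sub>v unit_vec n j) $ i = col A j $ i"
    using assms i by simp
qed (use assms in simp)

context filtered_complex
begin

section \<open>Chains and boundaries of a prefix\<close>

abbreviation "D \<equiv> boundary_matrix F"
abbreviation "R \<equiv> rd_R F"
abbreviation "V \<equiv> rd_V F"
abbreviation "cells p \<equiv> rd_cell F ` {..<p}"

lemma D_carrier: "D \<in> carrier_mat N N"
  by (simp add: boundary_matrix_def)

lemma R_carrier: "R \<in> carrier_mat N N"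
  using D_carrier V_carrier by (simp add: R_eq)

lemma col_carrier_V: "col V j \<in> carrier_vec N"
  using V_carrier by (intro carrier_vecI) simp

lemma col_R: "j < N \<Longrightarrow> col R j = D *\<^sub>v col V j"
  unfolding R_eq using D_carrier V_carrier by (rule col_mult2)

lemma chains_carrier: "x \<in> chains F n S \<Longrightarrow> x \<in> carrier_vec N"
  by (simp add: chains_def)

lemma chains_add: "x \<in> chains F n S \<Longrightarrow> y \<in> chains F n S \<Longrightarrow> x + y \<in> chains F n S"
  by (auto simp: chains_def)

lemma chains_smult: "x \<in> chains F n S \<Longrightarrow> k \<cdot>\<^sub>v x \<in> chains F n S"
  by (auto simp: chains_def)

lemma chains_zero: "0\<^sub>v N \<in> chains F n S"
  by (auto simp: chains_def)

lemma chains_mono: "S \<subseteq> T \<Longrightarrow> chains F n S \<subseteq> chains F n T"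
  by (auto simp: chains_def)

lemma chains_unit: "i < N \<Longrightarrow> idx_dim F i = n \<Longrightarrow> rd_cell F i \<in> S \<Longrightarrow> unit_vec N i \<in> chains F n S"
  by (simp add: chains_def)

lemma rd_cell_in_cells: "i < N \<Longrightarrow> p \<le> N \<Longrightarrow> rd_cell F i \<in> cells p \<longleftrightarrow> i < p"
  using rd_cell_inj[of i] by (auto intro: less_le_trans)

lemma chains_cells:
  assumes "p \<le> N"
  shows "x \<in> chains F n (cells p) \<longleftrightarrow>
    x \<in> carrier_vec N \<and> (\<forall>i<N. x $ i \<noteq> 0 \<longrightarrow> idx_dim F i = n \<and> i < p)"
  using rd_cell_in_cells[OF _ assms] by (auto simp: chains_def)

lemma boundaries_carrier: "x \<in> boundaries F n S \<Longrightarrow> x \<in> carrier_vec N"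
  using D_carrier by (auto simp: boundaries_def chains_carrier)

lemma boundaries_zero: "0\<^sub>v N \<in> boundaries F n S"
proof -
  have "D *\<^sub>v 0\<^sub>v N = 0\<^sub>v N"
    using D_carrier by (intro eq_vecI) auto
  then show ?thesis
    unfolding boundaries_def by (metis chains_zero image_eqI)
qed

lemma boundaries_add:
  assumes "x \<in> boundaries F n S" "y \<in> boundaries F n S"
  shows "x + y \<in> boundaries F n S"
proof -
  obtain a b where "a \<in> chains F (Suc n) S" "b \<in> chains F (Suc n) S" "x = D *\<^sub>v a" "y = D *\<^sub>v b"
    using assms by (auto simp: boundaries_def)
  moreover from this have "x + y = D *\<^sub>v (a + b)"
    using mult_add_distrib_mat_vec[OF D_carrier] chains_carrier by metis
  ultimately show ?thesis
    unfolding boundaries_def by (metis chains_add image_eqI)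
qed

lemma boundaries_smult:
  assumes "x \<in> boundaries F n S"
  shows "k \<cdot>\<^sub>v x \<in> boundaries F n S"
proof -
  obtain a where "a \<in> chains F (Suc n) S" "x = D *\<^sub>v a"
    using assms by (auto simp: boundaries_def)
  moreover from this have "k \<cdot>\<^sub>v x = D *\<^sub>v (k \<cdot>\<^sub>v a)"
    using mult_mat_vec[OF D_carrier] chains_carrier by metis
  ultimately show ?thesis
    unfolding boundaries_def by (metis chains_smult image_eqI)
qed

lemma boundaries_diff:
  assumes "x \<in> boundaries F n S" "y \<in> boundaries F n S"
  shows "x - y \<in> boundaries F n S"
proof -
  have "x - y = x + (- 1) \<cdot>\<^sub>v y"
    using assms[THEN boundaries_carrier] by (intro eq_vecI) auto
  then show ?thesis
    using assms boundaries_add boundaries_smult by metis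
qed

lemma boundaries_mono: "S \<subseteq> T \<Longrightarrow> boundaries F n S \<subseteq> boundaries F n T"
  unfolding boundaries_def by (intro image_mono chains_mono)

lemma boundary_entry:
  assumes x: "x \<in> chains F 1 (cells p)" and p: "p \<le> N" and i: "i \<in> vertices"
  shows "(D *\<^sub>v x) $ i =
    (\<Sum>j\<in>{j \<in> edges. j < p}. ((if src j = i then 1 else 0) - (if tgt j = i then 1 else 0)) * x $ j)"
proof -
  have "(D *\<^sub>v x) $ i = (\<Sum>j<N. D $$ (i, j) * x $ j)"
    using i chains_carrier[OF x] by (intro mult_mat_vec_entry[OF D_carrier]) (auto simp: vertices_def)
  also have "\<dots> = (\<Sum>j\<in>{j \<in> edges. j < p}. D $$ (i, j) * x $ j)"
    using x p by (intro sum.mono_neutral_right) (auto simp: edges_def chains_cells)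
  also have "\<dots> = (\<Sum>j\<in>{j \<in> edges. j < p}.
      ((if src j = i then 1 else 0) - (if tgt j = i then 1 else 0)) * x $ j)"
    by (intro sum.cong refl) (simp only: boundary_matrix_vertex_edge[OF i] mem_Collect_eq)
  finally show ?thesis .
qed

text \<open>An edge of the prefix has both ends in a class or neither, so its contributions 1 and -1
  cancel. The sum over a class is the functional that controls the lows and, later, forces the
  transition coefficients.\<close>

lemma boundary_class_sum:
  assumes x: "x \<in> boundaries F 0 (cells p)" and p: "p \<le> N" and u: "u \<in> vertices"
  shows "(\<Sum>i\<in>{i. (u, i) \<in> linked p}. x $ i) = 0"
proof -
  let ?C = "{i. (u, i) \<in> linked p}"
  have C: "?C \<subseteq> vertices" using linked_vertex u by blast
  then have fin: "finite ?C" using finite_vertices finite_subset by blast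
  obtain y where y: "y \<in> chains F 1 (cells p)" "x = D *\<^sub>v y"
    using x by (auto simp: boundaries_def)
  have "(\<Sum>i\<in>?C. x $ i) = (\<Sum>i\<in>?C. \<Sum>j\<in>{j \<in> edges. j < p}.
      ((if src j = i then 1 else 0) - (if tgt j = i then 1 else 0)) * y $ j)"
    unfolding y(2) using C by (intro sum.cong refl boundary_entry[OF y(1) p]) auto
  also have "\<dots> = (\<Sum>j\<in>{j \<in> edges. j < p}. (\<Sum>i\<in>?C.
      (if src j = i then 1 else 0) - (if tgt j = i then 1 else 0)) * y $ j)"
    by (subst sum.swap) (simp add: sum_distrib_right)
  also have "\<dots> = (\<Sum>j\<in>{j \<in> edges. j < p}. 0)"
  proof (intro sum.cong refl)
    fix j assume "j \<in> {j \<in> edges. j < p}"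
    then have "(src j, tgt j) \<in> linked p" using linked_edge by simp
    then have "src j \<in> ?C \<longleftrightarrow> tgt j \<in> ?C"
      using linked_sym linked_trans by blast
    then show "(\<Sum>i\<in>?C. (if src j = i then 1 else 0) - (if tgt j = i then 1 else 0)) * y $ j = 0"
      using fin by (simp add: sum_subtractf)
  qed
  finally show ?thesis by simp
qed

text \<open>Rows of cells that are not vertices vanish by dimension; for a loop both sides are
  zero.\<close>

lemma edge_boundary:
  assumes j: "j \<in> edges"
  shows "D *\<^sub>v unit_vec N j = unit_vec N (src j) - unit_vec N (tgt j)"
proof (rule eq_vecI)
  fix i assume "i < dim_vec (unit_vec N (src j) - unit_vec N (tgt j))"
  then have i: "i < N" by simp
  have jN: "j < N" using j by (simp add: edges_def)
  have lt: "src j < N" "tgt j < N" using src[OF j] tgt[OF j] by (auto simp: vertices_def)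
  have "(D *\<^sub>v unit_vec N j) $ i = D $$ (i, j)"
    using D_carrier i jN by (simp add: mult_unit_vec)
  also have "\<dots> = (if src j = i then 1 else 0) - (if tgt j = i then 1 else 0)"
  proof (cases "i \<in> vertices")
    case True
    then show ?thesis using boundary_matrix_vertex_edge j by blast
  next
    case False
    then have "src j \<noteq> i" "tgt j \<noteq> i" using src(1)[OF j] tgt(1)[OF j] by auto
    moreover have "D $$ (i, j) = 0"
      using boundary_matrix_dim[OF i jN] False i j by (auto simp: vertices_def edges_def)
    ultimately show ?thesis by simp
  qed
  finally show "(D *\<^sub>v unit_vec N j) $ i = (unit_vec N (src j) - unit_vec N (tgt j)) $ i"
    using i lt by simp
qed (use D_carrier in auto)

text \<open>The boundaries of the edges along a walk from \<open>u\<close> to \<open>v\<close>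
  telescope.\<close>

lemma linked_boundary:
  assumes uv: "(u, v) \<in> linked p" and p: "p \<le> N"
  shows "unit_vec N u - unit_vec N v \<in> boundaries F 0 (cells p)"
proof -
  have edge: "unit_vec N (src j) - unit_vec N (tgt j) \<in> boundaries F 0 (cells p)"
    if j: "j \<in> edges" "j < p" for j
  proof -
    have "unit_vec N j \<in> chains F 1 (cells p)"
      using j by (intro chains_unit) (auto simp: edges_def)
    then show ?thesis
      unfolding edge_boundary[OF j(1), symmetric] boundaries_def by simp
  qed
  show ?thesis
    using uv
  proof (induction rule: linked_induct)
    case refl
    have "unit_vec N u - unit_vec N u = (0\<^sub>v N :: 'k vec)" by (intro eq_vecI) auto
    then show ?case by (simp only: boundaries_zero)
  next
    case (src_tgt j)
    have "unit_vec N u - unit_vec N (tgt j) =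
      (unit_vec N u - unit_vec N (src j)) + (unit_vec N (src j) - unit_vec N (tgt j) :: 'k vec)"
      by (intro eq_vecI) auto
    then show ?case using boundaries_add src_tgt edge by metis
  next
    case (tgt_src j)
    have "unit_vec N u - unit_vec N (src j) =
      (unit_vec N u - unit_vec N (tgt j)) - (unit_vec N (src j) - unit_vec N (tgt j) :: 'k vec)"
      by (intro eq_vecI) auto
    then show ?case using boundaries_diff tgt_src edge by metis
  qed
qed

text \<open>Upper triangularity keeps the column within the cells up to \<open>j\<close>, and
  dimension preservation keeps it among the edges.\<close>

lemma col_V_chain:
  assumes "j \<in> edges" "j < p" "p \<le> N"
  shows "col V j \<in> chains F 1 (cells p)"
proof -
  have "V $$ (i, j) = 0" if "j < i" "i < N" for i
    using upper_triangularD[OF V_upper, of j i] that V_carrier by simp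
  then have le: "i \<le> j" if "i < N" "V $$ (i, j) \<noteq> 0" for i
    using that not_le by blast
  have j: "j < N" "idx_dim F j = 1" using assms(1) by (auto simp: edges_def)
  have entry: "col V j $ i = V $$ (i, j)" if "i < N" for i
    using that j V_carrier by simp
  show ?thesis
    unfolding chains_cells[OF assms(3)]
  proof (intro conjI allI impI)
    show "col V j \<in> carrier_vec N" by (rule col_carrier_V)
    fix i assume i: "i < N" "col V j $ i \<noteq> 0"
    then have "V $$ (i, j) \<noteq> 0" by (simp add: entry)
    then show "idx_dim F i = 1" "i < p"
      using V_dim[OF i(1) j(1)] le[OF i(1)] j(2) assms(2) by simp_all
  qed
qed

lemma R_dim:
  assumes "i < N" "j < N" "R $$ (i, j) \<noteq> 0"
  shows "idx_dim F j = Suc (idx_dim F i)"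
proof -
  have "R $$ (i, j) = (D *\<^sub>v col V j) $ i"
    unfolding col_R[OF assms(2), symmetric] using assms R_carrier by simp
  also have "\<dots> = (\<Sum>k<N. D $$ (i, k) * V $$ (k, j))"
    unfolding mult_mat_vec_entry[OF D_carrier col_carrier_V assms(1)]
    using assms V_carrier by (intro sum.cong refl) simp
  finally have "R $$ (i, j) = (\<Sum>k<N. D $$ (i, k) * V $$ (k, j))" .
  then have "(\<Sum>k<N. D $$ (i, k) * V $$ (k, j)) \<noteq> 0" using assms(3) by simp
  then obtain k where k: "k < N" "D $$ (i, k) * V $$ (k, j) \<noteq> 0"
    by (rule sum.not_neutral_contains_not_neutral) simp
  then have nz: "D $$ (i, k) \<noteq> 0" "V $$ (k, j) \<noteq> 0" by auto
  show ?thesis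
    using boundary_matrix_dim[OF assms(1) k(1) nz(1)] V_dim[OF k(1) assms(2) nz(2)] by simp
qed

text \<open>By \<open>R_dim\<close>, a nonzero entry would sit in a row of dimension one less than
  0.\<close>

lemma positive_vertex: "i \<in> vertices \<Longrightarrow> positive_cell F i"
  unfolding positive_cell_def using R_carrier R_dim[of _ i]
  by (intro eq_vecI) (auto simp: vertices_def)

text \<open>Clearing the entries of a chain from the top with the columns of \<open>V\<close>: the boundaries are
  spanned by the columns of \<open>R\<close>.\<close>

lemma boundary_reduction:
  assumes "p \<le> N" "y \<in> chains F 1 (cells p)"
  shows "\<exists>z\<in>chains F 1 (cells p). D *\<^sub>v y = R *\<^sub>v z"
  using assms
proof (induction p arbitrary: y)
  case 0
  then have "y = 0\<^sub>v N" by (intro eq_vecI) (auto simp: chains_def)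
  then show ?case
    using chains_zero D_carrier R_carrier by (intro bexI[of _ "0\<^sub>v N"]) auto
next
  case (Suc p)
  note y = Suc.prems(2)[unfolded chains_cells[OF Suc.prems(1)]]
  show ?case
  proof (cases "p \<in> edges")
    case False
    have "i < p" if "i < N" "y $ i \<noteq> 0" for i
      using y that False by (cases "i = p") (auto simp: edges_def)
    then have "y \<in> chains F 1 (cells p)"
      using y Suc.prems(1) by (auto simp: chains_cells)
    moreover have "chains F 1 (cells p) \<subseteq> chains F 1 (cells (Suc p))"
      by (intro chains_mono image_mono) auto
    ultimately show ?thesis using Suc.IH Suc.prems(1) by fastforce
  next
    case True
    then have pN: "p < N" by (simp add: edges_def)
    note Vp = col_carrier_V[of p]
    \<comment> \<open>As \<open>V\<close> has unit diagonal, this clears entry \<open>p\<close>; as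
      \<open>V\<close> is upper triangular, no entry beyond \<open>p\<close> appears.\<close>
    define y' where "y' = y - y $ p \<cdot>\<^sub>v col V p"
    have y'_entry: "y' $ i = y $ i - y $ p * V $$ (i, p)" if "i < N" for i
      using that pN y V_carrier by (simp add: y'_def)
    have "y' \<in> chains F 1 (cells p)"
      unfolding chains_cells[OF less_imp_le[OF pN]]
    proof (intro conjI allI impI)
      show "y' \<in> carrier_vec N" using y Vp by (simp add: y'_def)
      fix i assume i: "i < N" "y' $ i \<noteq> 0"
      then have "y $ i \<noteq> 0 \<or> V $$ (i, p) \<noteq> 0" using y'_entry by auto
      then show "idx_dim F i = 1" using y V_dim[of i p] i pN True by (auto simp: edges_def)
      show "i < p"
      proof (rule ccontr)
        assume "\<not> i < p"
        then consider "i = p" | "p < i" by linarith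
        then show False
        proof cases
          case 1
          then show False using y'_entry[OF pN] i V_diag[OF pN] by simp
        next
          case 2
          then have "y $ i = 0" using y i by auto
          moreover have "V $$ (i, p) = 0"
            using 2 i upper_triangularD[OF V_upper, of p i] V_carrier by simp
          ultimately show False using y'_entry i by simp
        qed
      qed
    qed
    then obtain z where z: "z \<in> chains F 1 (cells p)" "D *\<^sub>v y' = R *\<^sub>v z"
      using Suc.IH pN by force
    have zc: "z \<in> carrier_vec N" using z chains_carrier by blast
    \<comment> \<open>The subtracted multiple is recorded in entry \<open>p\<close>, because
      \<open>D\<close> maps column \<open>p\<close> of \<open>V\<close> to column \<open>p\<close>
      of \<open>R\<close>.\<close>
    define z' where "z' = z + y $ p \<cdot>\<^sub>v unit_vec N p"
    have "z' \<in> chains F 1 (cells (Suc p))"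
      unfolding z'_def
    proof (intro chains_add chains_smult chains_unit)
      show "z \<in> chains F 1 (cells (Suc p))"
        using z(1) chains_mono[of "cells p" "cells (Suc p)"] by fastforce
    qed (use pN True in \<open>auto simp: edges_def\<close>)
    moreover have "D *\<^sub>v y = R *\<^sub>v z'"
    proof -
      have "y = y' + y $ p \<cdot>\<^sub>v col V p"
        using y Vp V_carrier by (intro eq_vecI) (auto simp: y'_def)
      then have "D *\<^sub>v y = D *\<^sub>v y' + y $ p \<cdot>\<^sub>v col R p"
        using mult_add_distrib_mat_vec[OF D_carrier, of y' "y $ p \<cdot>\<^sub>v col V p"]
          mult_mat_vec[OF D_carrier Vp] y Vp by (simp add: col_R pN y'_def)
      also have "col R p = R *\<^sub>v unit_vec N p"
        using mult_unit_vec[OF R_carrier pN] by simp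
      also have "D *\<^sub>v y' + y $ p \<cdot>\<^sub>v (R *\<^sub>v unit_vec N p) = R *\<^sub>v z'"
        using mult_add_distrib_mat_vec[OF R_carrier zc, of "y $ p \<cdot>\<^sub>v unit_vec N p"]
          mult_mat_vec[OF R_carrier, of "unit_vec N p"] by (simp add: z(2) z'_def)
      finally show ?thesis .
    qed
    ultimately show ?thesis by blast
  qed
qed

text \<open>Lows that are pairwise distinct cannot cancel: in a combination of reduced columns, the
  largest low that occurs receives a contribution from one column only, so it is the low of the
  sum.\<close>

lemma low_of_boundary:
  assumes p: "p \<le> N" and x: "x \<in> boundaries F 0 (cells p)" "x \<noteq> 0\<^sub>v N"
  shows "\<exists>j<p. col R j \<noteq> 0\<^sub>v N \<and> low (col R j) = low x"
proof -
  obtain y where "y \<in> chains F 1 (cells p)" "x = D *\<^sub>v y"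
    using x by (auto simp: boundaries_def)
  then obtain z where z: "z \<in> chains F 1 (cells p)" "x = R *\<^sub>v z"
    using boundary_reduction[OF p] by metis
  have entry: "x $ i = (\<Sum>j<N. R $$ (i, j) * z $ j)" if "i < N" for i
    unfolding z(2) by (rule mult_mat_vec_entry[OF R_carrier chains_carrier[OF z(1)] that])
  \<comment> \<open>Zero columns are left out, since \<open>low\<close> of a zero vector is
    \<open>Max {}\<close> and says nothing.\<close>
  define J where "J = {j. j < N \<and> z $ j \<noteq> 0 \<and> col R j \<noteq> 0\<^sub>v N}"
  have colR: "col R j \<in> carrier_vec N" for j using R_carrier by (intro carrier_vecI) simp
  have R_zero: "R $$ (i, j) = 0" if "i < N" "j < N" "col R j = 0\<^sub>v N" for i j
    using that R_carrier by (metis carrier_matD index_col index_zero_vec(1))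
  have "J \<noteq> {}"
  proof
    assume J: "J = {}"
    have "x $ i = 0" if "i < N" for i
    proof -
      have "R $$ (i, j) * z $ j = 0" if "j < N" for j
        using J R_zero[OF \<open>i < N\<close> that] that by (auto simp: J_def)
      then show ?thesis unfolding entry[OF that] by (intro sum.neutral) auto
    qed
    then have "x = 0\<^sub>v N" using boundaries_carrier[OF x(1)] by (intro eq_vecI) auto
    with x(2) show False by simp
  qed
  moreover have "finite J" by (simp add: J_def)
  ultimately have "Max ((\<lambda>j. low (col R j)) ` J) \<in> (\<lambda>j. low (col R j)) ` J"
    by (intro Max_in) auto
  then obtain j0 where j0: "j0 \<in> J" "low (col R j0) = Max ((\<lambda>j. low (col R j)) ` J)" by auto
  have max: "low (col R j) \<le> low (col R j0)" if "j \<in> J" for j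
    unfolding j0(2) using that \<open>finite J\<close> by (intro Max_ge) auto
  have distinct: "low (col R j) \<noteq> low (col R j0)" if "j \<in> J" "j \<noteq> j0" for j
    using R_reduced that j0(1) R_carrier unfolding reduced_matrix_def J_def by auto
  let ?l = "low (col R j0)"
  have l: "?l < N" using low_props(1)[OF colR] j0(1) by (simp add: J_def)
  have vanish: "R $$ (i, j) * z $ j = 0"
    if "j < N" "i < N" "?l < i \<or> i = ?l \<and> j \<noteq> j0" for i j
  proof (cases "j \<in> J")
    case True
    then have "low (col R j) < i" using that max[OF True] distinct[OF True] by fastforce
    then have "col R j $ i = 0"
      using low_props(3)[OF colR] True that by (simp add: J_def)
    then show ?thesis using that R_carrier by simp
  next
    case False
    then show ?thesis using R_zero that by (auto simp: J_def)
  qed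
  have "low x = ?l"
  proof (rule low_eqI[OF boundaries_carrier[OF x(1)] l])
    have "x $ ?l = R $$ (?l, j0) * z $ j0"
    proof -
      have "x $ ?l = (\<Sum>j\<in>{j0}. R $$ (?l, j) * z $ j)"
        unfolding entry[OF l] using vanish l j0(1)
        by (intro sum.mono_neutral_right) (auto simp: J_def)
      then show ?thesis by simp
    qed
    moreover have "R $$ (?l, j0) \<noteq> 0"
      using low_props(2)[OF colR, of j0] j0(1) l R_carrier by (simp add: J_def)
    ultimately show "x $ ?l \<noteq> 0" using j0(1) by (simp add: J_def)
  next
    fix i assume "?l < i" "i < N"
    then show "x $ i = 0" unfolding entry[OF \<open>i < N\<close>] using vanish by (intro sum.neutral) auto
  qed
  moreover have "j0 < p"
    using j0(1) z(1) chains_cells[OF p] by (auto simp: J_def)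
  ultimately show ?thesis using j0(1) by (auto simp: J_def)
qed

text \<open>If \<open>i\<close> is the low of a column, the vanishing sum over the class of
  \<open>i\<close> needs a second nonzero entry there, which must lie below the low. Conversely, if
  \<open>m < i\<close> is linked to \<open>i\<close>, then
  \<open>unit_vec N i - unit_vec N m\<close> is a boundary with low \<open>i\<close>.\<close>

lemma low_iff_not_min:
  assumes p: "p \<le> N" and i: "i \<in> vertices"
  shows "(\<exists>j<p. col R j \<noteq> 0\<^sub>v N \<and> low (col R j) = i) \<longleftrightarrow> (\<exists>m<i. (i, m) \<in> linked p)"
proof
  assume "\<exists>j<p. col R j \<noteq> 0\<^sub>v N \<and> low (col R j) = i"
  then obtain j where j: "j < p" "col R j \<noteq> 0\<^sub>v N" "low (col R j) = i" by blast
  have colR: "col R j \<in> carrier_vec N" using R_carrier by (intro carrier_vecI) simp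
  have iN: "i < N" "j < N" using i j p by (auto simp: vertices_def)
  then have nz: "col R j $ i \<noteq> 0" using low_props(2)[OF colR j(2)] j(3) by simp
  then have "j \<in> edges"
    using R_dim[OF iN] i iN R_carrier by (simp add: vertices_def edges_def)
  then have "col V j \<in> chains F 1 (cells p)" by (rule col_V_chain[OF _ j(1) p])
  then have "col R j \<in> boundaries F 0 (cells p)"
    unfolding col_R[OF iN(2)] boundaries_def by simp
  then have sum: "(\<Sum>k\<in>{k. (i, k) \<in> linked p}. col R j $ k) = 0"
    by (rule boundary_class_sum[OF _ p i])
  let ?C = "{k. (i, k) \<in> linked p}"
  have C: "?C \<subseteq> vertices" using linked_vertex i by blast
  then have "finite ?C" using finite_vertices finite_subset by blast
  moreover have "i \<in> ?C" by (simp add: linked_refl)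
  ultimately have "(\<Sum>k\<in>?C - {i}. col R j $ k) = - (col R j $ i)"
    using sum by (subst (asm) sum.remove) (auto simp: add_eq_0_iff2)
  then obtain m where m: "m \<in> ?C - {i}" "col R j $ m \<noteq> 0"
    using nz by (metis neg_equal_0_iff_equal sum.neutral)
  moreover have "m < N" using m(1) C by (auto simp: vertices_def)
  ultimately have "m < i"
    using low_props(3)[OF colR j(2), of m] j(3) by (metis DiffE linorder_neqE_nat singletonI)
  with m(1) show "\<exists>m<i. (i, m) \<in> linked p" by blast
next
  assume "\<exists>m<i. (i, m) \<in> linked p"
  then obtain m where m: "m < i" "(i, m) \<in> linked p" by blast
  let ?x = "unit_vec N i - unit_vec N m :: 'k vec"
  have iN: "i < N" using i by (simp add: vertices_def)
  have xb: "?x \<in> boundaries F 0 (cells p)" by (rule linked_boundary[OF m(2) p])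
  have "?x $ i = 1" using iN m(1) by simp
  then have "?x \<noteq> 0\<^sub>v N" using iN by (metis index_zero_vec(1) zero_neq_one)
  moreover have "low ?x = i"
    using iN m(1) by (intro low_eqI[where n = N]) auto
  ultimately show "\<exists>j<p. col R j \<noteq> 0\<^sub>v N \<and> low (col R j) = i"
    using low_of_boundary[OF p xb] by simp
qed

text \<open>Filtration values increase along the enumeration, so the cells of value at most
  \<open>t\<close> form a prefix, and this is its length. The conjunct \<open>n < N\<close> makes
  \<open>N\<close> a witness, so that the least index exists.\<close>

definition level :: "real \<Rightarrow> nat" where
  "level t = (LEAST n. \<not> (n < N \<and> idx_filt F n \<le> t))"

lemma level_le: "level t \<le> N"
  unfolding level_def by (rule Least_le) simp

lemma less_level_iff: "i < N \<Longrightarrow> i < level t \<longleftrightarrow> idx_filt F i \<le> t"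
proof
  assume "i < level t"
  then show "idx_filt F i \<le> t" unfolding level_def using not_less_Least by blast
next
  assume i: "i < N" "idx_filt F i \<le> t"
  have "\<not> (level t < N \<and> idx_filt F (level t) \<le> t)"
    unfolding level_def by (rule LeastI[of _ N]) simp
  then show "i < level t"
    using i filt_mono[of "level t" i] by (metis dual_order.trans le_less_linear order_le_less_trans)
qed

lemma cells_le_eq: "cells_le F t = cells (level t)"
proof -
  have "cells_le F t = rd_cell F ` {i. i < N \<and> idx_filt F i \<le> t}"
    using bij_rd_cell by (auto simp: cells_le_def bij_betw_def idx_filt_def)
  moreover have "{i. i < N \<and> idx_filt F i \<le> t} = {..<level t}"
    using less_level_iff level_le by (auto dest: less_le_trans)
  ultimately show ?thesis by simp
qed

text \<open>The death is the value of the column whose low is \<open>i\<close>, so it exceeds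
  \<open>t\<close> iff no column of the prefix \<open>level t\<close> has this low. Reducedness
  makes the column chosen in \<open>pair\<close> unique.\<close>

lemma death_gt_iff:
  assumes i: "i \<in> vertices"
  shows "ereal t < death F i \<longleftrightarrow> (\<forall>m. (i, m) \<in> linked (level t) \<longrightarrow> i \<le> m)"
proof -
  define P where "P j \<longleftrightarrow> j < N \<and> col R j \<noteq> 0\<^sub>v N \<and> low (col R j) = i" for j
  have uniq: "j = k" if "P j" "P k" for j k
    using that R_reduced R_carrier unfolding P_def reduced_matrix_def by fastforce
  have pair: "pair F i = (if \<exists>j. P j then Some (THE j. P j) else None)"
    by (simp add: pair_def P_def Let_def)
  have "(\<exists>m<i. (i, m) \<in> linked (level t)) \<longleftrightarrow> (\<exists>j<level t. P j)"
    unfolding low_iff_not_min[OF level_le i, symmetric] P_def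
    using level_le by (auto dest: less_le_trans)
  moreover have "ereal t < death F i \<longleftrightarrow> \<not> (\<exists>j<level t. P j)"
  proof (cases "\<exists>j. P j")
    case True
    then obtain j where j: "P j" by blast
    then have "pair F i = Some j" using uniq pair by (auto intro: the_equality)
    then have "ereal t < death F i \<longleftrightarrow> t < idx_filt F j" by (simp add: death_def)
    also have "\<dots> \<longleftrightarrow> \<not> j < level t" using j less_level_iff[of j t] by (auto simp: P_def)
    finally show ?thesis using j uniq by blast
  next
    case False
    then show ?thesis by (simp add: death_def pair)
  qed
  ultimately show ?thesis by (metis not_le)
qed

section \<open>Transition coefficients\<close>

lemma chains_0_cycles: "cycles F 0 S = chains F 0 S"
proof -
  have "D *\<^sub>v x = 0\<^sub>v N" if x: "x \<in> chains F 0 S" for x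
  proof (rule eq_vecI)
    fix i assume "i < dim_vec (0\<^sub>v N :: 'k vec)"
    then have i: "i < N" by simp
    have "D $$ (i, j) * x $ j = 0" if "j < N" for j
      using boundary_matrix_dim[OF i that] x that
      by (cases "D $$ (i, j) = 0"; cases "x $ j = 0") (simp_all add: chains_def)
    then show "(D *\<^sub>v x) $ i = 0\<^sub>v N $ i"
      unfolding mult_mat_vec_entry[OF D_carrier chains_carrier[OF x] i]
      using i by (simp add: sum.neutral)
  qed (use D_carrier in simp)
  then show ?thesis by (auto simp: cycles_def)
qed

section \<open>Zeroth homology as cosets of boundaries\<close>

context
  fixes S :: "'c set"
begin

abbreviation "H \<equiv> homology F 0 S"
abbreviation "B \<equiv> boundaries F 0 S"
abbreviation "cls \<equiv> hclass F 0 S"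

lemma hclass_eq_iff:
  assumes "x \<in> carrier_vec N" "y \<in> carrier_vec N"
  shows "cls x = cls y \<longleftrightarrow> x - y \<in> B"
proof
  assume "cls x = cls y"
  moreover have "x \<in> cls x"
    unfolding hclass_def using boundaries_zero assms(1)
    by (metis (mono_tags, lifting) mem_Collect_eq right_zero_vec)
  ultimately obtain b where b: "b \<in> B" "x = y + b"
    by (auto simp: hclass_def)
  then have "x - y = b"
    using assms boundaries_carrier[OF b(1)] by (intro eq_vecI) auto
  with b show "x - y \<in> B" by simp
next
  assume d: "x - y \<in> B"
  have "x + b \<in> cls y" if "b \<in> B" for b
  proof -
    have "x + b = y + ((x - y) + b)"
      using assms boundaries_carrier[OF that] by (intro eq_vecI) auto
    then show ?thesis
      unfolding hclass_def using boundaries_add[OF d that] by blast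
  qed
  moreover have "y + b \<in> cls x" if "b \<in> B" for b
  proof -
    have "y + b = x + (b - (x - y))"
      using assms boundaries_carrier[OF that] by (intro eq_vecI) auto
    then show ?thesis
      unfolding hclass_def using boundaries_diff[OF that d] by blast
  qed
  ultimately show "cls x = cls y"
    by (auto simp: hclass_def)
qed

lemma hclass_add:
  assumes "x \<in> carrier_vec N" "y \<in> carrier_vec N"
  shows "cls x \<oplus>\<^bsub>H\<^esub> cls y = cls (x + y)"
proof
  show "cls x \<oplus>\<^bsub>H\<^esub> cls y \<subseteq> cls (x + y)"
  proof
    fix w assume "w \<in> cls x \<oplus>\<^bsub>H\<^esub> cls y"
    then obtain a b where ab: "a \<in> B" "b \<in> B" "w = (x + a) + (y + b)"
      by (auto simp: homology_def hclass_def)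
    then have "w = (x + y) + (a + b)"
      using assms boundaries_carrier[OF ab(1)] boundaries_carrier[OF ab(2)] by (intro eq_vecI) auto
    then show "w \<in> cls (x + y)"
      unfolding hclass_def using boundaries_add[OF ab(1,2)] by blast
  qed
  show "cls (x + y) \<subseteq> cls x \<oplus>\<^bsub>H\<^esub> cls y"
  proof
    fix w assume "w \<in> cls (x + y)"
    then obtain a where a: "a \<in> B" "w = (x + y) + a"
      by (auto simp: hclass_def)
    then have "w = (x + a) + (y + 0\<^sub>v N)"
      using assms boundaries_carrier[OF a(1)] by (intro eq_vecI) auto
    moreover have "x + a \<in> cls x" "y + 0\<^sub>v N \<in> cls y"
      unfolding hclass_def using a boundaries_zero by blast+
    ultimately show "w \<in> cls x \<oplus>\<^bsub>H\<^esub> cls y"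
      unfolding homology_def by auto
  qed
qed

lemma hclass_smult:
  assumes "x \<in> carrier_vec N"
  shows "k \<odot>\<^bsub>H\<^esub> cls x = cls (k \<cdot>\<^sub>v x)"
proof
  show "k \<odot>\<^bsub>H\<^esub> cls x \<subseteq> cls (k \<cdot>\<^sub>v x)"
  proof
    fix w assume "w \<in> k \<odot>\<^bsub>H\<^esub> cls x"
    then obtain a b where ab: "a \<in> B" "b \<in> B" "w = k \<cdot>\<^sub>v (x + a) + b"
      by (auto simp: homology_def hclass_def)
    then have "w = k \<cdot>\<^sub>v x + (k \<cdot>\<^sub>v a + b)"
      using assms boundaries_carrier[OF ab(1)] boundaries_carrier[OF ab(2)]
      by (intro eq_vecI) (auto simp: distrib_left)
    then show "w \<in> cls (k \<cdot>\<^sub>v x)"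
      unfolding hclass_def using boundaries_add[OF boundaries_smult[OF ab(1)] ab(2)] by blast
  qed
  show "cls (k \<cdot>\<^sub>v x) \<subseteq> k \<odot>\<^bsub>H\<^esub> cls x"
  proof
    fix w assume "w \<in> cls (k \<cdot>\<^sub>v x)"
    then obtain b where b: "b \<in> B" "w = k \<cdot>\<^sub>v x + b"
      by (auto simp: hclass_def)
    then have "w = k \<cdot>\<^sub>v (x + 0\<^sub>v N) + b"
      using assms by simp
    moreover have "x + 0\<^sub>v N \<in> cls x"
      unfolding hclass_def using boundaries_zero by blast
    ultimately show "w \<in> k \<odot>\<^bsub>H\<^esub> cls x"
      unfolding homology_def using b(1) by auto
  qed
qed

lemma hclass_zero: "\<zero>\<^bsub>H\<^esub> = cls (0\<^sub>v N)"
proof -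
  have "0\<^sub>v N + b = b" if "b \<in> B" for b
    using boundaries_carrier[OF that] by simp
  then have "cls (0\<^sub>v N) = B"
    unfolding hclass_def by force
  then show ?thesis by (simp add: homology_def)
qed

lemma carrier_homology: "carrier H = cls ` chains F 0 S"
  by (simp add: homology_def chains_0_cycles)

text \<open>Supplies the laws under which the finite sum in \<open>transition_coeff\<close> can be
  evaluated term by term.\<close>

lemma abelian_monoid_homology: "abelian_monoid H"
proof (rule abelian_monoidI)
  note chains_carrier[where n = 0 and S = S, intro]
  show "\<zero>\<^bsub>H\<^esub> \<in> carrier H"
    by (auto simp: hclass_zero carrier_homology chains_zero)
  fix a b assume "a \<in> carrier H" "b \<in> carrier H"
  then obtain x y where x: "x \<in> chains F 0 S" "a = cls x" and y: "y \<in> chains F 0 S" "b = cls y"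
    by (auto simp: carrier_homology)
  note xc = chains_carrier[OF x(1)] and yc = chains_carrier[OF y(1)]
  show "a \<oplus>\<^bsub>H\<^esub> b \<in> carrier H"
    using chains_add[OF x(1) y(1)] by (auto simp: x y hclass_add xc yc carrier_homology)
  show "a \<oplus>\<^bsub>H\<^esub> b = b \<oplus>\<^bsub>H\<^esub> a"
    by (simp add: x y hclass_add xc yc comm_add_vec[OF xc yc])
  show "\<zero>\<^bsub>H\<^esub> \<oplus>\<^bsub>H\<^esub> a = a"
    using xc by (simp add: x hclass_zero hclass_add)
  fix c assume "c \<in> carrier H"
  then obtain z where z: "z \<in> chains F 0 S" "c = cls z"
    by (auto simp: carrier_homology)
  note zc = chains_carrier[OF z(1)]
  show "a \<oplus>\<^bsub>H\<^esub> b \<oplus>\<^bsub>H\<^esub> c = a \<oplus>\<^bsub>H\<^esub> (b \<oplus>\<^bsub>H\<^esub> c)"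
    using xc yc zc by (simp add: x y z hclass_add assoc_add_vec[OF xc yc zc])
qed

text \<open>Collects a linear combination of classes into the class of one chain, so that an
  equation in homology becomes membership of one difference in the boundaries.\<close>

lemma finsum_hclass:
  assumes "finite A" "\<And>v. v \<in> A \<Longrightarrow> v \<in> vertices \<and> rd_cell F v \<in> S"
  shows "(\<Oplus>\<^bsub>H\<^esub>v\<in>A. w v \<odot>\<^bsub>H\<^esub> cls (unit_vec N v)) = cls (vec N (\<lambda>v. if v \<in> A then w v else 0))"
  using assms
proof (induction A rule: finite_induct)
  case empty
  interpret abelian_monoid H by (rule abelian_monoid_homology)
  have "vec N (\<lambda>v. 0) = (0\<^sub>v N :: 'k vec)" by (intro eq_vecI) auto
  then show ?case by (simp add: hclass_zero)
next
  case (insert a A)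
  interpret abelian_monoid H by (rule abelian_monoid_homology)
  have smult: "w v \<odot>\<^bsub>H\<^esub> cls (unit_vec N v) = cls (w v \<cdot>\<^sub>v unit_vec N v)" for v
    by (rule hclass_smult) simp
  have "cls (w v \<cdot>\<^sub>v unit_vec N v) \<in> carrier H" if "v \<in> insert a A" for v
    unfolding carrier_homology using insert.prems[OF that]
    by (intro imageI chains_smult chains_unit) (auto simp: vertices_def)
  then have "(\<Oplus>\<^bsub>H\<^esub>v\<in>insert a A. w v \<odot>\<^bsub>H\<^esub> cls (unit_vec N v)) =
      cls (w a \<cdot>\<^sub>v unit_vec N a) \<oplus>\<^bsub>H\<^esub> (\<Oplus>\<^bsub>H\<^esub>v\<in>A. w v \<odot>\<^bsub>H\<^esub> cls (unit_vec N v))"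
    unfolding smult using insert.hyps by (intro finsum_insert) auto
  also have "\<dots> = cls (w a \<cdot>\<^sub>v unit_vec N a + vec N (\<lambda>v. if v \<in> A then w v else 0))"
    using insert.prems by (subst insert.IH) (simp_all add: hclass_add)
  also have "w a \<cdot>\<^sub>v unit_vec N a + vec N (\<lambda>v. if v \<in> A then w v else 0) =
      vec N (\<lambda>v. if v \<in> insert a A then w v else 0)"
    using insert.hyps(2) insert.prems[of a] by (intro eq_vecI) (auto simp: vertices_def)
  finally show ?case .
qed

end

lemma induced_map_hclass:
  assumes "S \<subseteq> T" "x \<in> carrier_vec N"
  shows "induced_map F 0 T (hclass F 0 S x) = hclass F 0 T x"
proof
  show "induced_map F 0 T (hclass F 0 S x) \<subseteq> hclass F 0 T x"
  proof
    fix y assume "y \<in> induced_map F 0 T (hclass F 0 S x)"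
    then obtain a b where ab: "a \<in> boundaries F 0 S" "b \<in> boundaries F 0 T" "y = (x + a) + b"
      by (auto simp: induced_map_def hclass_def)
    then have "y = x + (a + b)"
      using assms boundaries_carrier[OF ab(1)] boundaries_carrier[OF ab(2)] by (intro eq_vecI) auto
    moreover have "a + b \<in> boundaries F 0 T"
      using ab boundaries_mono[OF assms(1)] boundaries_add by blast
    ultimately show "y \<in> hclass F 0 T x"
      unfolding hclass_def by blast
  qed
  show "hclass F 0 T x \<subseteq> induced_map F 0 T (hclass F 0 S x)"
  proof
    fix y assume "y \<in> hclass F 0 T x"
    then obtain b where b: "b \<in> boundaries F 0 T" "y = (x + 0\<^sub>v N) + b"
      using assms(2) by (auto simp: hclass_def)
    moreover have "x + 0\<^sub>v N \<in> hclass F 0 S x"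
      unfolding hclass_def using boundaries_zero by blast
    ultimately show "y \<in> induced_map F 0 T (hclass F 0 S x)"
      unfolding induced_map_def by blast
  qed
qed

section \<open>Least vertices of classes and the transition coefficients\<close>

definition class_min :: "nat \<Rightarrow> nat \<Rightarrow> nat" where
  "class_min p u = (LEAST m. (u, m) \<in> linked p)"

lemma linked_class_min: "(u, class_min p u) \<in> linked p"
  unfolding class_min_def by (rule LeastI[of _ u]) (rule linked_refl)

lemma class_min_le: "(u, v) \<in> linked p \<Longrightarrow> class_min p u \<le> v"
  unfolding class_min_def by (rule Least_le)

lemma class_min_eq_iff: "class_min p u = class_min p v \<longleftrightarrow> (u, v) \<in> linked p"
proof
  assume "class_min p u = class_min p v"
  then show "(u, v) \<in> linked p"
    using linked_class_min linked_sym linked_trans by metis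
next
  assume "(u, v) \<in> linked p"
  then have "(u, m) \<in> linked p \<longleftrightarrow> (v, m) \<in> linked p" for m
    using linked_sym linked_trans by blast
  then show "class_min p u = class_min p v" by (simp add: class_min_def)
qed

lemma class_min_idem: "class_min p (class_min p u) = class_min p u"
  using class_min_eq_iff linked_class_min linked_sym by blast

lemma class_min_vertex: "u \<in> vertices \<Longrightarrow> class_min p u \<in> vertices"
  using linked_class_min linked_vertex by blast

lemma death_gt_iff_class_min:
  "i \<in> vertices \<Longrightarrow> ereal t < death F i \<longleftrightarrow> class_min (level t) i = i"
  unfolding death_gt_iff
  using class_min_le[OF linked_refl, of "level t" i] linked_class_min[of i "level t"] class_min_le
  by (metis le_antisym)

lemma pairing_vertices_eq:
  "pairing_vertices F = {i \<in> vertices. ereal (idx_filt F i) < death F i}"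
  using positive_vertex by (auto simp: pairing_vertices_def vertices_def birth_def)

lemma surviving_eq:
  "surviving F t = {v \<in> vertices. idx_filt F v < t \<and> class_min (level t) v = v}"
proof -
  have "ereal (idx_filt F v) < death F v" if "idx_filt F v < t" "ereal t < death F v" for v
    using that by (metis less_ereal.simps(1) less_trans)
  then show ?thesis
    by (auto simp: surviving_def pairing_vertices_eq birth_def death_gt_iff_class_min[symmetric])
qed

text \<open>The displayed coefficients work because \<open>u\<close> and the least vertex of its
  class differ by a boundary. They are the only ones because each class contains at most one
  surviving vertex.\<close>

lemma transition_coeff_eq:
  assumes zcp: "zero_column_preserving_0 F"
    and u: "u \<in> pairing_vertices F" and death: "death F u = ereal t"
  shows "transition_coeff F u = (\<lambda>v. if v = class_min (level t) u then 1 else 0)"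
proof -
  let ?p = "level t" and ?S = "cells_le F t" and ?A = "surviving F t"
  let ?m = "class_min ?p u"
  have uv: "u \<in> vertices" "idx_filt F u < t"
    using u death by (auto simp: pairing_vertices_eq)
  \<comment> \<open>Zero-column preservation enters here: every birth cycle becomes a single
    vertex.\<close>
  have cycle: "birth_cycle F v = unit_vec N v" if "v \<in> vertices" for v
    using zcp that positive_vertex[OF that]
    by (simp add: zero_column_preserving_0_def vertices_def birth_cycle_def)
  have A: "?A \<subseteq> vertices" by (auto simp: surviving_eq)
  have finA: "finite ?A" using A finite_vertices finite_subset by blast
  have cellA: "rd_cell F v \<in> ?S" if "v \<in> ?A" for v
    using that rd_cell_in by (auto simp: surviving_eq cells_le_def vertices_def idx_filt_def)
  \<comment> \<open>The least vertex precedes \<open>u\<close>, so it is born no later than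
    \<open>u\<close> and hence strictly before \<open>t\<close>.\<close>
  have m: "?m \<in> ?A"
  proof -
    have "?m \<le> u" by (rule class_min_le[OF linked_refl])
    then have "idx_filt F ?m < t"
      using filt_mono[of ?m u] uv class_min_vertex[OF uv(1), of ?p] by (simp add: vertices_def)
    then show ?thesis
      using class_min_vertex[OF uv(1)] by (simp add: surviving_eq class_min_idem)
  qed
  define good where "good w \<longleftrightarrow> (\<forall>v. v \<notin> ?A \<longrightarrow> w v = 0) \<and>
        induced_map F 0 ?S (hclass F 0 (cells_lt F t) (birth_cycle F u)) =
        (\<Oplus>\<^bsub>homology F 0 ?S\<^esub>v\<in>?A. w v \<odot>\<^bsub>homology F 0 ?S\<^esub> hclass F 0 ?S (birth_cycle F v))"
    for w
  define wvec where "wvec w = vec N (\<lambda>v. if v \<in> ?A then w v else 0 :: 'k)" for w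
  have good_iff: "good w \<longleftrightarrow> (\<forall>v. v \<notin> ?A \<longrightarrow> w v = 0) \<and>
      unit_vec N u - wvec w \<in> boundaries F 0 (cells ?p)" for w
  proof -
    have "cells_lt F t \<subseteq> ?S" by (auto simp: cells_lt_def cells_le_def)
    then have "induced_map F 0 ?S (hclass F 0 (cells_lt F t) (birth_cycle F u)) =
        hclass F 0 ?S (unit_vec N u)"
      unfolding cycle[OF uv(1)] by (rule induced_map_hclass) simp
    moreover have "(\<Oplus>\<^bsub>homology F 0 ?S\<^esub>v\<in>?A. w v \<odot>\<^bsub>homology F 0 ?S\<^esub> hclass F 0 ?S (birth_cycle F v)) =
        hclass F 0 ?S (wvec w)"
    proof -
      interpret abelian_monoid "homology F 0 ?S" by (rule abelian_monoid_homology)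
      have "w v \<odot>\<^bsub>homology F 0 ?S\<^esub> hclass F 0 ?S (unit_vec N v) \<in> carrier (homology F 0 ?S)"
        if "v \<in> ?A" for v
        unfolding hclass_smult[OF unit_vec_carrier] carrier_homology
        using that A cellA[OF that] by (intro imageI chains_smult chains_unit) (auto simp: vertices_def)
      then have "(\<Oplus>\<^bsub>homology F 0 ?S\<^esub>v\<in>?A. w v \<odot>\<^bsub>homology F 0 ?S\<^esub> hclass F 0 ?S (birth_cycle F v)) =
         (\<Oplus>\<^bsub>homology F 0 ?S\<^esub>v\<in>?A. w v \<odot>\<^bsub>homology F 0 ?S\<^esub> hclass F 0 ?S (unit_vec N v))"
        using A cycle by (intro finsum_cong') auto
      then show ?thesis
        unfolding wvec_def using finA A cellA by (subst finsum_hclass[symmetric]) auto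
    qed
    moreover have "hclass F 0 ?S (unit_vec N u) = hclass F 0 ?S (wvec w) \<longleftrightarrow>
        unit_vec N u - wvec w \<in> boundaries F 0 ?S"
      by (rule hclass_eq_iff) (simp_all add: wvec_def)
    ultimately show ?thesis
      unfolding good_def cells_le_eq[symmetric] by simp
  qed
  have "good (\<lambda>v. if v = ?m then 1 else 0)"
  proof -
    have "wvec (\<lambda>v. if v = ?m then 1 else 0) = unit_vec N ?m"
      using m A by (intro eq_vecI) (auto simp: wvec_def vertices_def)
    then show ?thesis
      unfolding good_iff using m linked_boundary[OF linked_class_min level_le] by auto
  qed
  moreover have "w = (\<lambda>v. if v = ?m then 1 else 0)" if "good w" for w
  proof
    fix v
    show "w v = (if v = ?m then 1 else 0)"
    proof (cases "v \<in> ?A")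
      case False
      then show ?thesis using that m by (auto simp: good_iff)
    next
      case True
      \<comment> \<open>The sum over the class of \<open>v\<close> kills the boundary, and
        \<open>v\<close> is the only surviving vertex in this class, so the sum isolates
        \<open>w v\<close>.\<close>
      let ?C = "{i. (v, i) \<in> linked ?p}"
      have vv: "v \<in> vertices" "class_min ?p v = v" using True by (auto simp: surviving_eq)
      have C: "?C \<subseteq> vertices" using linked_vertex vv by blast
      then have finC: "finite ?C" using finite_vertices finite_subset by blast
      have "0 = (\<Sum>i\<in>?C. (unit_vec N u - wvec w) $ i)"
        using that level_le vv by (subst boundary_class_sum) (auto simp: good_iff)
      also have "\<dots> = (\<Sum>i\<in>?C. (if i = u then 1 else 0) - (if i = v then w v else 0))"
      proof (intro sum.cong refl)
        fix i assume i: "i \<in> ?C"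
        then have iN: "i < N" "u < N" using C uv by (auto simp: vertices_def)
        have "i \<in> ?A \<longleftrightarrow> i = v"
          using i True class_min_eq_iff[of ?p v i] vv by (auto simp: surviving_eq)
        then show "(unit_vec N u - wvec w) $ i = (if i = u then 1 else 0) - (if i = v then w v else 0)"
          using iN by (simp add: wvec_def)
      qed
      also have "\<dots> = (if u \<in> ?C then 1 else 0) - w v"
        using finC linked_refl[of v ?p] by (simp add: sum_subtractf)
      finally have "w v = (if u \<in> ?C then 1 else 0)" by simp
      moreover have "u \<in> ?C \<longleftrightarrow> v = ?m"
        using class_min_eq_iff[of ?p v u] vv by auto
      ultimately show ?thesis by simp
    qed
  qed
  ultimately have "(THE w. good w) = (\<lambda>v. if v = ?m then 1 else 0)"
    by (rule the_equality)
  then show ?thesis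
    unfolding transition_coeff_def good_def death real_of_ereal.simps Let_def .
qed

end

section \<open>Component evolution and the elder rule\<close>

lemma component_containing_eq:
  assumes "D \<in> connected_components_of Y" "C \<subseteq> D" "C \<noteq> {}"
  shows "component_containing Y C = D"
  unfolding component_containing_def
proof (rule the_equality)
  show "D \<in> connected_components_of Y \<and> C \<subseteq> D" using assms by blast
  fix E assume E: "E \<in> connected_components_of Y \<and> C \<subseteq> E"
  then have "\<not> disjnt E D" using assms by (auto simp: disjnt_iff)
  then show "E = D"
    using E assms(1) pairwise_disjoint_connected_components_of[of Y] by (auto simp: pairwise_def)
qed

lemma component_containing:
  assumes "connectedin Y C" "C \<noteq> {}"
  shows "component_containing Y C \<in> connected_components_of Y" "C \<subseteq> component_containing Y C"
proof -
  have "Y \<noteq> trivial_topology"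
    using assms connectedin_subset_topspace by fastforce
  then obtain D where "D \<in> connected_components_of Y" "C \<subseteq> D"
    using exists_connected_component_of_superset assms(1) by blast
  then show "component_containing Y C \<in> connected_components_of Y" "C \<subseteq> component_containing Y C"
    using component_containing_eq assms(2) by auto
qed

lemma connectedin_sublevel_mono:
  assumes "s \<le> t" "connectedin (sublevel X g s) C"
  shows "connectedin (sublevel X g t) C"
proof -
  have "sublevel X g s = subtopology (sublevel X g t) {x \<in> topspace X. g x \<le> s}"
    using assms(1) unfolding sublevel_def subtopology_subtopology
    by (intro arg_cong[where f = "subtopology X"]) auto
  then show ?thesis using assms(2) by (simp add: connectedin_subtopology)
qed

text \<open>The evolution of components as seen by a finite set of vertices born at the values \<open>b\<close>:
  \<open>\<kappa> t i\<close> is the component, at level \<open>t\<close>, of the vertex \<open>i\<close>.\<close>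

locale component_evolution =
  fixes X :: "'x topology" and g :: "'x \<Rightarrow> real"
    and vs :: "nat set" and b :: "nat \<Rightarrow> real" and T :: "real set"
    and \<kappa> :: "real \<Rightarrow> nat \<Rightarrow> 'x set" and lv :: "'x branch \<Rightarrow> nat"
    and old :: "'x branch \<Rightarrow> 'x branch \<Rightarrow> bool"
  assumes finite_T: "finite T"
    and b_in_T: "\<And>i. i \<in> vs \<Longrightarrow> b i \<in> T"
    and b_mono: "\<And>i j. i \<in> vs \<Longrightarrow> j \<in> vs \<Longrightarrow> i \<le> j \<Longrightarrow> b i \<le> b j"
    and components: "\<And>t. connected_components_of (sublevel X g t) = \<kappa> t ` {i \<in> vs. b i \<le> t}"
    and \<kappa>_mono: "\<And>i s t. i \<in> vs \<Longrightarrow> b i \<le> s \<Longrightarrow> s \<le> t \<Longrightarrow> \<kappa> s i \<subseteq> \<kappa> t i"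
    and \<kappa>_stable: "\<And>i j s t. s < t \<Longrightarrow> {s<..t} \<inter> T = {} \<Longrightarrow> i \<in> vs \<Longrightarrow> j \<in> vs \<Longrightarrow>
      b i \<le> s \<Longrightarrow> b j \<le> s \<Longrightarrow> \<kappa> t i = \<kappa> t j \<Longrightarrow> \<kappa> s i = \<kappa> s j"
    and lv: "\<And>i. i \<in> vs \<Longrightarrow> (\<And>j. j \<in> vs \<Longrightarrow> b j \<le> b i \<Longrightarrow> \<kappa> (b i) j = \<kappa> (b i) i \<Longrightarrow> i \<le> j) \<Longrightarrow>
      lv (b i, \<kappa> (b i) i) = i"
    and old: "\<And>\<beta> \<gamma>. old \<beta> \<gamma> \<longleftrightarrow> fst \<beta> < fst \<gamma> \<or> (fst \<beta> = fst \<gamma> \<and> lv \<beta> < lv \<gamma>)"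
begin

abbreviation comps :: "real \<Rightarrow> 'x set set" where
  "comps t \<equiv> connected_components_of (sublevel X g t)"

lemma \<kappa>_in: "i \<in> vs \<Longrightarrow> b i \<le> t \<Longrightarrow> \<kappa> t i \<in> comps t"
  by (simp add: components)

lemma \<kappa>_nonempty: "i \<in> vs \<Longrightarrow> b i \<le> t \<Longrightarrow> \<kappa> t i \<noteq> {}"
  using \<kappa>_in nonempty_connected_components_of by blast

text \<open>Both conditions are read at the later level \<open>t\<close>, where distinct components
  are disjoint.\<close>

lemma \<kappa>_subset_iff:
  assumes "i \<in> vs" "b i \<le> s" "s \<le> t" "j \<in> vs" "b j \<le> t"
  shows "\<kappa> s i \<subseteq> \<kappa> t j \<longleftrightarrow> \<kappa> t i = \<kappa> t j"
proof
  assume sub: "\<kappa> s i \<subseteq> \<kappa> t j"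
  have ne: "\<kappa> s i \<noteq> {}" and it: "b i \<le> t"
    using assms \<kappa>_nonempty by auto
  have "component_containing (sublevel X g t) (\<kappa> s i) = \<kappa> t j"
    using component_containing_eq[OF \<kappa>_in[OF assms(4,5)] sub ne] .
  moreover have "component_containing (sublevel X g t) (\<kappa> s i) = \<kappa> t i"
    using component_containing_eq[OF \<kappa>_in[OF assms(1) it] \<kappa>_mono[OF assms(1-3)] ne] .
  ultimately show "\<kappa> t i = \<kappa> t j" by simp
next
  assume "\<kappa> t i = \<kappa> t j"
  then show "\<kappa> s i \<subseteq> \<kappa> t j" using \<kappa>_mono[OF assms(1-3)] by simp
qed

lemma component_containing_\<kappa>:
  assumes "i \<in> vs" "b i \<le> s" "s \<le> t"
  shows "component_containing (sublevel X g t) (\<kappa> s i) = \<kappa> t i"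
  using assms \<kappa>_in \<kappa>_mono \<kappa>_nonempty by (intro component_containing_eq) auto

lemma \<kappa>_persist:
  assumes "i \<in> vs" "b i \<le> s" "j \<in> vs" "b j \<le> s" "s \<le> t" "\<kappa> s i = \<kappa> s j"
  shows "\<kappa> t i = \<kappa> t j"
proof -
  have "\<kappa> s i \<subseteq> \<kappa> t j" using assms \<kappa>_mono[of j s t] by simp
  then show ?thesis using assms \<kappa>_subset_iff[of i s t j] by simp
qed

text \<open>Least index instead of earliest birth: births are monotone in the index, so a single
  comparison covers the elder rule together with its tie-breaking.\<close>

definition eldest :: "real \<Rightarrow> nat \<Rightarrow> nat" where
  "eldest t i = (LEAST j. j \<in> vs \<and> b j \<le> t \<and> \<kappa> t j = \<kappa> t i)"

lemma eldest:
  assumes "i \<in> vs" "b i \<le> t"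
  shows "eldest t i \<in> vs" "b (eldest t i) \<le> t" "\<kappa> t (eldest t i) = \<kappa> t i"
  using LeastI[of "\<lambda>j. j \<in> vs \<and> b j \<le> t \<and> \<kappa> t j = \<kappa> t i" i] assms by (auto simp: eldest_def)

lemma eldest_le: "j \<in> vs \<Longrightarrow> b j \<le> t \<Longrightarrow> \<kappa> t j = \<kappa> t i \<Longrightarrow> eldest t i \<le> j"
  unfolding eldest_def by (rule Least_le) simp

lemma eldest_cong: "\<kappa> t i = \<kappa> t j \<Longrightarrow> eldest t i = eldest t j"
  by (simp add: eldest_def)

text \<open>Vertices sharing a component with the eldest one at \<open>s\<close> still do so at
  \<open>t\<close>, so none of them can have a smaller index.\<close>

lemma eldest_eldest_earlier:
  assumes "i \<in> vs" "b i \<le> t" "b (eldest t i) \<le> s" "s \<le> t"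
  shows "eldest s (eldest t i) = eldest t i"
proof (rule antisym)
  let ?m = "eldest t i"
  note m = eldest[OF assms(1,2)]
  show "eldest s ?m \<le> ?m" using eldest_le[of ?m s ?m] m assms by simp
  note e = eldest[OF m(1) assms(3)]
  have "\<kappa> t (eldest s ?m) = \<kappa> t ?m"
    using \<kappa>_persist[OF e(1,2) m(1) assms(3,4) e(3)] .
  then show "?m \<le> eldest s ?m"
    using eldest_le[of "eldest s ?m" t i] e m assms by simp
qed

text \<open>The common vertex set of the two graphs: it coincides with
  \<open>pairing_vertices\<close>, and \<open>branch_of\<close> maps it onto the branches.\<close>

definition founders :: "nat set" where
  "founders = {i \<in> vs. eldest (b i) i = i}"

definition branch_of :: "nat \<Rightarrow> 'x branch" where
  "branch_of i = (b i, \<kappa> (b i) i)"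

lemma eldest_founder: "i \<in> vs \<Longrightarrow> b i \<le> t \<Longrightarrow> eldest t i \<in> founders"
  using eldest eldest_eldest_earlier by (simp add: founders_def)

lemma founder_le:
  "i \<in> founders \<Longrightarrow> j \<in> vs \<Longrightarrow> b j \<le> b i \<Longrightarrow> \<kappa> (b i) j = \<kappa> (b i) i \<Longrightarrow> i \<le> j"
  using eldest_le[of j "b i" i] by (simp add: founders_def)

lemma inj_branch_of: "inj_on branch_of founders"
proof (rule inj_onI)
  fix i j assume ij: "i \<in> founders" "j \<in> founders" "branch_of i = branch_of j"
  have bij: "b i = b j"
    using arg_cong[OF ij(3), of fst] by (simp only: branch_of_def fst_conv)
  have "\<kappa> (b i) i = \<kappa> (b j) j"
    using arg_cong[OF ij(3), of snd] by (simp only: branch_of_def snd_conv)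
  then have "eldest (b i) i = eldest (b j) j"
    unfolding bij by (rule eldest_cong)
  then show "i = j" using ij by (simp add: founders_def)
qed

text \<open>For founders \<open>lv\<close> recovers the index, which settles equal births; unequal
  births are settled by monotonicity of \<open>b\<close>.\<close>

lemma old_branch_of:
  assumes "i \<in> founders" "j \<in> founders"
  shows "old (branch_of i) (branch_of j) \<longleftrightarrow> i < j"
proof -
  have "lv (branch_of i) = i" "lv (branch_of j) = j"
    using assms lv founder_le by (auto simp: branch_of_def founders_def)
  moreover have "i < j \<Longrightarrow> b i \<le> b j" "b i < b j \<Longrightarrow> i < j"
    using assms b_mono[of i j] b_mono[of j i] by (auto simp: founders_def not_le[symmetric])
  ultimately show ?thesis
    by (auto simp: old branch_of_def)
qed

text \<open>A component contains no earlier component exactly if its eldest vertex is born at that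
  very level.\<close>

lemma branches_eq: "branches X g = branch_of ` founders"
proof (intro equalityI subsetI)
  fix \<beta> assume "\<beta> \<in> branches X g"
  then obtain t C where \<beta>: "\<beta> = (t, C)" "C \<in> comps t"
    and new: "\<And>s B. s < t \<Longrightarrow> B \<in> comps s \<Longrightarrow> \<not> B \<subseteq> C"
    by (auto simp: branches_def)
  then obtain i where i: "i \<in> vs" "b i \<le> t" "C = \<kappa> t i" by (auto simp: components)
  let ?m = "eldest t i"
  note m = eldest[OF i(1,2)]
  have "\<not> b ?m < t"
  proof
    assume lt: "b ?m < t"
    have "\<kappa> (b ?m) ?m \<subseteq> C" using \<kappa>_mono[OF m(1) order_refl m(2)] m(3) i(3) by simp
    then show False using new[OF lt \<kappa>_in[OF m(1) order_refl]] by simp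
  qed
  then have "b ?m = t" using m(2) by simp
  then have "\<beta> = branch_of ?m" using \<beta> i m by (simp add: branch_of_def)
  then show "\<beta> \<in> branch_of ` founders" using eldest_founder[OF i(1,2)] by simp
next
  fix \<beta> assume "\<beta> \<in> branch_of ` founders"
  then obtain i where i: "i \<in> founders" "\<beta> = (b i, \<kappa> (b i) i)" by (auto simp: branch_of_def)
  then have ivs: "i \<in> vs" by (simp add: founders_def)
  have False if s: "s < b i" and B: "B \<in> comps s" "B \<subseteq> \<kappa> (b i) i" for s B
  proof -
    obtain j where j: "j \<in> vs" "b j \<le> s" "B = \<kappa> s j" using B by (auto simp: components)
    then have "\<kappa> (b i) j = \<kappa> (b i) i"
      using \<kappa>_subset_iff[of j s "b i" i] s B ivs by simp
    then have "i \<le> j" using founder_le[OF i(1) j(1)] j(2) s by simp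
    then show False using b_mono[OF ivs j(1)] j(2) s by simp
  qed
  then show "\<beta> \<in> branches X g"
    using i \<kappa>_in[OF ivs order_refl] by (auto simp: branches_def)
qed

lemma branch_iff_eldest:
  assumes "i \<in> vs" "b i \<le> t"
  shows "(t, \<kappa> t i) \<in> branches X g \<longleftrightarrow> b (eldest t i) = t"
proof
  assume "(t, \<kappa> t i) \<in> branches X g"
  then obtain j where j: "j \<in> founders" "t = b j" "\<kappa> t i = \<kappa> t j"
    by (auto simp: branches_eq branch_of_def)
  then have "eldest t i = j" using eldest_cong[of t i j] by (simp add: founders_def)
  with j show "b (eldest t i) = t" by simp
next
  assume bt: "b (eldest t i) = t"
  then have "(t, \<kappa> t i) = branch_of (eldest t i)"
    using eldest(3)[OF assms] by (simp add: branch_of_def)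
  then show "(t, \<kappa> t i) \<in> branches X g"
    using eldest_founder[OF assms] by (simp add: branches_eq)
qed

text \<open>Were \<open>i\<close> born after \<open>s\<close>, the bijection at level
  \<open>b i\<close> would make its component the continuation of one that already holds an older
  vertex, and \<open>i\<close> would not be a founder. Hence the eldest vertex is visible at every
  \<open>s\<close> that the elder rule considers.\<close>

lemma unchanged_before_birth:
  assumes uc: "unchanged_before X g s t" and i: "i \<in> founders" "b i < t"
  shows "b i \<le> s"
proof (rule ccontr)
  assume "\<not> b i \<le> s"
  then have bij: "bij_betw (component_containing (sublevel X g (b i))) (comps s) (comps (b i))"
    using uc i(2) by (simp add: unchanged_before_def)
  have ivs: "i \<in> vs" using i by (simp add: founders_def)
  have "\<kappa> (b i) i \<in> component_containing (sublevel X g (b i)) ` comps s"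
    using bij \<kappa>_in[OF ivs order_refl] by (simp add: bij_betw_def)
  then obtain j where j: "j \<in> vs" "b j \<le> s"
    "\<kappa> (b i) i = component_containing (sublevel X g (b i)) (\<kappa> s j)"
    by (auto simp: components)
  then have "\<kappa> (b i) j = \<kappa> (b i) i"
    using component_containing_\<kappa>[of j s "b i"] \<open>\<not> b i \<le> s\<close> by simp
  then have "i \<le> j" using founder_le[OF i(1) j(1)] j(2) \<open>\<not> b i \<le> s\<close> by simp
  then show False using b_mono[OF ivs j(1)] j(2) \<open>\<not> b i \<le> s\<close> by simp
qed

text \<open>The witness for the choice in \<open>elder_label\<close>. It takes a set, as a labeling
  must; its value at a set that is not a component is arbitrary.\<close>

definition oldest_label :: "real \<Rightarrow> 'x set \<Rightarrow> 'x branch" where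
  "oldest_label t C = branch_of (LEAST j. j \<in> vs \<and> b j \<le> t \<and> \<kappa> t j = C)"

lemma oldest_label_\<kappa>: "oldest_label t (\<kappa> t i) = branch_of (eldest t i)"
  by (simp add: oldest_label_def eldest_def)

lemma eldest_merged_le:
  assumes "i \<in> vs" "b i \<le> t" "j \<in> vs" "b j \<le> s" "s \<le> t" "\<kappa> s j \<subseteq> \<kappa> t i"
  shows "eldest t i \<le> eldest s j"
proof -
  note e = eldest[OF assms(3,4)]
  have "\<kappa> s (eldest s j) \<subseteq> \<kappa> t i" using assms(6) e(3) by simp
  then have "\<kappa> t (eldest s j) = \<kappa> t i"
    using \<kappa>_subset_iff[OF e(1,2) assms(5,1,2)] by simp
  then show ?thesis using eldest_le[OF e(1)] e(2) assms(5) by simp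
qed

text \<open>Away from births, the eldest vertex of \<open>C\<close> is present at \<open>s\<close>
  and already eldest in its component there, which puts its branch into \<open>M\<close>. The other
  labels in \<open>M\<close> come from vertices that ended up in \<open>C\<close>, so none has a
  smaller index.\<close>

lemma elder_labeling_oldest_label: "elder_labeling X g old oldest_label"
  unfolding elder_labeling_def
proof (intro allI ballI)
  fix t C assume "C \<in> comps t"
  then obtain i where i: "i \<in> vs" "b i \<le> t" "C = \<kappa> t i" by (auto simp: components)
  let ?m = "eldest t i"
  note m = eldest[OF i(1,2)] and m_founder = eldest_founder[OF i(1,2)]
  have label: "oldest_label t C = branch_of ?m" by (simp add: i(3) oldest_label_\<kappa>)
  show "if (t, C) \<in> branches X g then oldest_label t C = (t, C)
    else \<forall>s. unchanged_before X g s t \<longrightarrow>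
      (let M = {oldest_label s B | B. B \<in> comps s \<and> B \<subseteq> C} in
       oldest_label t C \<in> M \<and> (\<forall>\<beta>\<in>M. \<beta> \<noteq> oldest_label t C \<longrightarrow> old (oldest_label t C) \<beta>))"
  proof (cases "(t, C) \<in> branches X g")
    case True
    then have "b ?m = t" using branch_iff_eldest[OF i(1,2)] i(3) by simp
    then show ?thesis using True m(3) i(3) label by (simp add: branch_of_def)
  next
    case False
    then have lt: "b ?m < t" using branch_iff_eldest[OF i(1,2)] i(3) m(2) by simp
    have "oldest_label t C \<in> {oldest_label s B | B. B \<in> comps s \<and> B \<subseteq> C} \<and>
      (\<forall>\<beta>\<in>{oldest_label s B | B. B \<in> comps s \<and> B \<subseteq> C}.
        \<beta> \<noteq> oldest_label t C \<longrightarrow> old (oldest_label t C) \<beta>)"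
      if uc: "unchanged_before X g s t" for s
    proof
      have s: "s \<le> t" using uc by (simp add: unchanged_before_def)
      have ms: "b ?m \<le> s" by (rule unchanged_before_birth[OF uc m_founder lt])
      have "oldest_label s (\<kappa> s ?m) = oldest_label t C"
        using eldest_eldest_earlier[OF i(1,2) ms s] by (simp add: oldest_label_\<kappa> label)
      moreover have "\<kappa> s ?m \<in> comps s" using \<kappa>_in[OF m(1) ms] .
      moreover have "\<kappa> s ?m \<subseteq> C" using \<kappa>_mono[OF m(1) ms s] m(3) i(3) by simp
      ultimately show "oldest_label t C \<in> {oldest_label s B | B. B \<in> comps s \<and> B \<subseteq> C}"
        by (metis (mono_tags, lifting) mem_Collect_eq)
      show "\<forall>\<beta>\<in>{oldest_label s B | B. B \<in> comps s \<and> B \<subseteq> C}.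
        \<beta> \<noteq> oldest_label t C \<longrightarrow> old (oldest_label t C) \<beta>"
      proof (intro ballI impI)
        fix \<beta> assume "\<beta> \<in> {oldest_label s B | B. B \<in> comps s \<and> B \<subseteq> C}" and ne: "\<beta> \<noteq> oldest_label t C"
        then obtain j where j: "j \<in> vs" "b j \<le> s" "\<kappa> s j \<subseteq> C" "\<beta> = branch_of (eldest s j)"
          by (auto simp: components oldest_label_\<kappa>)
        have "?m \<le> eldest s j"
          using eldest_merged_le[OF i(1,2) j(1,2) s] j(3) i(3) by simp
        moreover have "?m \<noteq> eldest s j" using ne label j(4) by auto
        ultimately show "old (oldest_label t C) \<beta>"
          using old_branch_of[OF m_founder eldest_founder[OF j(1,2)]] label j(4) by simp
      qed
    qed
    then show ?thesis using False by (simp only: if_False Let_def) blast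
  qed
qed

text \<open>Gives the elder rule an \<open>s\<close> to act on; without one, its universally
  quantified clause would be vacuous. Injectivity is \<open>\<kappa>_stable\<close> on the gap after
  the last value, surjectivity holds because nothing is born in the gap.\<close>

lemma unchanged_before_Max:
  assumes ne: "{\<tau> \<in> T. \<tau> < t} \<noteq> {}"
  shows "unchanged_before X g (Max {\<tau> \<in> T. \<tau> < t}) t"
proof -
  let ?s = "Max {\<tau> \<in> T. \<tau> < t}"
  have fin: "finite {\<tau> \<in> T. \<tau> < t}" using finite_T by simp
  have s: "?s \<in> T" "?s < t" using Max_in[OF fin ne] by auto
  have gap: "\<tau> \<le> ?s" if "\<tau> \<in> T" "\<tau> < t" for \<tau> using that fin by (intro Max_ge) auto
  have "bij_betw (component_containing (sublevel X g r)) (comps ?s) (comps r)" if r: "r \<in> {?s..<t}" for r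
    unfolding bij_betw_def
  proof
    show "inj_on (component_containing (sublevel X g r)) (comps ?s)"
    proof (rule inj_onI)
      fix B C assume "B \<in> comps ?s" "C \<in> comps ?s"
        and eq: "component_containing (sublevel X g r) B = component_containing (sublevel X g r) C"
      then obtain i j where ij: "i \<in> vs" "b i \<le> ?s" "B = \<kappa> ?s i" "j \<in> vs" "b j \<le> ?s" "C = \<kappa> ?s j"
        by (auto simp: components)
      have \<kappa>r: "\<kappa> r i = \<kappa> r j"
        using eq ij r component_containing_\<kappa>[of i ?s r] component_containing_\<kappa>[of j ?s r] by simp
      show "B = C"
      proof (cases "r = ?s")
        case True
        then show ?thesis using \<kappa>r ij by simp
      next
        case False
        then have "?s < r" "{?s<..r} \<inter> T = {}" using r gap by fastforce+
        then show ?thesis using \<kappa>_stable[of ?s r i j] \<kappa>r ij by simp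
      qed
    qed
    show "component_containing (sublevel X g r) ` comps ?s = comps r"
    proof (intro equalityI subsetI)
      fix C assume "C \<in> component_containing (sublevel X g r) ` comps ?s"
      then obtain i where "i \<in> vs" "b i \<le> ?s" "C = component_containing (sublevel X g r) (\<kappa> ?s i)"
        by (auto simp: components)
      then show "C \<in> comps r"
        using component_containing_\<kappa>[of i ?s r] \<kappa>_in[of i r] r by simp
    next
      fix C assume "C \<in> comps r"
      then obtain i where i: "i \<in> vs" "b i \<le> r" "C = \<kappa> r i" by (auto simp: components)
      then have bs: "b i \<le> ?s" using gap[OF b_in_T] r by simp
      then have "C = component_containing (sublevel X g r) (\<kappa> ?s i)"
        using component_containing_\<kappa>[of i ?s r] i r by simp
      then show "C \<in> component_containing (sublevel X g r) ` comps ?s"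
        using \<kappa>_in[OF i(1) bs] by simp
    qed
  qed
  then show ?thesis using s by (simp add: unchanged_before_def)
qed

text \<open>The level is a real number, so the induction runs on how many values of \<open>T\<close>
  lie below it; passing to the last such value lowers this count.\<close>

lemma elder_labeling_unique:
  assumes L: "elder_labeling X g old L" and "i \<in> vs" "b i \<le> t"
  shows "L t (\<kappa> t i) = branch_of (eldest t i)"
  using assms(2,3)
proof (induction "card {\<tau> \<in> T. \<tau> < t}" arbitrary: t i rule: less_induct)
  case less
  let ?m = "eldest t i" and ?C = "\<kappa> t i"
  note m = eldest[OF less.prems] and m_founder = eldest_founder[OF less.prems]
  have rule: "if (t, ?C) \<in> branches X g then L t ?C = (t, ?C)
    else \<forall>s. unchanged_before X g s t \<longrightarrow>
      (let M = {L s B | B. B \<in> comps s \<and> B \<subseteq> ?C} in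
       L t ?C \<in> M \<and> (\<forall>\<beta>\<in>M. \<beta> \<noteq> L t ?C \<longrightarrow> old (L t ?C) \<beta>))"
    using L \<kappa>_in[OF less.prems] unfolding elder_labeling_def by blast
  show ?case
  proof (cases "(t, ?C) \<in> branches X g")
    case True
    then have "b ?m = t" using branch_iff_eldest[OF less.prems] by simp
    then show ?thesis using rule True m(3) by (simp add: branch_of_def)
  next
    case False
    then have lt: "b ?m < t" using branch_iff_eldest[OF less.prems] m(2) by simp
    define s where "s = Max {\<tau> \<in> T. \<tau> < t}"
    have ne: "{\<tau> \<in> T. \<tau> < t} \<noteq> {}" using b_in_T[OF m(1)] lt by blast
    have fin: "finite {\<tau> \<in> T. \<tau> < t}" using finite_T by simp
    have s: "s \<in> T" "s < t" using Max_in[OF fin ne] by (auto simp: s_def)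
    have uc: "unchanged_before X g s t" unfolding s_def by (rule unchanged_before_Max[OF ne])
    have ms: "b ?m \<le> s" by (rule unchanged_before_birth[OF uc m_founder lt])
    have IH: "L s (\<kappa> s j) = branch_of (eldest s j)" if "j \<in> vs" "b j \<le> s" for j
    proof (rule less.hyps[OF _ that])
      show "card {\<tau> \<in> T. \<tau> < s} < card {\<tau> \<in> T. \<tau> < t}"
        using s fin by (intro psubset_card_mono) auto
    qed
    let ?M = "{L s B | B. B \<in> comps s \<and> B \<subseteq> ?C}"
    have "L t ?C \<in> ?M \<and> (\<forall>\<beta>\<in>?M. \<beta> \<noteq> L t ?C \<longrightarrow> old (L t ?C) \<beta>)"
      using rule uc unfolding if_not_P[OF False] Let_def by blast
    then have LM: "L t ?C \<in> ?M" and oldest: "\<And>\<beta>. \<beta> \<in> ?M \<Longrightarrow> \<beta> \<noteq> L t ?C \<Longrightarrow> old (L t ?C) \<beta>"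
      by blast+
    obtain j where j: "j \<in> vs" "b j \<le> s" "\<kappa> s j \<subseteq> ?C" "L t ?C = L s (\<kappa> s j)"
      using LM by (auto simp: components)
    then have Lj: "L t ?C = branch_of (eldest s j)" using IH by simp
    have le: "?m \<le> eldest s j"
      using eldest_merged_le[OF less.prems j(1,2) _ j(3)] s by simp
    have "L s (\<kappa> s ?m) = branch_of ?m"
      using IH[OF m(1) ms] eldest_eldest_earlier[OF less.prems ms] s by simp
    moreover have "\<kappa> s ?m \<in> comps s" "\<kappa> s ?m \<subseteq> ?C"
      using \<kappa>_in[OF m(1) ms] \<kappa>_mono[OF m(1) ms, of t] m(3) s by simp_all
    ultimately have "branch_of ?m \<in> ?M" by (metis (mono_tags, lifting) mem_Collect_eq)
    \<comment> \<open>Otherwise the chosen branch would be older than that of \<open>?m\<close>,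
      against \<open>?m \<le> eldest s j\<close>.\<close>
    then have "branch_of ?m = L t ?C \<or> old (branch_of (eldest s j)) (branch_of ?m)"
      using oldest[OF \<open>branch_of ?m \<in> ?M\<close>] unfolding Lj by blast
    then show ?thesis
      using le old_branch_of[OF eldest_founder[OF j(1,2)] m_founder] by auto
  qed
qed

lemma elder_labeling_choice:
  assumes "i \<in> vs" "b i \<le> t"
  shows "(SOME L. elder_labeling X g old L) t (\<kappa> t i) = branch_of (eldest t i)"
  using elder_labeling_unique[OF someI[of "elder_labeling X g old", OF elder_labeling_oldest_label] assms] .

end

section \<open>Parent-pointer forests\<close>

locale parent_forest =
  fixes G :: "(nat, nat \<times> nat) pre_digraph" and Roots :: "nat set" and parent :: "nat \<Rightarrow> nat"
  assumes arcs_eq: "arcs G = {(u, parent u) | u. u \<in> verts G \<and> u \<notin> Roots}"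
    and tail_eq: "tail G = fst" and head_eq: "head G = snd"
    and parent: "\<And>u. u \<in> verts G \<Longrightarrow> u \<notin> Roots \<Longrightarrow> parent u \<in> verts G \<and> parent u < u"
    and Roots: "Roots \<subseteq> verts G"
begin

sublocale wf_digraph G
  using parent by unfold_locales (auto simp: arcs_eq tail_eq head_eq)

lemma ex_root_walk: "u \<in> verts G \<Longrightarrow> \<exists>r\<in>Roots. \<exists>p. awalk u p r"
proof (induction u rule: less_induct)
  case (less u)
  show ?case
  proof (cases "u \<in> Roots")
    case True
    then show ?thesis using less.prems by (auto simp: awalk_Nil_iff intro!: bexI[of _ u] exI[of _ "[]"])
  next
    case False
    then obtain r p where "r \<in> Roots" "awalk (parent u) p r"
      using less parent by blast
    moreover from this have "awalk u ((u, parent u) # p) r"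
      using less.prems False by (simp add: awalk_Cons_iff arcs_eq tail_eq head_eq)
    ultimately show ?thesis by blast
  qed
qed

lemma walk_from_root: "r \<in> Roots \<Longrightarrow> awalk r p v \<Longrightarrow> p = [] \<and> v = r"
  by (cases p) (auto simp: awalk_Nil_iff awalk_Cons_iff arcs_eq tail_eq)

text \<open>A non-root has exactly one outgoing arc and a root has none, so a walk to a root is
  forced at every step and stops at its first root.\<close>

lemma root_walk_unique:
  assumes "awalk u p r" "awalk u q r'" "r \<in> Roots" "r' \<in> Roots"
  shows "p = q \<and> r = r'"
  using assms
proof (induction p arbitrary: u q)
  case Nil
  then have "u = r" by (simp add: awalk_Nil_iff)
  then show ?case using walk_from_root[OF Nil.prems(3), of q r'] Nil.prems(2) by simp
next
  case (Cons e p)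
  then have e: "e = (u, parent u)" "u \<notin> Roots" "awalk (parent u) p r"
    by (auto simp: awalk_Cons_iff arcs_eq tail_eq head_eq)
  then have "q \<noteq> []" using Cons.prems by (auto simp: awalk_Nil_iff)
  then obtain f q' where q: "q = f # q'" by (cases q) auto
  then have f: "f = (u, parent u)" "awalk (parent u) q' r'"
    using Cons.prems(2) by (auto simp: awalk_Cons_iff arcs_eq tail_eq head_eq)
  show ?case using Cons.IH[OF e(3) f(2) Cons.prems(3,4)] e f q by simp
qed

definition root_of :: "nat \<Rightarrow> nat" where
  "root_of u = (THE r. r \<in> Roots \<and> (\<exists>p. awalk u p r))"

lemma root_of_eq:
  assumes "awalk u p r" "r \<in> Roots" shows "root_of u = r"
  unfolding root_of_def
proof (rule the_equality)
  show "r \<in> Roots \<and> (\<exists>p. awalk u p r)" using assms by blast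
  fix r' assume "r' \<in> Roots \<and> (\<exists>p. awalk u p r')"
  then show "r' = r" using root_walk_unique[OF assms(1)] assms(2) by blast
qed

lemma root_of_root: "r \<in> Roots \<Longrightarrow> root_of r = r"
  using Roots by (intro root_of_eq[of _ "[]"]) (auto simp: awalk_Nil_iff)

lemma root_of_in: "u \<in> verts G \<Longrightarrow> root_of u \<in> Roots"
  using ex_root_walk root_of_eq by metis

lemma root_of_parent:
  assumes "u \<in> verts G" "u \<notin> Roots" shows "root_of (parent u) = root_of u"
proof -
  obtain r p where r: "r \<in> Roots" "awalk (parent u) p r"
    using ex_root_walk parent[OF assms] by blast
  then have "awalk u ((u, parent u) # p) r"
    using assms by (simp add: awalk_Cons_iff arcs_eq tail_eq head_eq)
  then show ?thesis using r root_of_eq by metis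
qed

text \<open>Arcs are selected by their tails alone; by \<open>root_of_parent\<close> their heads
  have the same root.\<close>

definition root_component :: "nat \<Rightarrow> (nat, nat \<times> nat) pre_digraph" where
  "root_component r = \<lparr> verts = {v \<in> verts G. root_of v = r},
     arcs = {e \<in> arcs G. root_of (fst e) = r}, tail = fst, head = snd \<rparr>"

lemma wf_root_component: "wf_digraph (root_component r)"
  using parent root_of_parent
  by unfold_locales (auto simp: root_component_def arcs_eq)

lemma root_component_subgraph: "subgraph (root_component r) G"
  using wf_root_component
  by (intro subgraphI wf_digraph_axioms) (auto simp: root_component_def compatible_def tail_eq head_eq)

lemma root_component_walk:
  assumes "r \<in> Roots" "v \<in> verts (root_component r)"
  shows "\<exists>p. pre_digraph.awalk (root_component r) v p r"
  using assms(2)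
proof (induction v rule: less_induct)
  case (less v)
  interpret T: wf_digraph "root_component r" by (rule wf_root_component)
  have v: "v \<in> verts G" "root_of v = r" using less.prems by (auto simp: root_component_def)
  show ?case
  proof (cases "v \<in> Roots")
    case True
    then have "v = r" using v root_of_root by simp
    then show ?thesis using less.prems by (auto simp: T.awalk_Nil_iff intro!: exI[of _ "[]"])
  next
    case False
    then have "parent v \<in> verts (root_component r)" "parent v < v"
      using parent root_of_parent v by (auto simp: root_component_def)
    then obtain p where "T.awalk (parent v) p r" using less.IH by blast
    then have "T.awalk v ((v, parent v) # p) r"
      using v False by (simp add: T.awalk_Cons_iff) (simp add: root_component_def arcs_eq)
    then show ?thesis by blast
  qed
qed

lemma root_in_component: "r \<in> Roots \<Longrightarrow> r \<in> verts (root_component r)"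
  using Roots root_of_root by (auto simp: root_component_def)

lemma rooted_root_component:
  assumes "r \<in> Roots" shows "rooted_in_tree (root_component r) r"
  unfolding rooted_in_tree_def
proof (intro conjI ballI)
  fix v assume v: "v \<in> verts (root_component r)"
  then obtain p where p: "pre_digraph.awalk (root_component r) v p r"
    using root_component_walk assms by blast
  show "\<exists>!p. pre_digraph.awalk (root_component r) v p r"
  proof (rule ex1I[where a = p])
    show "pre_digraph.awalk (root_component r) v p r" by (rule p)
    fix q assume "pre_digraph.awalk (root_component r) v q r"
    then show "q = p"
      using p subgraph_awalk_imp_awalk[OF _ root_component_subgraph] root_walk_unique assms by metis
  qed
qed (use wf_root_component root_in_component assms in auto)

lemma connected_root_component:
  assumes "r \<in> Roots" shows "Digraph_Component.connected (root_component r)"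
proof -
  interpret T: wf_digraph "root_component r" by (rule wf_root_component)
  interpret S: pair_wf_digraph "mk_symmetric (root_component r)" by (rule T.wellformed_mk_symmetric)
  have up: "u \<rightarrow>\<^sup>*\<^bsub>mk_symmetric (root_component r)\<^esub> r" if "u \<in> verts (root_component r)" for u
    using root_component_walk[OF assms that] by (metis T.reachable_awalk T.reachable_mk_symmetricI)
  have down: "r \<rightarrow>\<^sup>*\<^bsub>mk_symmetric (root_component r)\<^esub> u" if "u \<in> verts (root_component r)" for u
    using up[OF that] by (rule symmetric_reachable[OF symmetric_mk_symmetric])
  show ?thesis
    unfolding Digraph_Component.connected_def strongly_connected_def
    using up down root_in_component[OF assms] by (auto intro: S.reachable_trans)
qed

text \<open>\<open>root_of\<close> agrees at the two ends of every arc, hence along every undirected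
  walk.\<close>

lemma connected_root_of:
  assumes "subgraph H G" "Digraph_Component.connected H" "u \<in> verts H" "v \<in> verts H"
  shows "root_of u = root_of v"
proof -
  interpret H: wf_digraph H using assms(1) by auto
  interpret S: pair_wf_digraph "mk_symmetric H" by (rule H.wellformed_mk_symmetric)
  have "u \<rightarrow>\<^sup>*\<^bsub>mk_symmetric H\<^esub> v"
    using assms unfolding Digraph_Component.connected_def strongly_connected_def by simp
  then show ?thesis
  proof (induction rule: S.reachable_induct)
    case (step x y)
    then have "(x, y) \<in> parcs (mk_symmetric H)" by simp
    then obtain e where e: "e \<in> arcs H" "(x, y) = (tail H e, head H e) \<or> (x, y) = (head H e, tail H e)"
      by (auto simp: parcs_mk_symmetric)
    have "e \<in> arcs G" "tail H e = fst e" "head H e = snd e"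
      using assms(1) e(1) by (auto simp: subgraph_def compatible_def tail_eq head_eq)
    then have "root_of (head H e) = root_of (tail H e)"
      using root_of_parent by (auto simp: arcs_eq)
    then show ?case using step.IH e(2) by auto
  qed simp
qed

lemma subgraph_root_component:
  assumes "subgraph H G" "Digraph_Component.connected H" "v \<in> verts H"
  shows "subgraph H (root_component (root_of v))"
proof (rule subgraphI)
  show "wf_digraph H" using assms(1) by auto
  then interpret H: wf_digraph H .
  have comp: "tail H = fst" "head H = snd"
    using assms(1) by (auto simp: subgraph_def compatible_def tail_eq head_eq)
  show "verts H \<subseteq> verts (root_component (root_of v))"
    using connected_root_of[OF assms(1,2) _ assms(3)] assms(1)
    by (auto simp: root_component_def subgraph_def)
  show "arcs H \<subseteq> arcs (root_component (root_of v))"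
  proof
    fix e assume e: "e \<in> arcs H"
    then have "fst e \<in> verts H" using H.tail_in_verts[OF e] by (simp add: comp)
    then show "e \<in> arcs (root_component (root_of v))"
      using connected_root_of[OF assms(1,2) _ assms(3)] assms(1) e
      by (auto simp: root_component_def subgraph_def)
  qed
  show "compatible (root_component (root_of v)) H"
    by (simp add: compatible_def root_component_def comp)
qed (rule wf_root_component)

text \<open>A connected subgraph lies inside the root component of any of its vertices, and root
  components are themselves connected, so they are the maximal connected subgraphs.\<close>

lemma weak_component_iff: "weak_component G T \<longleftrightarrow> (\<exists>r\<in>Roots. T = root_component r)"
proof
  assume T: "weak_component G T"
  then have sub: "subgraph T G" and con: "Digraph_Component.connected T"
    and max: "\<And>H. H \<noteq> T \<Longrightarrow> subgraph T H \<Longrightarrow> subgraph H G \<Longrightarrow> \<not> Digraph_Component.connected H"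
    by (auto simp: weak_component_def max_subgraph_def)
  from con obtain v where v: "v \<in> verts T"
    by (auto simp: Digraph_Component.connected_def strongly_connected_def)
  then have "v \<in> verts G" using sub by auto
  then have r: "root_of v \<in> Roots" by (rule root_of_in)
  then have "T = root_component (root_of v)"
    using max[OF _ subgraph_root_component[OF sub con v] root_component_subgraph]
      connected_root_component by metis
  with r show "\<exists>r\<in>Roots. T = root_component r" by blast
next
  assume "\<exists>r\<in>Roots. T = root_component r"
  then obtain r where r: "r \<in> Roots" and T: "T = root_component r" by blast
  have "H = T" if H: "subgraph T H" "subgraph H G" "Digraph_Component.connected H" for H
  proof -
    have "r \<in> verts H" using H(1) root_in_component[OF r] T by auto
    then have "subgraph H T"
      using subgraph_root_component[OF H(2,3), of r] root_of_root[OF r] T by simp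
    with H(1) show ?thesis
      by (auto simp: subgraph_def compatible_def intro!: pre_digraph.equality)
  qed
  then show "weak_component G T"
    unfolding weak_component_def max_subgraph_def
    using root_component_subgraph connected_root_component[OF r] T by blast
qed

text \<open>The walk from \<open>r\<close> to \<open>r'\<close> in \<open>T\<close> is also a walk
  in \<open>G\<close>, where no arc leaves \<open>r\<close>.\<close>

lemma rooted_in_tree_root:
  assumes "subgraph T G" "r \<in> Roots" "r \<in> verts T" "rooted_in_tree T r'"
  shows "r' = r"
proof -
  obtain p where "pre_digraph.awalk T r p r'"
    using assms(3,4) unfolding rooted_in_tree_def by blast
  then have "awalk r p r'" using assms(1) by (rule subgraph_awalk_imp_awalk)
  then show ?thesis using walk_from_root assms(2) by blast
qed

lemma rooted_in_forest: "rooted_in_forest G"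
  unfolding rooted_in_forest_def
proof (intro conjI allI impI)
  fix T assume "weak_component G T"
  then obtain r where r: "r \<in> Roots" "T = root_component r" by (auto simp: weak_component_iff)
  show "\<exists>!r. rooted_in_tree T r"
  proof (rule ex1I)
    show "rooted_in_tree T r" using r rooted_root_component by simp
    fix r' assume "rooted_in_tree T r'"
    then show "r' = r"
      using rooted_in_tree_root[of T r r'] r root_in_component root_component_subgraph by simp
  qed
qed (rule wf_digraph_axioms)

lemma forest_roots: "forest_roots G = Roots"
proof
  show "forest_roots G \<subseteq> Roots"
  proof
    fix r' assume "r' \<in> forest_roots G"
    then obtain T r where "r \<in> Roots" "T = root_component r" "rooted_in_tree T r'"
      by (auto simp: forest_roots_def weak_component_iff)
    then show "r' \<in> Roots"
      using rooted_in_tree_root[of T r r'] root_in_component root_component_subgraph by simp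
  qed
  show "Roots \<subseteq> forest_roots G"
    using rooted_root_component by (auto simp: forest_roots_def weak_component_iff)
qed

lemma rooted_in_tree_unique_root:
  assumes "Roots = {r}" shows "\<exists>!r. rooted_in_tree G r"
proof (rule ex1I)
  have "root_of v = r" if "v \<in> verts G" for v
    using root_of_in[OF that] assms by simp
  then have "root_component r = G"
    by (auto simp: root_component_def arcs_eq tail_eq head_eq intro!: pre_digraph.equality)
  then show "rooted_in_tree G r" using rooted_root_component[of r] assms by simp
  fix r' assume "rooted_in_tree G r'"
  then show "r' = r"
    using rooted_in_tree_root[OF subgraph_refl, of r r'] assms Roots by auto
qed

end

section \<open>Comparing the two graphs\<close>

locale evolution_agreement = filtered_complex F
  for F :: "('a, 'c, 'k :: field) reduction_data" +
  fixes X :: "'x topology" and g :: "'x \<Rightarrow> real" and \<theta> :: "real \<Rightarrow> 'a set \<Rightarrow> 'x set"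
  assumes agrees: "component_evolution_agrees F X g \<theta>"
begin

abbreviation "T \<equiv> filtration_values F"

lemma T_eq: "T = idx_filt F ` {..<N}"
  by (simp add: filtration_values_def idx_filt_def [abs_def] image_image
      flip: bij_betw_imp_surj_on[OF bij_rd_cell])

lemma finite_T: "finite T"
  by (simp add: T_eq)

lemma vertex_filt_in_T: "i \<in> vertices \<Longrightarrow> idx_filt F i \<in> T"
  by (auto simp: T_eq vertices_def)

lemma \<theta>_bij: "t \<in> T \<Longrightarrow> bij_betw (\<theta> t) (connected_components_of (subcomplex_le F t))
    (connected_components_of (sublevel X g t))"
  and \<theta>_natural: "s \<in> T \<Longrightarrow> t \<in> T \<Longrightarrow> s \<le> t \<Longrightarrow> C \<in> connected_components_of (subcomplex_le F s) \<Longrightarrow>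
    \<theta> t (component_containing (subcomplex_le F t) C) = component_containing (sublevel X g t) (\<theta> s C)"
  and changes: "changes_only_at X g T"
  and empty_before: "\<forall>r\<in>T. t < r \<Longrightarrow> topspace (sublevel X g t) = {}"
  using agrees unfolding component_evolution_agrees_def by blast+

lemma subcomplex_le_eq: "subcomplex_le F t = cell_subspace K (cells (level t))"
  by (simp add: subcomplex_le_def cells_le_eq)

lemma vertex_less_level: "i \<in> vertices \<Longrightarrow> i < level t \<longleftrightarrow> idx_filt F i \<le> t"
  using less_level_iff by (simp add: vertices_def)

lemma vertex_point_in_iff:
  assumes "i \<in> vertices"
  shows "vertex_point i \<in> topspace (subcomplex_le F t) \<longleftrightarrow> idx_filt F i \<le> t"
proof -
  have pt: "vertex_point i \<in> idx_cell F i" using idx_cell_vertex[OF assms] by simp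
  have iN: "i < N" using assms by (simp add: vertices_def)
  have "vertex_point i \<in> topspace (subcomplex_le F t) \<longleftrightarrow> (\<exists>j<level t. vertex_point i \<in> idx_cell F j)"
    unfolding subcomplex_le_eq topspace_cell_subspace[OF subcomplex[OF level_le]]
    by (auto simp: idx_cell_def)
  also have "\<dots> \<longleftrightarrow> i < level t"
    using pt idx_cell_unique[OF iN _ pt] level_le by (metis less_le_trans)
  finally show ?thesis using vertex_less_level[OF assms] by simp
qed

section \<open>Components of the cellular filtration\<close>

definition vertex_component :: "real \<Rightarrow> nat \<Rightarrow> 'a set" where
  "vertex_component t i = connected_component_of_set (subcomplex_le F t) (vertex_point i)"

lemma vertex_component_in:
  "i \<in> vertices \<Longrightarrow> idx_filt F i \<le> t \<Longrightarrow>
    vertex_component t i \<in> connected_components_of (subcomplex_le F t)"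
  unfolding vertex_component_def connected_component_in_connected_components_of
  by (simp add: vertex_point_in_iff)

lemma vertex_point_in_component_iff:
  assumes "i \<in> vertices" "idx_filt F i \<le> t" "j \<in> vertices"
  shows "vertex_point j \<in> vertex_component t i \<longleftrightarrow> (i, j) \<in> linked (level t)"
proof
  assume L: "vertex_point j \<in> vertex_component t i"
  then have "vertex_point j \<in> topspace (subcomplex_le F t)"
    unfolding vertex_component_def using connected_component_in_topspace by fastforce
  then have "j < level t" using assms(3) vertex_point_in_iff vertex_less_level by simp
  moreover have "i < level t" using assms vertex_less_level by simp
  ultimately show "(i, j) \<in> linked (level t)"
    using L connected_component_iff_linked[OF level_le assms(1) _ assms(3)]
    by (simp add: vertex_component_def subcomplex_le_eq)
next
  assume L: "(i, j) \<in> linked (level t)"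
  have i: "i < level t" using assms vertex_less_level by simp
  then have "j < level t" using L linked_less by blast
  then show "vertex_point j \<in> vertex_component t i"
    using L i connected_component_iff_linked[OF level_le assms(1) _ assms(3)]
    by (simp add: vertex_component_def subcomplex_le_eq)
qed

lemma vertex_component_eq_iff:
  assumes "i \<in> vertices" "idx_filt F i \<le> t" "j \<in> vertices" "idx_filt F j \<le> t"
  shows "vertex_component t i = vertex_component t j \<longleftrightarrow> (i, j) \<in> linked (level t)"
proof -
  have "vertex_component t i = vertex_component t j \<longleftrightarrow> vertex_point j \<in> vertex_component t i"
  proof
    have "vertex_point j \<in> vertex_component t j"
      using assms(3,4) by (simp add: vertex_component_def connected_component_of_refl vertex_point_in_iff)
    then show "vertex_point j \<in> vertex_component t i" if "vertex_component t i = vertex_component t j"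
      using that by simp
    show "vertex_component t i = vertex_component t j" if "vertex_point j \<in> vertex_component t i"
      using that unfolding vertex_component_def mem_Collect_eq
      by (simp only: connected_component_of_equiv)
  qed
  then show ?thesis using vertex_point_in_component_iff[OF assms(1-3)] by simp
qed

lemma components_subcomplex_le:
  "connected_components_of (subcomplex_le F t) = vertex_component t ` {i \<in> vertices. idx_filt F i \<le> t}"
proof (intro equalityI subsetI)
  note sub = subcomplex[OF level_le, of t]
  fix C assume "C \<in> connected_components_of (subcomplex_le F t)"
  then obtain x where x: "x \<in> topspace (subcomplex_le F t)"
    "C = connected_component_of_set (subcomplex_le F t) x"
    by (auto simp: connected_components_of_def)
  then obtain c where c: "c \<in> cells (level t)" "x \<in> open_cell K c"
    unfolding subcomplex_le_eq topspace_cell_subspace[OF sub] by blast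
  obtain v y where v: "v \<in> cells (level t)" "cw_dim K v = 0" "y \<in> open_cell K v"
    "connected_component_of (subcomplex_le F t) x y"
    using connected_component_vertex[OF sub c] unfolding subcomplex_le_eq by blast
  then obtain i where i: "i < level t" "v = rd_cell F i" by blast
  then have iv: "i \<in> vertices"
    using v(2) level_le[of t] by (simp add: vertices_def idx_dim_def)
  then have "y = vertex_point i"
    using v(3) idx_cell_vertex[OF iv] i(2) by (simp add: idx_cell_def)
  then have "C = vertex_component t i"
    using v(4) x(2) unfolding vertex_component_def by (simp only: connected_component_of_equiv)
  then show "C \<in> vertex_component t ` {i \<in> vertices. idx_filt F i \<le> t}"
    using iv i(1) vertex_less_level[OF iv] by simp
next
  fix C assume "C \<in> vertex_component t ` {i \<in> vertices. idx_filt F i \<le> t}"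
  then show "C \<in> connected_components_of (subcomplex_le F t)"
    using vertex_component_in by auto
qed

lemma component_containing_vertex_component:
  assumes "i \<in> vertices" "idx_filt F i \<le> s" "s \<le> t"
  shows "component_containing (subcomplex_le F t) (vertex_component s i) = vertex_component t i"
proof (rule component_containing_eq)
  show "vertex_component t i \<in> connected_components_of (subcomplex_le F t)"
    using assms by (intro vertex_component_in) auto
  have "cells_le F s \<subseteq> cells_le F t" using assms(3) by (auto simp: cells_le_def)
  then have "(\<Union>c\<in>cells_le F s. open_cell K c) \<subseteq> (\<Union>c\<in>cells_le F t. open_cell K c)" by blast
  then show "vertex_component s i \<subseteq> vertex_component t i"
    unfolding vertex_component_def subcomplex_le_def cell_subspace_def
    using connected_component_of_mono by (metis (no_types, lifting) Collect_mono)
  show "vertex_component s i \<noteq> {}"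
    using vertex_component_in[OF assms(1,2)] by (rule nonempty_connected_components_of)
qed

text \<open>\<open>\<theta>\<close> is applied only at the birth value, which is a filtration value,
  and inclusions in \<open>X\<close> do the rest. The definition thus makes sense at every real
  \<open>t\<close> from the birth on.\<close>

definition \<kappa> :: "real \<Rightarrow> nat \<Rightarrow> 'x set" where
  "\<kappa> t i = component_containing (sublevel X g t) (\<theta> (idx_filt F i) (vertex_component (idx_filt F i) i))"

lemma born_component:
  assumes "i \<in> vertices"
  shows "\<theta> (idx_filt F i) (vertex_component (idx_filt F i) i)
    \<in> connected_components_of (sublevel X g (idx_filt F i))"
  using \<theta>_bij[OF vertex_filt_in_T[OF assms]] vertex_component_in[OF assms order_refl]
  by (auto simp: bij_betw_def)

lemma \<kappa>_component:
  assumes "i \<in> vertices" "idx_filt F i \<le> t"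
  shows "\<kappa> t i \<in> connected_components_of (sublevel X g t)"
    and "\<theta> (idx_filt F i) (vertex_component (idx_filt F i) i) \<subseteq> \<kappa> t i"
proof -
  let ?Z = "\<theta> (idx_filt F i) (vertex_component (idx_filt F i) i)"
  have "connectedin (sublevel X g t) ?Z"
    using born_component[OF assms(1)] connectedin_connected_components_of
      connectedin_sublevel_mono[OF assms(2)] by blast
  moreover have "?Z \<noteq> {}"
    using born_component[OF assms(1)] by (rule nonempty_connected_components_of)
  ultimately show "\<kappa> t i \<in> connected_components_of (sublevel X g t)" "?Z \<subseteq> \<kappa> t i"
    unfolding \<kappa>_def by (rule component_containing)+
qed

lemma \<kappa>_subset:
  assumes "i \<in> vertices" "idx_filt F i \<le> s" "s \<le> t"
  shows "\<kappa> s i \<subseteq> \<kappa> t i"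
proof (rule connected_components_of_maximal)
  let ?Z = "\<theta> (idx_filt F i) (vertex_component (idx_filt F i) i)"
  have t: "idx_filt F i \<le> t" using assms by simp
  show "\<kappa> t i \<in> connected_components_of (sublevel X g t)" by (rule \<kappa>_component(1)[OF assms(1) t])
  show "connectedin (sublevel X g t) (\<kappa> s i)"
    using \<kappa>_component(1)[OF assms(1,2)] connectedin_connected_components_of
      connectedin_sublevel_mono[OF assms(3)] by blast
  have "?Z \<noteq> {}"
    using born_component[OF assms(1)] by (rule nonempty_connected_components_of)
  then show "\<not> disjnt (\<kappa> t i) (\<kappa> s i)"
    using \<kappa>_component(2)[OF assms(1,2)] \<kappa>_component(2)[OF assms(1) t] by (auto simp: disjnt_def)
qed

lemma component_containing_\<kappa>:
  assumes "i \<in> vertices" "idx_filt F i \<le> s" "s \<le> t"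
  shows "component_containing (sublevel X g t) (\<kappa> s i) = \<kappa> t i"
proof (rule component_containing_eq)
  show "\<kappa> t i \<in> connected_components_of (sublevel X g t)"
    using assms by (intro \<kappa>_component) auto
  show "\<kappa> s i \<noteq> {}"
    using \<kappa>_component(1)[OF assms(1,2)] by (rule nonempty_connected_components_of)
qed (rule \<kappa>_subset[OF assms])

text \<open>Naturality of \<open>\<theta>\<close> from the birth value of \<open>i\<close> to
  \<open>t\<close>.\<close>

lemma \<kappa>_at_filtration_value:
  assumes "t \<in> T" "i \<in> vertices" "idx_filt F i \<le> t"
  shows "\<kappa> t i = \<theta> t (vertex_component t i)"
  using \<theta>_natural[OF vertex_filt_in_T[OF assms(2)] assms(1,3) vertex_component_in[OF assms(2) order_refl]]
    component_containing_vertex_component[OF assms(2) order_refl assms(3)]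
  by (simp add: \<kappa>_def)

lemma \<kappa>_stable:
  assumes "s < t" "{s<..t} \<inter> T = {}" "i \<in> vertices" "j \<in> vertices"
    "idx_filt F i \<le> s" "idx_filt F j \<le> s" "\<kappa> t i = \<kappa> t j"
  shows "\<kappa> s i = \<kappa> s j"
proof -
  have "inj_on (component_containing (sublevel X g t)) (connected_components_of (sublevel X g s))"
    using changes assms(1,2) unfolding changes_only_at_def bij_betw_def by blast
  moreover have "component_containing (sublevel X g t) (\<kappa> s i) = component_containing (sublevel X g t) (\<kappa> s j)"
    using assms component_containing_\<kappa>[of i s t] component_containing_\<kappa>[of j s t] by simp
  ultimately show ?thesis
    using \<kappa>_component(1) assms by (meson inj_onD)
qed

lemma last_filtration_value:
  assumes "r \<in> T" "r \<le> t"
  obtains \<tau> where "\<tau> \<in> T" "\<tau> \<le> t" "\<And>r. r \<in> T \<Longrightarrow> r \<le> t \<Longrightarrow> r \<le> \<tau>"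
proof -
  let ?S = "{r \<in> T. r \<le> t}"
  have "finite ?S" "?S \<noteq> {}" using finite_T assms by auto
  then show thesis
    using Max_in[of ?S] Max_ge[of ?S] by (intro that[of "Max ?S"]) auto
qed

text \<open>At the last filtration value up to \<open>t\<close> the bijection
  \<open>\<theta>\<close> transfers the cellular components, and nothing changes from there to
  \<open>t\<close>. Below all filtration values both sides are empty.\<close>

lemma components_sublevel:
  "connected_components_of (sublevel X g t) = \<kappa> t ` {i \<in> vertices. idx_filt F i \<le> t}"
proof (cases "\<exists>r\<in>T. r \<le> t")
  case True
  then obtain \<tau> where \<tau>: "\<tau> \<in> T" "\<tau> \<le> t" "\<And>r. r \<in> T \<Longrightarrow> r \<le> t \<Longrightarrow> r \<le> \<tau>"
    using last_filtration_value by blast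
  have "connected_components_of (sublevel X g \<tau>) = \<theta> \<tau> ` vertex_component \<tau> ` {i \<in> vertices. idx_filt F i \<le> \<tau>}"
    using \<theta>_bij[OF \<tau>(1)] by (simp add: bij_betw_def components_subcomplex_le)
  also have "\<dots> = \<kappa> \<tau> ` {i \<in> vertices. idx_filt F i \<le> \<tau>}"
    unfolding image_image using \<kappa>_at_filtration_value[OF \<tau>(1)] by (intro image_cong refl) auto
  finally have at_\<tau>: "connected_components_of (sublevel X g \<tau>) = \<kappa> \<tau> ` {i \<in> vertices. idx_filt F i \<le> \<tau>}" .
  show ?thesis
  proof (cases "\<tau> = t")
    case True
    then show ?thesis using at_\<tau> by simp
  next
    case False
    then have "\<tau> < t" "{\<tau><..t} \<inter> T = {}" using \<tau> by fastforce+
    then have "connected_components_of (sublevel X g t) =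
        component_containing (sublevel X g t) ` \<kappa> \<tau> ` {i \<in> vertices. idx_filt F i \<le> \<tau>}"
      using changes unfolding changes_only_at_def bij_betw_def at_\<tau>[symmetric] by simp
    also have "\<dots> = \<kappa> t ` {i \<in> vertices. idx_filt F i \<le> \<tau>}"
      unfolding image_image using component_containing_\<kappa>[OF _ _ \<tau>(2)] by (intro image_cong refl) auto
    also have "{i \<in> vertices. idx_filt F i \<le> \<tau>} = {i \<in> vertices. idx_filt F i \<le> t}"
      using \<tau> vertex_filt_in_T by fastforce
    finally show ?thesis .
  qed
next
  case False
  then have "topspace (sublevel X g t) = {}" by (intro empty_before) auto
  then have "connected_components_of (sublevel X g t) = {}"
    by (simp add: connected_components_of_def)
  moreover have "{i \<in> vertices. idx_filt F i \<le> t} = {}"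
    using False vertex_filt_in_T by blast
  ultimately show ?thesis by simp
qed

text \<open>Equality is read at the last filtration value up to \<open>t\<close>: there
  \<open>\<theta>\<close> is injective, the prefix of cells is the same as at \<open>t\<close>, and
  no components merge in between.\<close>

lemma \<kappa>_eq_iff:
  assumes "i \<in> vertices" "idx_filt F i \<le> t" "j \<in> vertices" "idx_filt F j \<le> t"
  shows "\<kappa> t i = \<kappa> t j \<longleftrightarrow> (i, j) \<in> linked (level t)"
proof -
  obtain \<tau> where \<tau>: "\<tau> \<in> T" "\<tau> \<le> t" "\<And>r. r \<in> T \<Longrightarrow> r \<le> t \<Longrightarrow> r \<le> \<tau>"
    using last_filtration_value[OF vertex_filt_in_T[OF assms(1)] assms(2)] by blast
  have le: "idx_filt F i \<le> \<tau>" "idx_filt F j \<le> \<tau>" using \<tau>(3) vertex_filt_in_T assms by blast+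
  have "(n < N \<and> idx_filt F n \<le> \<tau>) = (n < N \<and> idx_filt F n \<le> t)" for n
    using \<tau>(2) \<tau>(3)[of "idx_filt F n"] by (auto simp: T_eq)
  then have level: "level \<tau> = level t" by (simp add: level_def)
  have "\<kappa> \<tau> i = \<kappa> \<tau> j \<longleftrightarrow> vertex_component \<tau> i = vertex_component \<tau> j"
    unfolding \<kappa>_at_filtration_value[OF \<tau>(1) assms(1) le(1)] \<kappa>_at_filtration_value[OF \<tau>(1) assms(3) le(2)]
    using inj_on_eq_iff[OF bij_betw_imp_inj_on[OF \<theta>_bij[OF \<tau>(1)]]]
      vertex_component_in[OF assms(1) le(1)] vertex_component_in[OF assms(3) le(2)] by blast
  also have "\<dots> \<longleftrightarrow> (i, j) \<in> linked (level t)"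
    using vertex_component_eq_iff[OF assms(1) le(1) assms(3) le(2)] level by simp
  also have "\<kappa> \<tau> i = \<kappa> \<tau> j \<longleftrightarrow> \<kappa> t i = \<kappa> t j"
  proof
    assume "\<kappa> \<tau> i = \<kappa> \<tau> j"
    then show "\<kappa> t i = \<kappa> t j"
      using component_containing_\<kappa>[OF assms(1) le(1) \<tau>(2)] component_containing_\<kappa>[OF assms(3) le(2) \<tau>(2)]
      by simp
  next
    assume eq: "\<kappa> t i = \<kappa> t j"
    show "\<kappa> \<tau> i = \<kappa> \<tau> j"
    proof (cases "\<tau> = t")
      case False
      then have "\<tau> < t" "{\<tau><..t} \<inter> T = {}" using \<tau> by fastforce+
      then show ?thesis using \<kappa>_stable assms(1,3) le eq by blast
    qed (use eq in simp)
  qed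
  finally show ?thesis .
qed

text \<open>Undoing \<open>\<theta>\<close> at the birth value returns the cellular component of
  \<open>i\<close>, whose vertices are those linked to \<open>i\<close>.\<close>

lemma least_vertex_\<kappa>:
  assumes i: "i \<in> vertices"
    and min: "\<And>j. j \<in> vertices \<Longrightarrow> idx_filt F j \<le> idx_filt F i \<Longrightarrow>
      \<kappa> (idx_filt F i) j = \<kappa> (idx_filt F i) i \<Longrightarrow> i \<le> j"
  shows "least_vertex F \<theta> (idx_filt F i, \<kappa> (idx_filt F i) i) = i"
proof -
  let ?t = "idx_filt F i"
  have inv: "the_inv_into (connected_components_of (subcomplex_le F ?t)) (\<theta> ?t) (\<kappa> ?t i) = vertex_component ?t i"
    unfolding \<kappa>_at_filtration_value[OF vertex_filt_in_T[OF i] i order_refl]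
    using \<theta>_bij[OF vertex_filt_in_T[OF i]] vertex_component_in[OF i order_refl]
    by (intro the_inv_into_f_f) (auto simp: bij_betw_def)
  have "j < N \<and> idx_dim F j = 0 \<and> idx_cell F j \<subseteq> vertex_component ?t i \<longleftrightarrow>
      j \<in> vertices \<and> (i, j) \<in> linked (level ?t)" for j
    using vertex_point_in_component_iff[OF i order_refl, of j] idx_cell_vertex[of j]
    by (auto simp: vertices_def)
  then have "least_vertex F \<theta> (?t, \<kappa> ?t i) = (LEAST j. j \<in> vertices \<and> (i, j) \<in> linked (level ?t))"
    by (simp add: least_vertex_def inv)
  also have "\<dots> = i"
  proof (rule Least_equality)
    fix j assume j: "j \<in> vertices \<and> (i, j) \<in> linked (level ?t)"
    then have "j < level ?t" using linked_less[of i j] vertex_less_level[OF i, of ?t] by simp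
    then have "idx_filt F j \<le> ?t" using j vertex_less_level by simp
    then show "i \<le> j" using min[of j] j \<kappa>_eq_iff[OF i order_refl, of j] by simp
  qed (simp add: i linked_refl)
  finally show ?thesis .
qed

sublocale evo: component_evolution X g vertices "idx_filt F" T \<kappa> "least_vertex F \<theta>" "older F \<theta>"
proof
  show "finite T" by (rule finite_T)
  show "connected_components_of (sublevel X g t) = \<kappa> t ` {i \<in> vertices. idx_filt F i \<le> t}" for t
    by (rule components_sublevel)
  show "older F \<theta> \<beta> \<gamma> \<longleftrightarrow> fst \<beta> < fst \<gamma> \<or> (fst \<beta> = fst \<gamma> \<and> least_vertex F \<theta> \<beta> < least_vertex F \<theta> \<gamma>)"
    for \<beta> \<gamma> by (rule older_def)
  show "idx_filt F i \<le> idx_filt F j" if "i \<in> vertices" "j \<in> vertices" "i \<le> j" for i j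
    using that filt_mono by (simp add: vertices_def)
qed (fact vertex_filt_in_T \<kappa>_subset \<kappa>_stable least_vertex_\<kappa>)+

text \<open>The bridge between the two graphs: one side comes from the sublevel sets of
  \<open>g\<close>, the other governs deaths and transition coefficients.\<close>

lemma eldest_eq_class_min:
  assumes i: "i \<in> vertices" "idx_filt F i \<le> t"
  shows "evo.eldest t i = class_min (level t) i"
proof -
  have "j \<in> vertices \<and> idx_filt F j \<le> t \<and> \<kappa> t j = \<kappa> t i \<longleftrightarrow> (i, j) \<in> linked (level t)" for j
  proof
    assume "j \<in> vertices \<and> idx_filt F j \<le> t \<and> \<kappa> t j = \<kappa> t i"
    then show "(i, j) \<in> linked (level t)" using \<kappa>_eq_iff[OF i, of j] by simp
  next
    assume L: "(i, j) \<in> linked (level t)"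
    have "j \<in> vertices" using linked_vertex[OF L i(1)] .
    moreover have "j < level t" using linked_less[OF L] i vertex_less_level by simp
    ultimately show "j \<in> vertices \<and> idx_filt F j \<le> t \<and> \<kappa> t j = \<kappa> t i"
      using L \<kappa>_eq_iff[OF i, of j] vertex_less_level by simp
  qed
  then show ?thesis by (simp add: evo.eldest_def class_min_def)
qed

lemma death_gt_iff_eldest:
  "i \<in> vertices \<Longrightarrow> idx_filt F i \<le> t \<Longrightarrow> ereal t < death F i \<longleftrightarrow> evo.eldest t i = i"
  by (simp add: death_gt_iff_class_min eldest_eq_class_min)

lemma pairing_vertices_founders: "pairing_vertices F = evo.founders"
  by (auto simp: pairing_vertices_eq evo.founders_def death_gt_iff_eldest)

lemma founder_vertex: "i \<in> evo.founders \<Longrightarrow> i \<in> vertices"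
  by (simp add: evo.founders_def)

lemma founder_death: "i \<in> evo.founders \<Longrightarrow> ereal (idx_filt F i) < death F i"
  using pairing_vertices_eq pairing_vertices_founders by auto

lemma death_cases:
  obtains "death F i = \<infinity>" | d where "death F i = ereal d"
  by (cases "pair F i") (auto simp: death_def)

lemma current_label_branch_of:
  assumes "i \<in> vertices" "idx_filt F i \<le> t"
  shows "current_label F \<theta> X g t (evo.branch_of i) = evo.branch_of (evo.eldest t i)"
proof -
  have "component_containing (sublevel X g t) (snd (evo.branch_of i)) = \<kappa> t i"
    using component_containing_\<kappa>[OF assms(1) order_refl assms(2)] by (simp add: evo.branch_of_def)
  then show ?thesis
    unfolding current_label_def elder_label_def
    using evo.elder_labeling_choice[OF assms] by simp
qed

text \<open>The label stays \<open>branch_of i\<close> exactly as long as the level is below the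
  death of \<open>i\<close>, so the death is the first level at which it differs.\<close>

lemma terminates_at_branch_of:
  assumes i: "i \<in> evo.founders"
  shows "terminates_at F \<theta> X g (evo.branch_of i) t \<longleftrightarrow> death F i = ereal t"
proof -
  have iv: "i \<in> vertices" by (rule founder_vertex[OF i])
  have label: "current_label F \<theta> X g s (evo.branch_of i) = evo.branch_of i \<longleftrightarrow> ereal s < death F i"
    if s: "idx_filt F i \<le> s" for s
  proof -
    have "evo.branch_of (evo.eldest s i) = evo.branch_of i \<longleftrightarrow> evo.eldest s i = i"
      using inj_on_eq_iff[OF evo.inj_branch_of evo.eldest_founder[OF iv s] i] .
    then show ?thesis
      using current_label_branch_of[OF iv s] death_gt_iff_eldest[OF iv s] by simp
  qed
  have "terminates_at F \<theta> X g (evo.branch_of i) t \<longleftrightarrow> idx_filt F i \<le> t \<and> \<not> ereal t < death F i \<and>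
      (\<forall>s. idx_filt F i \<le> s \<and> s < t \<longrightarrow> ereal s < death F i)"
    unfolding terminates_at_def using label by (auto simp: evo.branch_of_def)
  also have "\<dots> \<longleftrightarrow> death F i = ereal t"
  proof (cases rule: death_cases[of i])
    case 1
    then show ?thesis by simp
  next
    case (2 d)
    then have "idx_filt F i < d" using founder_death[OF i] by simp
    \<comment> \<open>The instance \<open>s = d\<close> excludes a termination later than the
      death.\<close>
    then show ?thesis using 2 by (auto simp: not_less intro: le_less_trans dest: spec[of _ d])
  qed
  finally show ?thesis .
qed

text \<open>Every branch here has positive length: a vertex absorbed at its own birth value is no
  founder and names no branch.\<close>

lemma nonzero_branches_eq: "nonzero_branches F \<theta> X g = evo.branch_of ` evo.founders"
proof -
  have "idx_filt F i < t" if "i \<in> evo.founders" "death F i = ereal t" for i t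
    using founder_death[OF that(1)] that(2) by simp
  then show ?thesis
    unfolding nonzero_branches_def evo.branches_eq
    using terminates_at_branch_of by (auto simp: evo.branch_of_def)
qed

text \<open>At a final vertex the value is a default, \<open>real_of_ereal\<close> sending infinity
  to 0; arcs to parents are drawn from the other founders only.\<close>

definition parent :: "nat \<Rightarrow> nat" where
  "parent u = evo.eldest (real_of_ereal (death F u)) u"

definition final_vertices :: "nat set" where
  "final_vertices = {u \<in> evo.founders. death F u = \<infinity>}"

lemma parent_founder:
  assumes "u \<in> evo.founders" "u \<notin> final_vertices"
  shows "parent u \<in> evo.founders" "parent u < u"
    "ereal (idx_filt F (parent u)) < death F u" "death F u < death F (parent u)"
proof -
  obtain t where t: "death F u = ereal t"
    using assms by (cases rule: death_cases[of u]) (auto simp: final_vertices_def)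
  have u: "u \<in> vertices" by (rule founder_vertex[OF assms(1)])
  have ut: "idx_filt F u < t" using founder_death[OF assms(1)] t by simp
  then have ule: "idx_filt F u \<le> t" by simp
  have parent: "parent u = evo.eldest t u" by (simp add: parent_def t)
  show "parent u \<in> evo.founders" unfolding parent by (rule evo.eldest_founder[OF u ule])
  have "evo.eldest t u \<noteq> u" using death_gt_iff_eldest[OF u ule] t by simp
  moreover have "evo.eldest t u \<le> u" by (rule evo.eldest_le[OF u ule refl])
  ultimately show less: "parent u < u" unfolding parent by simp
  note e = evo.eldest[OF u ule]
  have "idx_filt F (parent u) \<le> idx_filt F u"
    using evo.b_mono[OF e(1) u] less parent by simp
  then show "ereal (idx_filt F (parent u)) < death F u" using ut t by simp
  \<comment> \<open>The parent is eldest in its component at the very level where \<open>u\<close>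
    dies, hence outlives \<open>u\<close>.\<close>
  have "evo.eldest t (evo.eldest t u) = evo.eldest t u"
    using evo.eldest_cong[OF e(3)] .
  then show "death F u < death F (parent u)"
    unfolding t parent using death_gt_iff_eldest[OF e(1,2)] by simp
qed

end

locale zero_preserving_agreement = evolution_agreement F X g \<theta>
  for F :: "('a, 'c, 'k :: field) reduction_data" and X :: "'x topology" and g \<theta> +
  assumes zero_preserving: "zero_column_preserving_0 F"
begin

lemma transition_coeff_parent:
  assumes "u \<in> evo.founders" "u \<notin> final_vertices"
  shows "transition_coeff F u = (\<lambda>v. if v = parent u then 1 else 0)"
proof -
  obtain t where t: "death F u = ereal t"
    using assms by (cases rule: death_cases[of u]) (auto simp: final_vertices_def)
  have "idx_filt F u < t" using founder_death[OF assms(1)] t by simp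
  then have "parent u = class_min (level t) u"
    using eldest_eq_class_min[OF founder_vertex[OF assms(1)]] by (simp add: parent_def t)
  then show ?thesis
    using transition_coeff_eq[OF zero_preserving _ t] assms(1) pairing_vertices_founders by simp
qed

lemma pairing_graph_arcs:
  "arcs (pairing_graph F) = {(u, parent u) | u. u \<in> evo.founders \<and> u \<notin> final_vertices}"
proof (intro equalityI subsetI)
  fix e assume "e \<in> arcs (pairing_graph F)"
  then obtain u v where e: "e = (u, v)" "u \<in> evo.founders" "death F u < \<infinity>" "transition_coeff F u v \<noteq> 0"
    by (auto simp: pairing_graph_def pairing_vertices_founders)
  then have nf: "u \<notin> final_vertices" by (auto simp: final_vertices_def)
  then have "v = parent u" using e transition_coeff_parent[OF e(2)] by (auto split: if_splits)
  then show "e \<in> {(u, parent u) | u. u \<in> evo.founders \<and> u \<notin> final_vertices}"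
    using e nf by blast
next
  fix e assume "e \<in> {(u, parent u) | u. u \<in> evo.founders \<and> u \<notin> final_vertices}"
  then obtain u where u: "e = (u, parent u)" "u \<in> evo.founders" "u \<notin> final_vertices" by blast
  then have "death F u < \<infinity>"
    by (cases rule: death_cases[of u]) (auto simp: final_vertices_def)
  then show "e \<in> arcs (pairing_graph F)"
    using u parent_founder[OF u(2,3)] transition_coeff_parent[OF u(2,3)]
    by (simp add: pairing_graph_def pairing_vertices_founders birth_def)
qed

sublocale forest: parent_forest "pairing_graph F" final_vertices parent
proof
  have verts: "verts (pairing_graph F) = evo.founders"
    by (simp add: pairing_graph_def pairing_vertices_founders)
  show "arcs (pairing_graph F) = {(u, parent u) | u. u \<in> verts (pairing_graph F) \<and> u \<notin> final_vertices}"
    unfolding verts by (rule pairing_graph_arcs)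
  show "parent u \<in> verts (pairing_graph F) \<and> parent u < u"
    if "u \<in> verts (pairing_graph F)" "u \<notin> final_vertices" for u
    using that parent_founder unfolding verts by blast
  show "final_vertices \<subseteq> verts (pairing_graph F)"
    unfolding verts by (auto simp: final_vertices_def)
qed (simp_all add: pairing_graph_def)

section \<open>The isomorphism of the two graphs\<close>

definition branch_iso ::
    "(nat, nat \<times> nat, 'x branch, 'x branch \<times> 'x branch) digraph_isomorphism" where
  "branch_iso = \<lparr> iso_verts = evo.branch_of, iso_arcs = map_prod evo.branch_of evo.branch_of,
    iso_head = snd, iso_tail = fst \<rparr>"

lemma digraph_isomorphism_branch_iso: "pre_digraph.digraph_isomorphism (pairing_graph F) branch_iso"
proof -
  have verts: "verts (pairing_graph F) = evo.founders"
    by (simp add: pairing_graph_def pairing_vertices_founders)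
  have "arcs (pairing_graph F) \<subseteq> evo.founders \<times> evo.founders"
    using parent_founder unfolding pairing_graph_arcs by auto
  moreover have "inj_on (map_prod evo.branch_of evo.branch_of) (evo.founders \<times> evo.founders)"
    using evo.inj_branch_of by (intro map_prod_inj_on)
  ultimately have "inj_on (map_prod evo.branch_of evo.branch_of) (arcs (pairing_graph F))"
    by (rule inj_on_subset[rotated])
  then show ?thesis
    unfolding pre_digraph.digraph_isomorphism_def
    using forest.wf_digraph_axioms evo.inj_branch_of
    by (simp add: branch_iso_def verts forest.tail_eq forest.head_eq)
qed

lemma branch_graph_eq: "branch_graph F \<theta> X g = app_iso branch_iso (pairing_graph F)"
proof -
  have "arcs (branch_graph F \<theta> X g) =
      {(evo.branch_of u, evo.branch_of (parent u)) | u. u \<in> evo.founders \<and> u \<notin> final_vertices}"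
  proof (intro equalityI subsetI)
    fix e assume "e \<in> arcs (branch_graph F \<theta> X g)"
    then obtain u t where u: "u \<in> evo.founders" "terminates_at F \<theta> X g (evo.branch_of u) t"
      "e = (evo.branch_of u, current_label F \<theta> X g t (evo.branch_of u))"
      by (auto simp: branch_graph_def nonzero_branches_eq)
    then have t: "death F u = ereal t" using terminates_at_branch_of by simp
    then have "idx_filt F u < t" using founder_death[OF u(1)] by simp
    then have "current_label F \<theta> X g t (evo.branch_of u) = evo.branch_of (parent u)"
      using current_label_branch_of[OF founder_vertex[OF u(1)], of t] t by (simp add: parent_def)
    moreover have "u \<notin> final_vertices" using t by (simp add: final_vertices_def)
    ultimately show "e \<in> {(evo.branch_of u, evo.branch_of (parent u)) | u. u \<in> evo.founders \<and> u \<notin> final_vertices}"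
      using u by auto
  next
    fix e assume "e \<in> {(evo.branch_of u, evo.branch_of (parent u)) | u. u \<in> evo.founders \<and> u \<notin> final_vertices}"
    then obtain u where u: "e = (evo.branch_of u, evo.branch_of (parent u))" "u \<in> evo.founders" "u \<notin> final_vertices"
      by blast
    then obtain t where t: "death F u = ereal t"
      by (cases rule: death_cases[of u]) (auto simp: final_vertices_def)
    then have "idx_filt F u < t" using founder_death[OF u(2)] by simp
    then have "current_label F \<theta> X g t (evo.branch_of u) = evo.branch_of (parent u)"
      using current_label_branch_of[OF founder_vertex[OF u(2)], of t] t by (simp add: parent_def)
    moreover have "terminates_at F \<theta> X g (evo.branch_of u) t"
      using terminates_at_branch_of[OF u(2)] t by simp
    ultimately have "\<exists>t. terminates_at F \<theta> X g (evo.branch_of u) t \<and>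
        evo.branch_of (parent u) = current_label F \<theta> X g t (evo.branch_of u)" by metis
    then show "e \<in> arcs (branch_graph F \<theta> X g)"
      using u parent_founder(1)[OF u(2,3)] by (simp add: branch_graph_def nonzero_branches_eq)
  qed
  moreover have "arcs (app_iso branch_iso (pairing_graph F)) =
      {(evo.branch_of u, evo.branch_of (parent u)) | u. u \<in> evo.founders \<and> u \<notin> final_vertices}"
    unfolding arcs_app_iso pairing_graph_arcs by (force simp: branch_iso_def)
  ultimately have "arcs (branch_graph F \<theta> X g) = arcs (app_iso branch_iso (pairing_graph F))"
    by simp
  moreover have "verts (branch_graph F \<theta> X g) = verts (app_iso branch_iso (pairing_graph F))"
    by (simp add: branch_graph_def branch_iso_def nonzero_branches_eq pairing_graph_def
        pairing_vertices_founders)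
  moreover have "tail (branch_graph F \<theta> X g) = tail (app_iso branch_iso (pairing_graph F))"
    "head (branch_graph F \<theta> X g) = head (app_iso branch_iso (pairing_graph F))"
    by (simp_all add: branch_graph_def branch_iso_def)
  ultimately show ?thesis by (intro pre_digraph.equality) simp_all
qed

text \<open>Past the last filtration value nothing merges, so the eldest vertex of each component at
  \<open>t\<close> remains eldest at all later levels and never dies.\<close>

lemma final_vertices_bij:
  assumes t: "\<forall>r\<in>T. r \<le> t"
  shows "bij_betw (\<kappa> t) final_vertices (connected_components_of (sublevel X g t))"
proof -
  have filt: "idx_filt F i \<le> t" if "i \<in> vertices" for i
    using t vertex_filt_in_T[OF that] by blast
  have final_iff: "i \<in> final_vertices \<longleftrightarrow> i \<in> vertices \<and> evo.eldest t i = i" for i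
  proof
    assume "i \<in> final_vertices"
    then have "i \<in> vertices" "ereal t < death F i"
      using founder_vertex by (auto simp: final_vertices_def)
    then show "i \<in> vertices \<and> evo.eldest t i = i"
      using death_gt_iff_eldest filt by simp
  next
    assume i: "i \<in> vertices \<and> evo.eldest t i = i"
    then have "i \<in> evo.founders" using evo.eldest_founder[of i t] filt by simp
    moreover have "death F i = \<infinity>"
    proof (cases rule: death_cases[of i])
      case (2 d)
      \<comment> \<open>If \<open>i\<close> died at \<open>d\<close>, it would be dead at this
        level; but the prefix of cells here is the one at \<open>t\<close>, where \<open>i\<close>
        is eldest.\<close>
      let ?s = "max t d"
      have "idx_filt F n \<le> s" if "t \<le> s" "n < N" for n s
        using t that unfolding T_eq by (meson imageI lessThan_iff order_trans)
      then have "n < N \<and> idx_filt F n \<le> s \<longleftrightarrow> n < N" if "t \<le> s" for n s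
        using that by blast
      then have "level ?s = level t" by (simp add: level_def)
      then have "evo.eldest ?s i = i"
        using i filt[of i] eldest_eq_class_min[of i ?s] eldest_eq_class_min[of i t] by simp
      then have "ereal ?s < death F i"
        using death_gt_iff_eldest[of i ?s] i filt[of i] by simp
      then show ?thesis using 2 by simp
    qed
    ultimately show "i \<in> final_vertices" by (simp add: final_vertices_def)
  qed
  show ?thesis
    unfolding bij_betw_def
  proof
    show "inj_on (\<kappa> t) final_vertices"
    proof (rule inj_onI)
      fix i j assume "i \<in> final_vertices" "j \<in> final_vertices" "\<kappa> t i = \<kappa> t j"
      then show "i = j" using evo.eldest_cong[of t i j] final_iff by simp
    qed
    show "\<kappa> t ` final_vertices = connected_components_of (sublevel X g t)"
    proof (intro equalityI subsetI)
      fix C assume "C \<in> \<kappa> t ` final_vertices"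
      then show "C \<in> connected_components_of (sublevel X g t)"
        using final_iff \<kappa>_component(1) filt by auto
    next
      fix C assume "C \<in> connected_components_of (sublevel X g t)"
      then obtain i where i: "i \<in> vertices" "C = \<kappa> t i" by (auto simp: components_sublevel)
      note e = evo.eldest[OF i(1) filt[OF i(1)]]
      have "evo.eldest t i \<in> final_vertices"
        using e(1) evo.eldest_cong[OF e(3)] final_iff by simp
      then show "C \<in> \<kappa> t ` final_vertices" using i(2) e(3) by (metis imageI)
    qed
  qed
qed

lemma eventually_past_filtration: "\<forall>\<^sub>F t in at_top. \<forall>r\<in>T. r \<le> (t :: real)"
  using finite_T by (simp add: eventually_ball_finite_distrib eventually_ge_at_top)

text \<open>The two eventual properties hold together at some level, where the final vertices can be
  counted through the components.\<close>

lemma unique_root: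
  assumes "\<forall>\<^sub>F t in at_top. card (connected_components_of (sublevel X g t)) = 1"
  shows "\<exists>!r. rooted_in_tree (pairing_graph F) r"
proof -
  obtain t where t: "card (connected_components_of (sublevel X g t)) = 1" "\<forall>r\<in>T. r \<le> t"
    using eventually_happens'[OF _ eventually_conj[OF assms eventually_past_filtration]] by auto
  then have "card final_vertices = 1"
    using bij_betw_same_card[OF final_vertices_bij[OF t(2)]] by simp
  then obtain r where "final_vertices = {r}" by (rule card_1_singletonE)
  then show ?thesis by (rule forest.rooted_in_tree_unique_root)
qed

lemma roots_bij:
  "\<forall>\<^sub>F t in at_top. bij_betw (\<lambda>r. component_containing (sublevel X g t) (snd (iso_verts branch_iso r)))
    (forest_roots (pairing_graph F)) (connected_components_of (sublevel X g t))"
  using eventually_past_filtration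
proof (rule eventually_mono)
  fix t assume t: "\<forall>r\<in>T. r \<le> t"
  have "component_containing (sublevel X g t) (snd (iso_verts branch_iso r)) = \<kappa> t r"
    if "r \<in> final_vertices" for r
  proof -
    have r: "r \<in> vertices" using that founder_vertex by (simp add: final_vertices_def)
    then show ?thesis
      using component_containing_\<kappa>[OF r order_refl, of t] vertex_filt_in_T[OF r] t
      by (simp add: branch_iso_def evo.branch_of_def)
  qed
  then show "bij_betw (\<lambda>r. component_containing (sublevel X g t) (snd (iso_verts branch_iso r)))
      (forest_roots (pairing_graph F)) (connected_components_of (sublevel X g t))"
    unfolding forest.forest_roots
    using final_vertices_bij[OF t] by (subst bij_betw_cong) auto
qed

end

theorem proposition3p11:
  fixes X :: "'x topology" and g :: "'x \<Rightarrow> real"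
    and F :: "('a, 'c, 'k :: field) reduction_data"
    and \<theta> :: "real \<Rightarrow> 'a set \<Rightarrow> 'x set"
  assumes "continuous_map X euclideanreal g"
    and "\<And>a. locally_path_connected_space (sublevel X g a)"
    and "\<And>a. finite (connected_components_of (sublevel X g a))"
    and "\<exists>T. finite T \<and> changes_only_at X g T"
    and "valid_reduction_data F"
    and "component_evolution_agrees F X g \<theta>"
    and "zero_column_preserving_0 F"
  shows "\<exists>h. pre_digraph.digraph_isomorphism (pairing_graph F) h \<and>
      branch_graph F \<theta> X g = app_iso h (pairing_graph F) \<and>
      (\<forall>(u, v)\<in>arcs (pairing_graph F). transition_coeff F u v = 1) \<and>
      ((\<forall>\<^sub>F t in at_top. card (connected_components_of (sublevel X g t)) = 1) \<longrightarrow>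
        (\<exists>!r. rooted_in_tree (pairing_graph F) r)) \<and>
      ((\<forall>\<^sub>F t in at_top. card (connected_components_of (sublevel X g t)) \<ge> 2) \<longrightarrow>
        rooted_in_forest (pairing_graph F) \<and>
        (\<forall>\<^sub>F t in at_top.
          bij_betw (\<lambda>r. component_containing (sublevel X g t) (snd (iso_verts h r)))
            (forest_roots (pairing_graph F)) (connected_components_of (sublevel X g t))))"
proof -
  interpret zero_preserving_agreement F X g \<theta>
    using assms by unfold_locales
  have "\<forall>(u, v)\<in>arcs (pairing_graph F). transition_coeff F u v = 1"
    by (auto simp: pairing_graph_arcs transition_coeff_parent)
  then show ?thesis
    using digraph_isomorphism_branch_iso branch_graph_eq unique_root forest.rooted_in_forest roots_bij
    by (intro exI[of _ branch_iso]) blast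
qed

end
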